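(* Let $k,n$ be integers with $2\leq k<\frac{n}{2}$ and let $2<p\leq\frac{2n}{n-2k}$. There exists a positive constant $C$ such that for each $u\in C^{\infty}_{0}(\mathbb{B}^{n})$, \[ \int_{\mathbb{B}^{n}}(Q_{k}u)\,u\,dV\geq C\left(\int_{\mathbb{B}^{n}}|u|^{p}\,dV\right)^{\frac{2}{p}}. \]
   Context: $\mathbb{B}^{n}=\{x\in\mathbb{R}^{n}:|x|<1\}$ is the Poincaré ball model of hyperbolic space, with metric $ds^{2}=\frac{4(dx_1^2+\cdots+dx_n^2)}{(1-|x|^{2})^{2}}$, volume element $dV=\left(\frac{2}{1-|x|^{2}}\right)^{n}dx$ and Laplace-Beltrami operator $\Delta_{\mathbb{H}}=\frac{1-|x|^{2}}{4}\left\{(1-|x|^{2})\sum_{i=1}^{n}\frac{\partial^{2}}{\partial x_{i}^{2}}+2(n-2)\sum_{i=1}^{n}x_{i}\frac{\partial}{\partial x_{i}}\right\}$. Put $P_{1}=-\Delta_{\mathbb{H}}-\frac{n(n-2)}{4}$ and, for $k\ge 2$, \[ Q_{k}=\left(-\Delta_{\mathbb{H}}-\frac{(n-1)^{2}}{4}\right)(P_{1}+2)\cdots(P_{1}+k(k-1)), \] where the remaining factors are $P_1+i(i-1)$ for $i=2,\dots,k$. $C_0^\infty(\mathbb{B}^n)$ denotes smooth (real-valued) functions with compact support in the open ball. *)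

theory Defs
  imports "HOL-Analysis.Analysis"
begin

definition pderiv_at :: "'n::finite \<Rightarrow> (real ^ 'n \<Rightarrow> real) \<Rightarrow> real ^ 'n \<Rightarrow> real"
  where "pderiv_at i u x = deriv (\<lambda>t. u (x + t *\<^sub>R axis i 1)) 0"

primrec Ck_on :: "nat \<Rightarrow> (real ^ 'n) set \<Rightarrow> (real ^ 'n::finite \<Rightarrow> real) \<Rightarrow> bool"
  where
    "Ck_on 0 S u \<longleftrightarrow> continuous_on S u"
  | "Ck_on (Suc m) S u \<longleftrightarrow> (\<forall>x\<in>S. u differentiable (at x)) \<and> (\<forall>i. Ck_on m S (pderiv_at i u))"

abbreviation hyp_ball :: "(real ^ 'n::finite) set"
  where "hyp_ball \<equiv> ball 0 1"

text \<open>
  A function on the ball with compact support is represented by its extension by zero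
  to the whole space, so the support is the closure of the nonvanishing set.
\<close>

definition test_functions :: "(real ^ 'n::finite \<Rightarrow> real) set"
  where "test_functions =
    {u. (\<forall>m. Ck_on m hyp_ball u) \<and>
        compact (closure {x. u x \<noteq> 0}) \<and> closure {x. u x \<noteq> 0} \<subseteq> hyp_ball}"

definition hyp_vol :: "(real ^ 'n::finite) measure"
  where "hyp_vol =
    density (restrict_space lborel hyp_ball)
      (\<lambda>x. ennreal ((2 / (1 - (norm x)\<^sup>2)) ^ CARD('n)))"

definition hyp_laplace :: "(real ^ 'n::finite \<Rightarrow> real) \<Rightarrow> real ^ 'n \<Rightarrow> real"
  where "hyp_laplace u x =
    (1 - (norm x)\<^sup>2) / 4 *
      ((1 - (norm x)\<^sup>2) * (\<Sum>i\<in>UNIV. pderiv_at i (pderiv_at i u) x)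
       + 2 * (real CARD('n) - 2) * (\<Sum>i\<in>UNIV. x $ i * pderiv_at i u x))"

definition hyp_P1 :: "(real ^ 'n::finite \<Rightarrow> real) \<Rightarrow> real ^ 'n \<Rightarrow> real"
  where "hyp_P1 u x =
    - hyp_laplace u x - real CARD('n) * (real CARD('n) - 2) / 4 * u x"

text \<open>
  The product of operators is composition: the fold applies the factor with \<open>i = k\<close> first
  and the one with \<open>i = 2\<close> last. Intended for \<open>k \<ge> 2\<close>.
\<close>

definition hyp_Q :: "nat \<Rightarrow> (real ^ 'n::finite \<Rightarrow> real) \<Rightarrow> real ^ 'n \<Rightarrow> real"
  where "hyp_Q k u =
    (let v = foldr (\<lambda>i w x. hyp_P1 w x + real i * (real i - 1) * w x) [2..<Suc k] u
     in (\<lambda>x. - hyp_laplace v x - (real CARD('n) - 1)\<^sup>2 / 4 * v x))"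

end

theory Submission
  imports Defs
begin

text \<open>
  Put \<open>\<rho> x = (1 - |x|\<^sup>2) / 2\<close>, \<open>N\<close> for the dimension and \<open>A = - \<Delta>\<^sub>H - (N - 1)\<^sup>2 / 4\<close>, so that
  \<open>P\<^sub>1 + i (i - 1) = A + (i - 1/2)\<^sup>2\<close> and \<open>Q\<^sub>k\<close> is a polynomial in \<open>A\<close> without constant term whose
  other coefficients are at least 1. Since \<open>\<langle>A\<^sup>j u, u\<rangle> \<ge> 0\<close>, the form of \<open>Q\<^sub>k\<close> dominates
  \<open>\<langle>A\<^sup>j u, u\<rangle>\<close> for \<open>1 \<le> j \<le> k\<close>.

  For \<open>k = 1\<close> the substitution \<open>u = \<rho> powr ((N - 1) / 2) * v\<close> turns \<open>\<langle>A u, u\<rangle>\<close> into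
  \<open>\<integral> \<rho> |\<nabla>v|\<^sup>2 + (N - 1) / 2 \<integral> v\<^sup>2\<close>. The weighted Sobolev inequality needed for it follows from an
  \<open>L\<^sup>1\<close> inequality for \<open>|v| powr s\<close>, with \<open>s = (p + 2) / 2\<close> chosen such that the
  Cauchy-Schwarz inequality closes; the \<open>L\<^sup>1\<close> inequality interpolates between a Hardy inequality and
  the Gagliardo-Nirenberg inequality applied to \<open>\<rho> powr a * |v| powr s\<close>.

  Inserting \<open>|u| powr s\<close> with \<open>s > 1\<close> into the case \<open>k = 1\<close> bounds the \<open>L\<^sup>r\<close> norm of \<open>u\<close> by the
  \<open>L\<^sup>q\<close> norm of \<open>A u\<close> and a lower norm of \<open>u\<close>, where \<open>1 / r = 1 / q - 2 / N\<close>. Iterating this from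
  \<open>q = 2\<close> or from \<open>q = 2 N / (N - 2)\<close> reaches the exponent \<open>2 N / (N - 2 k)\<close>.
\<close>

section \<open>Hoelder inequality and grid-line integrals\<close>

text \<open>The difficulty is that 0 is the bottom of the spectrum of \<open>A\<close>: as Q_k has
  no constant term, its form controls no multiple of the hyperbolic L2 norm. For k = 1 the loss is
  made up by the square of v that the substitution leaves over; it amounts to the integral of rho *
  u^2 against dV, which is weaker than the L2 norm near the boundary but sufficient because p > 2.
  In the iteration the lower norm cannot be the L2 norm either. It is the one with exponent 2 N / (N
  - 2), which the first moment of \<open>A\<close> controls. So all p up to 2 N / (N - 2) come from
  the case k = 1 alone, and larger p by interpolation between 2 N / (N - 2) and 2 N / (N - 2 k). An
  iteration step is applied to A u, whose moments are those of u moved up by two; hence one starting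
  point for even k and one for odd k. Throughout, integration by parts against powers of u takes the
  place of Green functions and harmonic analysis on hyperbolic space.\<close>

lemma weighted_arith_geom_mean:
  fixes a x :: "'i \<Rightarrow> real"
  assumes J: "finite J" and a: "\<And>j. j \<in> J \<Longrightarrow> a j > 0" and sum: "sum a J = 1"
    and x: "\<And>j. j \<in> J \<Longrightarrow> x j \<ge> 0"
  shows "(\<Prod>j\<in>J. x j powr a j) \<le> (\<Sum>j\<in>J. a j * x j)"
proof (cases "\<exists>j\<in>J. x j = 0")
  case True
  then have "(\<Prod>j\<in>J. x j powr a j) = 0"
    using J by (auto intro: prod_zero)
  also have "0 \<le> (\<Sum>j\<in>J. a j * x j)"
    by (intro sum_nonneg mult_nonneg_nonneg) (auto simp: x a less_imp_le)
  finally show ?thesis .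
next
  case False
  then have pos: "x j > 0" if "j \<in> J" for j using x[OF that] that by (metis less_eq_real_def)
  have "J \<noteq> {}" using sum by auto
  have "(\<Prod>j\<in>J. x j powr a j) = exp (\<Sum>j\<in>J. a j *\<^sub>R ln (x j))"
    using J pos by (auto simp: exp_sum powr_def intro!: prod.cong dest: less_imp_neq[OF pos])
  also have "\<dots> \<le> (\<Sum>j\<in>J. a j * exp (ln (x j)))"
    by (rule convex_on_sum[OF J \<open>J \<noteq> {}\<close> exp_convex sum]) (auto simp: a less_imp_le)
  also have "\<dots> = (\<Sum>j\<in>J. a j * x j)"
    using pos by (intro sum.cong) auto
  finally show ?thesis .
qed

text \<open>
  The powers of 0 differ from those of \<open>powr\<close>: the exponent 0 must give 1, since it occurs on the
  left-hand side of the grid-line inequality when that is applied in full dimension.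
\<close>

definition epow :: "ennreal \<Rightarrow> real \<Rightarrow> ennreal"
  where "epow x a = (if a = 0 then 1 else if x = \<infinity> then \<infinity> else ennreal (enn2real x powr a))"

lemma epow_0 [simp]: "epow x 0 = 1" by (simp add: epow_def)
lemma epow_zero [simp]: "a \<noteq> 0 \<Longrightarrow> epow 0 a = 0" by (simp add: epow_def)

lemma epow_ennreal: "x \<ge> 0 \<Longrightarrow> a \<noteq> 0 \<Longrightarrow> epow (ennreal x) a = ennreal (x powr a)"
  by (simp add: epow_def)

lemma epow_measurable [measurable]:
  assumes [measurable]: "f \<in> borel_measurable M"
  shows "(\<lambda>x. epow (f x) a) \<in> borel_measurable M"
  unfolding epow_def by measurable

lemma epow_add: "a \<ge> 0 \<Longrightarrow> b \<ge> 0 \<Longrightarrow> epow x (a + b) = epow x a * epow x b"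
  by (auto simp: epow_def powr_add ennreal_mult'' ennreal_mult_eq_top_iff)

lemma epow_mono: "a \<ge> 0 \<Longrightarrow> x \<le> y \<Longrightarrow> epow x a \<le> epow y a"
  by (auto simp: epow_def top_unique less_top intro!: ennreal_leI powr_mono2 enn2real_mono)

lemma epow_eq_0_iff: "epow x a = 0 \<longleftrightarrow> a \<noteq> 0 \<and> x = 0"
  by (cases x) (auto simp: epow_def ennreal_eq_0_iff)

text \<open>Dividing each \<open>f j\<close> by its integral reduces the claim to the weighted
  arithmetic-geometric mean inequality, whose right-hand side then integrates to the sum of the
  weights, that is to 1. The division needs integrals that are neither 0 nor infinite, hence the
  case split: a vanishing integral makes the left side 0, and if none vanishes, an infinite one
  makes the right side infinite.\<close>

lemma nn_integral_Holder_pos: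
  assumes J: "finite J" and a: "\<And>j. j \<in> J \<Longrightarrow> a j > 0" and sum: "sum a J = 1"
    and f[measurable]: "\<And>j. j \<in> J \<Longrightarrow> f j \<in> borel_measurable M"
  shows "(\<integral>\<^sup>+x. (\<Prod>j\<in>J. epow (f j x) (a j)) \<partial>M) \<le> (\<Prod>j\<in>J. epow (\<integral>\<^sup>+x. f j x \<partial>M) (a j))"
proof -
  consider (zero) j where "j \<in> J" "(\<integral>\<^sup>+x. f j x \<partial>M) = 0"
    | (inf) i where "\<And>j. j \<in> J \<Longrightarrow> (\<integral>\<^sup>+x. f j x \<partial>M) \<noteq> 0" "i \<in> J" "(\<integral>\<^sup>+x. f i x \<partial>M) = \<infinity>"
    | (fin) "\<And>j. j \<in> J \<Longrightarrow> (\<integral>\<^sup>+x. f j x \<partial>M) \<noteq> 0" "\<And>j. j \<in> J \<Longrightarrow> (\<integral>\<^sup>+x. f j x \<partial>M) \<noteq> \<infinity>"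
    by blast
  then show ?thesis
  proof cases
    case zero
    then have "AE x in M. f j x = 0"
      by (subst (asm) nn_integral_0_iff_AE) auto
    then have "AE x in M. (\<Prod>j\<in>J. epow (f j x) (a j)) = 0"
      by eventually_elim (use zero J a[of j] in \<open>auto intro!: prod_zero bexI[of _ j]\<close>)
    then have "(\<integral>\<^sup>+x. (\<Prod>j\<in>J. epow (f j x) (a j)) \<partial>M) = 0"
      by (subst nn_integral_cong_AE[where v="\<lambda>_. 0"]) auto
    then show ?thesis by simp
  next
    case inf
    have "(\<Prod>j\<in>J. epow (\<integral>\<^sup>+x. f j x \<partial>M) (a j))
       = epow (\<integral>\<^sup>+x. f i x \<partial>M) (a i) * (\<Prod>j\<in>J-{i}. epow (\<integral>\<^sup>+x. f j x \<partial>M) (a j))"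
      by (rule prod.remove[OF J inf(2)])
    moreover have "(\<Prod>j\<in>J-{i}. epow (\<integral>\<^sup>+x. f j x \<partial>M) (a j)) \<noteq> 0"
      using J inf(1) by (auto simp: epow_eq_0_iff)
    moreover have "epow (\<integral>\<^sup>+x. f i x \<partial>M) (a i) = \<infinity>"
      using a[OF inf(2)] inf(3) by (simp add: epow_def)
    ultimately have "(\<Prod>j\<in>J. epow (\<integral>\<^sup>+x. f j x \<partial>M) (a j)) = \<infinity>"
      by (simp add: ennreal_top_mult)
    then show ?thesis by simp
  next
    case fin
    define c where "c j = enn2real (\<integral>\<^sup>+x. f j x \<partial>M)" for j
    have c: "c j > 0" "(\<integral>\<^sup>+x. f j x \<partial>M) = ennreal (c j)" if "j \<in> J" for j
      using fin[OF that] unfolding c_def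
      by (auto simp: enn2real_positive_iff less_top zero_less_iff_neq_zero)
    define P where "P = (\<Prod>j\<in>J. c j powr a j)"
    have P: "P > 0" unfolding P_def using c(1) by (intro prod_pos) (auto dest: c(1))
    have pt: "(\<Prod>j\<in>J. epow (f j x) (a j)) \<le> ennreal P * (\<Sum>j\<in>J. ennreal (a j / c j) * f j x)" for x
    proof (cases "\<exists>i\<in>J. f i x = \<infinity>")
      case True
      then obtain i where i: "i \<in> J" "f i x = \<infinity>" by blast
      have "ennreal (a i / c i) * f i x = \<infinity>"
        using a[OF i(1)] c(1)[OF i(1)] i(2) by (simp add: ennreal_mult_top)
      then have "(\<Sum>j\<in>J. ennreal (a j / c j) * f j x) = \<infinity>"
        using i(1) J by (auto simp: sum.remove[OF J i(1)])
      then show ?thesis using P by (simp add: ennreal_mult_top)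
    next
      case False
      define y where "y j = enn2real (f j x)" for j
      have y: "f j x = ennreal (y j)" "y j \<ge> 0" if "j \<in> J" for j
        using False that by (auto simp: y_def less_top)
      have "(\<Prod>j\<in>J. epow (f j x) (a j)) = (\<Prod>j\<in>J. ennreal (y j powr a j))"
        using y less_imp_neq[OF a] by (intro prod.cong refl) (metis epow_ennreal)
      also have "\<dots> = ennreal (\<Prod>j\<in>J. y j powr a j)" by (simp add: prod_ennreal)
      also have "(\<Prod>j\<in>J. y j powr a j) = P * (\<Prod>j\<in>J. (y j / c j) powr a j)"
        unfolding P_def prod.distrib[symmetric]
      proof (intro prod.cong refl)
        fix j assume "j \<in> J"
        then show "y j powr a j = c j powr a j * (y j / c j) powr a j"
          using c(1)[of j] y(2)[of j] by (simp add: powr_divide)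
      qed
      also have "ennreal \<dots> \<le> ennreal (P * (\<Sum>j\<in>J. a j * (y j / c j)))"
        using P c(1) y(2)
        by (intro ennreal_leI mult_left_mono weighted_arith_geom_mean J a sum) (auto simp: less_imp_le)
      also have "\<dots> = ennreal P * (\<Sum>j\<in>J. ennreal (a j / c j * y j))"
        using P a c(1) y(2) by (subst sum_ennreal) (auto simp: ennreal_mult' less_imp_le)
      also have "(\<Sum>j\<in>J. ennreal (a j / c j * y j)) = (\<Sum>j\<in>J. ennreal (a j / c j) * f j x)"
        using a c(1) y
        by (intro sum.cong refl) (simp add: less_imp_le ennreal_mult' [symmetric] del: times_divide_eq_left)
      finally show ?thesis .
    qed
    have "(\<integral>\<^sup>+x. (\<Prod>j\<in>J. epow (f j x) (a j)) \<partial>M)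
      \<le> (\<integral>\<^sup>+x. ennreal P * (\<Sum>j\<in>J. ennreal (a j / c j) * f j x) \<partial>M)"
      by (intro nn_integral_mono pt)
    also have "\<dots> = ennreal P * (\<Sum>j\<in>J. ennreal (a j / c j) * (\<integral>\<^sup>+x. f j x \<partial>M))"
      using J by (simp add: nn_integral_cmult nn_integral_sum)
    also have "(\<Sum>j\<in>J. ennreal (a j / c j) * (\<integral>\<^sup>+x. f j x \<partial>M)) = (\<Sum>j\<in>J. ennreal (a j))"
    proof (intro sum.cong refl)
      fix j assume j: "j \<in> J"
      have "ennreal (a j / c j) * ennreal (c j) = ennreal (a j / c j * c j)"
        using a[OF j] c(1)[OF j] by (intro ennreal_mult [symmetric]) auto
      then show "ennreal (a j / c j) * (\<integral>\<^sup>+x. f j x \<partial>M) = ennreal (a j)"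
        using c[OF j] by simp
    qed
    also have "\<dots> = 1" using sum a by (subst sum_ennreal) (auto simp: less_imp_le)
    also have "ennreal P * 1 = (\<Prod>j\<in>J. epow (\<integral>\<^sup>+x. f j x \<partial>M) (a j))"
      unfolding P_def mult_1_right
      by (subst prod_ennreal[symmetric], simp, intro prod.cong refl)
         (metis c epow_ennreal less_imp_le less_imp_neq[OF a])
    finally show ?thesis .
  qed
qed

lemma nn_integral_Holder:
  assumes J: "finite J" and a: "\<And>j. j \<in> J \<Longrightarrow> a j \<ge> 0" and sum: "sum a J = 1"
    and f: "\<And>j. j \<in> J \<Longrightarrow> f j \<in> borel_measurable M"
  shows "(\<integral>\<^sup>+x. (\<Prod>j\<in>J. epow (f j x) (a j)) \<partial>M) \<le> (\<Prod>j\<in>J. epow (\<integral>\<^sup>+x. f j x \<partial>M) (a j))"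
proof -
  \<comment> \<open>Factors with exponent 0 equal 1 on both sides, whatever \<open>f j\<close> and
    its integral are.\<close>
  define J' where "J' = {j\<in>J. a j > 0}"
  have eq: "(\<Prod>j\<in>J. epow (g j) (a j)) = (\<Prod>j\<in>J'. epow (g j) (a j))" for g
    using J a by (intro prod.mono_neutral_right) (auto simp: J'_def less_le)
  have "sum a J' = 1"
    unfolding sum[symmetric] using J a
    by (intro sum.mono_neutral_left) (auto simp: J'_def less_le)
  then show ?thesis
    unfolding eq using J f by (intro nn_integral_Holder_pos) (auto simp: J'_def)
qed

text \<open>
  The exponents are arranged so that integrating out one coordinate with Hoelder's inequality
  reproduces the inequality for the marginal of \<open>f\<close> in the remaining coordinates.
\<close>

lemma (in product_sigma_finite) nn_integral_grid_lines:
  assumes "finite S" and "f \<in> borel_measurable (Pi\<^sub>M S M)"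
    and p: "p \<ge> 0" and "(real (card S) - 1) * p \<le> 1"
  shows "(\<integral>\<^sup>+x. epow (f x) (1 - (real (card S) - 1) * p) *
            (\<Prod>j\<in>S. epow (\<integral>\<^sup>+t. f (x(j := t)) \<partial>M j) p) \<partial>Pi\<^sub>M S M)
         \<le> epow (\<integral>\<^sup>+x. f x \<partial>Pi\<^sub>M S M) (1 + p)"
  using assms(1,2,4)
proof (induction S arbitrary: f)
  case empty
  then show ?case by (simp add: nn_integral_empty)
next
  case (insert i S)
  note f[measurable] = insert.prems(1)
  note [simp] = insert.hyps
  define q where "q = 1 - real (card S) * p"
  have q: "q \<ge> 0" "q = 1 - (real (card (insert i S)) - 1) * p"
    using insert.prems(2) by (auto simp: q_def)
  define g where "g x = (\<integral>\<^sup>+t. f (x(i := t)) \<partial>M i)" for x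
  have g[measurable]: "g \<in> borel_measurable (Pi\<^sub>M S M)"
    unfolding g_def by measurable
  have upd2: "(\<lambda>(v, t). v(j := t)) \<in> Pi\<^sub>M (insert i S) M \<Otimes>\<^sub>M M j \<rightarrow>\<^sub>M Pi\<^sub>M (insert i S) M"
    if "j \<in> insert i S" for j
    using measurable_add_dim[of j "insert i S" M] insert_absorb[OF that] by simp
  have meas_line: "(\<lambda>x. \<integral>\<^sup>+t. f (x(j := t)) \<partial>M j) \<in> borel_measurable (Pi\<^sub>M (insert i S) M)"
    if "j \<in> insert i S" for j
    using measurable_compose[OF upd2[OF that] f]
    by (intro borel_measurable_nn_integral) (simp add: case_prod_beta' fun_upd_def)
  have whole: "(\<lambda>x. epow (f x) q * (\<Prod>j\<in>insert i S. epow (\<integral>\<^sup>+t. f (x(j := t)) \<partial>M j) p))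
        \<in> borel_measurable (Pi\<^sub>M (insert i S) M)"
    using meas_line by measurable
  have "(\<integral>\<^sup>+x. epow (f x) q * (\<Prod>j\<in>insert i S. epow (\<integral>\<^sup>+t. f (x(j := t)) \<partial>M j) p) \<partial>Pi\<^sub>M (insert i S) M)
     = (\<integral>\<^sup>+x. \<integral>\<^sup>+y. epow (f (x(i := y))) q *
          (\<Prod>j\<in>insert i S. epow (\<integral>\<^sup>+t. f (x(i := y, j := t)) \<partial>M j) p) \<partial>M i \<partial>Pi\<^sub>M S M)"
    by (rule product_nn_integral_insert[OF _ _ whole]) auto
  also have "\<dots> \<le> (\<integral>\<^sup>+x. epow (g x) (1 - (real (card S) - 1) * p) *
            (\<Prod>j\<in>S. epow (\<integral>\<^sup>+t. g (x(j := t)) \<partial>M j) p) \<partial>Pi\<^sub>M S M)"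
  proof (rule nn_integral_mono)
    fix x assume x: "x \<in> space (Pi\<^sub>M S M)"
    have upd3: "(\<lambda>y. x(i := y)) \<in> M i \<rightarrow>\<^sub>M Pi\<^sub>M (insert i S) M"
      using x by (intro measurable_component_update) auto
    have fi[measurable]: "(\<lambda>y. f (x(i := y))) \<in> borel_measurable (M i)"
      using measurable_compose[OF upd3 f] .
    have fij[measurable]: "(\<lambda>(y, t). f (x(i := y, j := t))) \<in> borel_measurable (M i \<Otimes>\<^sub>M M j)"
      if "j \<in> S" for j
    proof -
      have "(\<lambda>(y, t). (x(i := y), t)) \<in> M i \<Otimes>\<^sub>M M j \<rightarrow>\<^sub>M Pi\<^sub>M (insert i S) M \<Otimes>\<^sub>M M j"
        using upd3 by measurable
      from measurable_compose[OF this measurable_compose[OF upd2 f]] that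
      show ?thesis by (simp add: case_prod_beta' fun_upd_def split_def cong: if_cong)
    qed
    \<comment> \<open>Hoelder is applied in the variable \<open>y\<close> to \<open>f\<close> itself
      with exponent \<open>q\<close> and, for each \<open>j\<close> in \<open>S\<close>, to the line
      integral in direction \<open>j\<close> with exponent \<open>p\<close>; the exponents add up to
      q + card S * p = 1.\<close>
    define F where "F j y = (if j = i then f (x(i := y)) else (\<integral>\<^sup>+t. f (x(i := y, j := t)) \<partial>M j))" for j y
    have F[measurable]: "F j \<in> borel_measurable (M i)" if "j \<in> insert i S" for j
    proof (cases "j = i")
      case False
      then have "j \<in> S" using that by simp
      from sigma_finite_measure.borel_measurable_nn_integral[OF sigma_finite_measures fij[OF this]]
      show ?thesis using False by (simp add: F_def[abs_def])
    qed (simp add: F_def[abs_def])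
    have ni: "j \<noteq> i" if "j \<in> S" for j using that insert.hyps by auto
    \<comment> \<open>The line integral in direction \<open>i\<close> does not depend on
      \<open>y\<close>, so it can leave the integral as the constant
      \<open>epow (g x) p\<close>.\<close>
    have 1: "epow (f (x(i := y))) q * (\<Prod>j\<in>insert i S. epow (\<integral>\<^sup>+t. f (x(i := y, j := t)) \<partial>M j) p)
       = epow (g x) p * (\<Prod>j\<in>insert i S. epow (F j y) (if j = i then q else p))" for y
    proof -
      have "(\<Prod>j\<in>S. epow (F j y) (if j = i then q else p)) = (\<Prod>j\<in>S. epow (\<integral>\<^sup>+t. f (x(i := y, j := t)) \<partial>M j) p)"
        by (intro prod.cong) (auto simp: F_def dest: ni)
      then show ?thesis by (simp add: F_def g_def mult_ac)
    qed
    have 2: "(\<integral>\<^sup>+y. (\<Prod>j\<in>insert i S. epow (F j y) (if j = i then q else p)) \<partial>M i)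
        \<le> (\<Prod>j\<in>insert i S. epow (\<integral>\<^sup>+y. F j y \<partial>M i) (if j = i then q else p))"
    proof (rule nn_integral_Holder)
      have "(\<Sum>j\<in>S. if j = i then q else p) = (\<Sum>j\<in>S. p)"
        by (intro sum.cong) (auto dest: ni)
      then show "(\<Sum>j\<in>insert i S. if j = i then q else p) = 1" by (simp add: q_def)
    qed (use q p F in auto)
    have 3: "(\<integral>\<^sup>+y. F j y \<partial>M i) = (\<integral>\<^sup>+t. g (x(j := t)) \<partial>M j)" if "j \<in> S" for j
    proof -
      interpret pair_sigma_finite "M i" "M j"
        by (simp add: pair_sigma_finite.intro sigma_finite_measures)
      have "(\<integral>\<^sup>+y. F j y \<partial>M i) = (\<integral>\<^sup>+y. \<integral>\<^sup>+t. f (x(i := y, j := t)) \<partial>M j \<partial>M i)"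
        using ni[OF that] by (simp add: F_def)
      also have "\<dots> = (\<integral>\<^sup>+t. \<integral>\<^sup>+y. f (x(i := y, j := t)) \<partial>M i \<partial>M j)"
        using Fubini'[OF fij[OF that]] by simp
      also have "\<dots> = (\<integral>\<^sup>+t. g (x(j := t)) \<partial>M j)"
        unfolding g_def using ni[OF that] by (simp add: fun_upd_twist)
      finally show ?thesis .
    qed
    have "(\<integral>\<^sup>+y. epow (f (x(i := y))) q *
          (\<Prod>j\<in>insert i S. epow (\<integral>\<^sup>+t. f (x(i := y, j := t)) \<partial>M j) p) \<partial>M i)
        = epow (g x) p * (\<integral>\<^sup>+y. (\<Prod>j\<in>insert i S. epow (F j y) (if j = i then q else p)) \<partial>M i)"
      unfolding 1 by (rule nn_integral_cmult) measurable
    also have "\<dots> \<le> epow (g x) p * (\<Prod>j\<in>insert i S. epow (\<integral>\<^sup>+y. F j y \<partial>M i) (if j = i then q else p))"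
      by (intro mult_left_mono 2) auto
    also have "(\<Prod>j\<in>insert i S. epow (\<integral>\<^sup>+y. F j y \<partial>M i) (if j = i then q else p))
       = epow (g x) q * (\<Prod>j\<in>S. epow (\<integral>\<^sup>+t. g (x(j := t)) \<partial>M j) p)"
    proof -
      have "(\<Prod>j\<in>S. epow (\<integral>\<^sup>+y. F j y \<partial>M i) (if j = i then q else p))
        = (\<Prod>j\<in>S. epow (\<integral>\<^sup>+t. g (x(j := t)) \<partial>M j) p)"
        by (intro prod.cong) (auto simp: 3 dest: ni)
      then show ?thesis by (simp add: F_def g_def)
    qed
    \<comment> \<open>The sum p + q is the exponent that the induction hypothesis for
      \<open>g\<close> asks for.\<close>
    also have "epow (g x) p * (epow (g x) q * (\<Prod>j\<in>S. epow (\<integral>\<^sup>+t. g (x(j := t)) \<partial>M j) p))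
       = epow (g x) (1 - (real (card S) - 1) * p) * (\<Prod>j\<in>S. epow (\<integral>\<^sup>+t. g (x(j := t)) \<partial>M j) p)"
      using q p by (simp add: mult.assoc[symmetric] epow_add[symmetric]) (simp add: q_def algebra_simps)
    finally show "(\<integral>\<^sup>+y. epow (f (x(i := y))) q *
          (\<Prod>j\<in>insert i S. epow (\<integral>\<^sup>+t. f (x(i := y, j := t)) \<partial>M j) p) \<partial>M i) \<le> \<dots>" .
  qed
  also have "\<dots> \<le> epow (\<integral>\<^sup>+x. g x \<partial>Pi\<^sub>M S M) (1 + p)"
  proof (rule insert.IH[OF g])
    show "(real (card S) - 1) * p \<le> 1" using insert.prems(2) p by (simp add: algebra_simps)
  qed
  also have "(\<integral>\<^sup>+x. g x \<partial>Pi\<^sub>M S M) = (\<integral>\<^sup>+x. f x \<partial>Pi\<^sub>M (insert i S) M)"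
    unfolding g_def by (rule product_nn_integral_insert[symmetric]) auto
  finally show ?case unfolding q(2) .
qed

section \<open>The Gagliardo-Nirenberg inequality\<close>

text \<open>Continuity is asked on \<open>S\<close> only, vanishing on the whole space. A factor
  that is singular at the boundary of \<open>S\<close>, such as a negative power of
  \<open>rho\<close>, can therefore be multiplied in by showing its continuity on \<open>S\<close>;
  for open \<open>S\<close>, \<open>Cc_extend\<close> recovers continuity everywhere.\<close>

definition Cc :: "'a::euclidean_space set \<Rightarrow> ('a \<Rightarrow> 'b::real_normed_vector) \<Rightarrow> bool"
  where "Cc S f \<longleftrightarrow> continuous_on S f \<and> (\<exists>K. compact K \<and> K \<subseteq> S \<and> (\<forall>x. x \<notin> K \<longrightarrow> f x = 0))"

text \<open>The gradient is an argument of its own because explicit formulas for it are needed after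
  multiplication by a weight or composition with a power.\<close>

definition C1c :: "'a::euclidean_space set \<Rightarrow> ('a \<Rightarrow> real) \<Rightarrow> ('a \<Rightarrow> 'a) \<Rightarrow> bool"
  where "C1c S f f' \<longleftrightarrow> (\<forall>x. (f has_derivative (\<lambda>h. f' x \<bullet> h)) (at x)) \<and> Cc S f \<and> Cc S f'"

lemma Cc_transfer:
  assumes "Cc S f" "continuous_on S g" "\<And>x. f x = 0 \<Longrightarrow> g x = 0"
  shows "Cc S g"
  using assms unfolding Cc_def by blast

lemma Cc_continuous_on: "Cc S f \<Longrightarrow> continuous_on S f"
  by (simp add: Cc_def)

lemma Cc_add:
  fixes f g :: "'a::euclidean_space \<Rightarrow> 'b::real_normed_vector"
  assumes "Cc S f" "Cc S g" shows "Cc S (\<lambda>x. f x + g x)"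
proof -
  obtain K L where "compact K" "K \<subseteq> S" "\<forall>x. x \<notin> K \<longrightarrow> f x = 0" "compact L" "L \<subseteq> S" "\<forall>x. x \<notin> L \<longrightarrow> g x = 0"
    using assms unfolding Cc_def by blast
  then have "compact (K \<union> L)" "K \<union> L \<subseteq> S" "\<forall>x. x \<notin> K \<union> L \<longrightarrow> f x + g x = 0" by auto
  then show ?thesis using assms unfolding Cc_def by (blast intro: continuous_on_add)
qed

lemma Cc_mult:
  fixes f g :: "'a::euclidean_space \<Rightarrow> real"
  shows "Cc S f \<Longrightarrow> continuous_on S g \<Longrightarrow> Cc S (\<lambda>x. f x * g x)"
    and "Cc S f \<Longrightarrow> continuous_on S g \<Longrightarrow> Cc S (\<lambda>x. g x * f x)"
  by (auto intro!: Cc_transfer[of S f] continuous_intros dest: Cc_continuous_on)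

lemma Cc_scaleR:
  fixes g :: "'a::euclidean_space \<Rightarrow> 'b::real_normed_vector"
  shows "Cc S f \<Longrightarrow> continuous_on S g \<Longrightarrow> Cc S (\<lambda>x. f x *\<^sub>R g x)"
    and "Cc S g \<Longrightarrow> continuous_on S f \<Longrightarrow> Cc S (\<lambda>x. f x *\<^sub>R g x)"
   apply (rule Cc_transfer[of S f]; auto intro: continuous_intros dest: Cc_continuous_on)
  apply (rule Cc_transfer[of S g]; auto intro: continuous_intros dest: Cc_continuous_on)
  done

lemma Cc_integrable:
  fixes f :: "'a::euclidean_space \<Rightarrow> 'b::euclidean_space"
  assumes "Cc S f" shows "integrable lborel f"
proof -
  obtain K where K: "compact K" "K \<subseteq> S" "\<forall>x. x \<notin> K \<longrightarrow> f x = 0" using assms by (auto simp: Cc_def)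
  have "integrable lborel (\<lambda>x. indicator K x *\<^sub>R f x)"
    using K assms by (intro borel_integrable_compact) (auto simp: Cc_def intro: continuous_on_subset)
  also have "(\<lambda>x. indicator K x *\<^sub>R f x) = f"
    using K by (auto simp: indicator_def fun_eq_iff)
  finally show ?thesis .
qed

lemma Cc_extend:
  assumes "Cc S f" "open S" shows "continuous_on UNIV f"
proof -
  obtain K where K: "compact K" "K \<subseteq> S" "\<forall>x. x \<notin> K \<longrightarrow> f x = 0" using assms by (auto simp: Cc_def)
  have "continuous_on (S \<union> - K) f"
  proof (rule continuous_on_open_Un)
    show "open S" "open (- K)" using assms K by (auto simp: compact_imp_closed)
    show "continuous_on S f" using assms by (simp add: Cc_def)
    show "continuous_on (- K) f" using K by (auto intro: continuous_on_eq[OF continuous_on_const[of _ 0]])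
  qed
  moreover have "S \<union> - K = UNIV" using K by auto
  ultimately show ?thesis by simp
qed

lemma Cc_mono: "Cc S f \<Longrightarrow> open S \<Longrightarrow> S \<subseteq> T \<Longrightarrow> Cc T f"
  using Cc_extend[of S f] continuous_on_subset[of UNIV f T] unfolding Cc_def by auto

lemma C1c_mono: "C1c S f f' \<Longrightarrow> open S \<Longrightarrow> S \<subseteq> T \<Longrightarrow> C1c T f f'"
  unfolding C1c_def by (auto intro: Cc_mono)

lemma C1cD:
  assumes "C1c S f f'"
  shows "(f has_derivative (\<lambda>h. f' x \<bullet> h)) (at x)" "Cc S f" "Cc S f'"
  using assms by (auto simp: C1c_def)

lemma C1c_common_support:
  assumes "C1c S f f'"
  shows "\<exists>K. compact K \<and> K \<subseteq> S \<and> (\<forall>x. x \<notin> K \<longrightarrow> f x = 0) \<and> (\<forall>x. x \<notin> K \<longrightarrow> f' x = 0)"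
proof -
  obtain K L where "compact K" "K \<subseteq> S" "\<forall>x. x \<notin> K \<longrightarrow> f x = 0" "compact L" "L \<subseteq> S" "\<forall>x. x \<notin> L \<longrightarrow> f' x = 0"
    using C1cD(2,3)[OF assms] unfolding Cc_def by blast
  then have "compact (K \<union> L)" "K \<union> L \<subseteq> S" "\<forall>x. x \<notin> K \<union> L \<longrightarrow> f x = 0" "\<forall>x. x \<notin> K \<union> L \<longrightarrow> f' x = 0"
    by auto
  then show ?thesis by blast
qed

text \<open>Nothing is known of \<open>g\<close> outside \<open>S\<close>. There the product is
  differentiable because it vanishes on the complement of the common support \<open>K\<close>, which
  is open and together with \<open>S\<close> covers the space.\<close>

lemma C1c_mult:
  assumes S: "open S" and f: "C1c S f f'"
    and g: "\<And>x. x \<in> S \<Longrightarrow> (g has_derivative (\<lambda>h. g' x \<bullet> h)) (at x)" and g': "continuous_on S g'"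
  shows "C1c S (\<lambda>x. g x * f x) (\<lambda>x. g x *\<^sub>R f' x + f x *\<^sub>R g' x)"
proof -
  obtain K where K: "compact K" "K \<subseteq> S" "\<And>x. x \<notin> K \<Longrightarrow> f x = 0" "\<And>x. x \<notin> K \<Longrightarrow> f' x = 0"
    using C1c_common_support[OF f] by blast
  have gc: "continuous_on S g"
    using g by (meson continuous_at_imp_continuous_on has_derivative_continuous)
  have "((\<lambda>x. g x * f x) has_derivative (\<lambda>h. (g x *\<^sub>R f' x + f x *\<^sub>R g' x) \<bullet> h)) (at x)" for x
  proof (cases "x \<in> S")
    case True
    show ?thesis
      by (rule has_derivative_eq_rhs[OF has_derivative_mult[OF g[OF True] C1cD(1)[OF f]]])
         (auto simp: inner_add_left)
  next
    case False
    then have x: "x \<in> - K" using K by auto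
    have "((\<lambda>x. 0) has_derivative (\<lambda>h. 0)) (at x)" by simp
    then have "((\<lambda>x. g x * f x) has_derivative (\<lambda>h. 0)) (at x)"
      by (rule has_derivative_transform_within_open[OF _ _ x])
         (use K in \<open>auto simp: compact_imp_closed\<close>)
    then show ?thesis using x K by simp
  qed
  then show ?thesis
    unfolding C1c_def
    using Cc_add[OF Cc_scaleR(2)[OF C1cD(3)[OF f] gc] Cc_scaleR(1)[OF C1cD(2)[OF f] g']]
      Cc_mult(2)[OF C1cD(2)[OF f] gc] by blast
qed

lemma C1c_compose:
  assumes f: "C1c S f f'" and e: "\<And>t. (e has_real_derivative e' t) (at t)" "continuous_on UNIV e'" "e 0 = 0"
  shows "C1c S (\<lambda>x. e (f x)) (\<lambda>x. e' (f x) *\<^sub>R f' x)"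
  unfolding C1c_def
proof (intro conjI allI)
  fix x
  show "((\<lambda>x. e (f x)) has_derivative (\<lambda>h. (e' (f x) *\<^sub>R f' x) \<bullet> h)) (at x)"
    using has_derivative_compose[OF C1cD(1)[OF f], of e "(*) (e' (f x))"] e(1)
    by (simp add: has_field_derivative_def)
  have ec: "continuous_on UNIV e"
    using e(1) by (meson DERIV_isCont continuous_at_imp_continuous_on)
  show "Cc S (\<lambda>x. e (f x))"
    by (rule Cc_transfer[OF C1cD(2)[OF f]])
       (simp_all add: e(3) continuous_on_compose2[OF ec Cc_continuous_on[OF C1cD(2)[OF f]]])
  show "Cc S (\<lambda>x. e' (f x) *\<^sub>R f' x)"
    by (intro Cc_scaleR C1cD(3)[OF f] continuous_on_compose2[OF e(2)] Cc_continuous_on C1cD(2)[OF f]) auto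
qed

section \<open>Integrals of derivatives of compactly supported functions\<close>

lemma lborel_integral_translation:
  fixes f :: "'a::euclidean_space \<Rightarrow> real"
  assumes [measurable]: "f \<in> borel_measurable borel"
  shows "(\<integral>x. f (c + x) \<partial>lborel) = (\<integral>x. f x \<partial>lborel)"
  by (subst (2) lborel_distr_plus[of c, symmetric], subst integral_distr) auto

lemma lborel_integrable_translation:
  fixes f :: "'a::euclidean_space \<Rightarrow> real"
  assumes "integrable lborel f"
  shows "integrable lborel (\<lambda>x. f (c + x))"
proof -
  have "integrable (distr lborel borel ((+) c)) f" using assms by (simp add: lborel_distr_plus)
  then show ?thesis by (subst (asm) integrable_distr_eq) (use borel_measurable_integrable[OF assms] in auto)
qed

text \<open>By translation invariance the integral of every difference quotient vanishes.\<close>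

lemma integral_C1c_derivative:
  assumes S: "open S" and f: "C1c S f f'"
  shows "(\<integral>x. f' x \<bullet> b \<partial>lborel) = 0"
proof -
  have f: "C1c UNIV f f'" using C1c_mono[OF f S] by simp
  have cf: "continuous_on UNIV f" "continuous_on UNIV f'" using C1cD(2,3)[OF f] by (auto simp: Cc_def)
  have [measurable]: "f \<in> borel_measurable borel" "f' \<in> borel_measurable borel"
    using cf by (auto intro: borel_measurable_continuous_onI)
  obtain K where K: "compact K" "\<And>x. x \<notin> K \<Longrightarrow> f x = 0" "\<And>x. x \<notin> K \<Longrightarrow> f' x = 0"
    using C1c_common_support[OF f] by blast
  obtain R where R: "\<And>x. x \<in> K \<Longrightarrow> norm x \<le> R"
    using compact_imp_bounded[OF K(1)] by (auto simp: bounded_iff)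
  have "bounded (f' ` K)"
    using K(1) continuous_on_subset[OF cf(2)] by (intro compact_imp_bounded compact_continuous_image) auto
  then obtain B where B: "\<And>x. x \<in> K \<Longrightarrow> norm (f' x) \<le> B" by (auto simp: bounded_iff)
  \<comment> \<open>\<open>K\<close> may be empty, and then \<open>B\<close> may be
    negative.\<close>
  define B' where "B' = max B 0"
  have B': "norm (f' x) \<le> B'" "B' \<ge> 0" for x
    using B[of x] K(3)[of x] by (cases "x \<in> K"; force simp: B'_def)+
  have lip: "\<bar>f (x + h) - f x\<bar> \<le> B' * norm h" for x h
  proof -
    have "norm (f (x + h) - f x) \<le> B' * norm (x + h - x)"
    proof (rule differentiable_bound[of UNIV f "\<lambda>x h. f' x \<bullet> h"])
      fix y show "onorm ((\<bullet>) (f' y)) \<le> B'"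
      proof (rule onorm_bound[OF B'(2)])
        fix h
        have "norm (f' y \<bullet> h) \<le> norm (f' y) * norm h" using Cauchy_Schwarz_ineq2[of "f' y" h] by simp
        also have "\<dots> \<le> B' * norm h" by (intro mult_right_mono B') simp
        finally show "norm (f' y \<bullet> h) \<le> B' * norm h" .
      qed
    qed (use C1cD(1)[OF f] in auto)
    then show ?thesis by simp
  qed
  define g where "g m x = real (Suc m) * (f ((1 / real (Suc m)) *\<^sub>R b + x) - f x)" for m x
  have fint: "integrable lborel f" using C1cD(2)[OF f] by (rule Cc_integrable)
  have fint2: "integrable lborel (\<lambda>x. f (c + x))" for c
    using fint by (rule lborel_integrable_translation)
  have g0: "(\<integral>x. g m x \<partial>lborel) = 0" for m
    unfolding g_def using fint fint2 by (simp add: lborel_integral_translation)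
  have "(\<lambda>m. \<integral>x. g m x \<partial>lborel) \<longlonglongrightarrow> (\<integral>x. f' x \<bullet> b \<partial>lborel)"
  \<comment> \<open>The difference quotients are bounded by \<open>B' * norm b\<close> through the
    Lipschitz estimate. As the step size is at most 1, they vanish unless \<open>x\<close> is within
    distance \<open>norm b\<close> of the support.\<close>
  proof (rule integral_dominated_convergence[where w="\<lambda>x. indicator (cball 0 (R + norm b)) x *\<^sub>R (B' * norm b)"])
    show "integrable lborel (\<lambda>x::'a. indicator (cball 0 (R + norm b)) x *\<^sub>R (B' * norm b))"
      by (intro borel_integrable_compact) auto
    show "AE x in lborel. (\<lambda>m. g m x) \<longlonglongrightarrow> f' x \<bullet> b"
    proof (intro AE_I2)
      fix x :: 'a
      have d: "((\<lambda>t. x + t *\<^sub>R b) has_derivative (\<lambda>t. t *\<^sub>R b)) (at 0)"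
        by (auto intro!: derivative_eq_intros)
      have "((\<lambda>t. f (x + t *\<^sub>R b)) has_real_derivative (f' x \<bullet> b)) (at 0)"
        by (rule has_derivative_imp_has_field_derivative[OF has_derivative_compose[OF d C1cD(1)[OF f]]]) simp
      then have "((\<lambda>t. (f (x + t *\<^sub>R b) - f x) / t) \<longlongrightarrow> f' x \<bullet> b) (at 0)"
        by (simp add: DERIV_def)
      moreover have "filterlim (\<lambda>m. 1 / real (Suc m)) (at 0) sequentially"
        by (rule filterlim_atI) (use LIMSEQ_Suc[OF lim_1_over_n[where 'a=real]] in auto)
      ultimately have "(\<lambda>m. (f (x + (1 / real (Suc m)) *\<^sub>R b) - f x) / (1 / real (Suc m))) \<longlonglongrightarrow> f' x \<bullet> b"
        by (rule filterlim_compose)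
      then show "(\<lambda>m. g m x) \<longlonglongrightarrow> f' x \<bullet> b"
        by (simp add: g_def add.commute mult.commute)
    qed
    fix m
    show "AE x in lborel. norm (g m x) \<le> indicator (cball 0 (R + norm b)) x *\<^sub>R (B' * norm b)"
    proof (intro AE_I2)
      fix x :: 'a
      show "norm (g m x) \<le> indicator (cball 0 (R + norm b)) x *\<^sub>R (B' * norm b)"
      proof (cases "x \<in> cball 0 (R + norm b)")
        case True
        have "\<bar>f ((1 / real (Suc m)) *\<^sub>R b + x) - f x\<bar> \<le> B' * norm ((1 / real (Suc m)) *\<^sub>R b)"
          using lip[of x "(1 / real (Suc m)) *\<^sub>R b"] by (simp add: add.commute)
        then have "real (Suc m) * \<bar>f ((1 / real (Suc m)) *\<^sub>R b + x) - f x\<bar> \<le> B' * norm b"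
          by (simp add: field_simps)
        then show ?thesis using True by (simp add: g_def abs_mult del: of_nat_Suc)
      next
        case False
        then have n: "norm x > R + norm b" by (simp add: not_le)
        then have "x \<notin> K" using R[of x] by (smt (verit) norm_ge_zero)
        moreover have "norm ((1 / real (Suc m)) *\<^sub>R b) \<le> norm b"
          using mult_right_mono[of "1 / real (Suc m)" 1 "norm b"] by (simp del: of_nat_Suc)
        then have "(1 / real (Suc m)) *\<^sub>R b + x \<notin> K"
          using R[of "(1 / real (Suc m)) *\<^sub>R b + x"] n norm_triangle_ineq4[of "(1 / real (Suc m)) *\<^sub>R b + x" "(1 / real (Suc m)) *\<^sub>R b"]
          by fastforce
        ultimately show ?thesis using False K(2) by (simp add: g_def)
      qed
    qed
  qed (auto simp: g_def)
  then show ?thesis unfolding g0 by (simp add: LIMSEQ_const_iff)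
qed

text \<open>Fundamental theorem of calculus on the line through \<open>x\<close> in direction
  \<open>b\<close>, started outside the support. The line is parametrised by its
  \<open>b\<close>-coordinate, so the bound depends on the other coordinates of \<open>x\<close>
  only; this is the form in which it enters the grid-line inequality.\<close>

lemma C1c_line_bound:
  assumes f: "C1c UNIV f f'" and b: "b \<in> Basis"
  shows "ennreal \<bar>f x\<bar> \<le> (\<integral>\<^sup>+t. ennreal (norm (f' (x + (t - x \<bullet> b) *\<^sub>R b))) \<partial>lborel)"
proof -
  obtain K where K: "compact K" "\<And>x. x \<notin> K \<Longrightarrow> f x = 0"
    using C1c_common_support[OF f] by blast
  obtain R where R: "\<And>x. x \<in> K \<Longrightarrow> norm x \<le> R"
    using compact_imp_bounded[OF K(1)] by (auto simp: bounded_iff)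
  define y where "y t = x + (t - x \<bullet> b) *\<^sub>R b" for t
  have yb: "y t \<bullet> b = t" for t using b by (simp add: y_def inner_add_left)
  \<comment> \<open>At such a parameter the \<open>b\<close>-coordinate alone already makes the norm
    exceed \<open>R\<close>.\<close>
  define T where "T = min (x \<bullet> b) (- \<bar>R\<bar> - 1)"
  have T: "T \<le> x \<bullet> b" "T \<le> - \<bar>R\<bar> - 1" by (auto simp: T_def)
  have "\<bar>y T \<bullet> b\<bar> \<le> norm (y T)" using Basis_le_norm[OF b] by blast
  then have "y T \<notin> K" using T R[of "y T"] unfolding yb by auto
  then have fT: "f (y T) = 0" by (rule K)
  have cf: "continuous_on UNIV f'" using C1cD(3)[OF f] by (auto simp: Cc_def)
  have cy: "continuous_on A y" for A unfolding y_def by (intro continuous_intros)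
  have D: "((\<lambda>t. f (y t)) has_real_derivative (f' (y t) \<bullet> b)) (at t)" for t
  proof -
    have "(y has_derivative (\<lambda>t. t *\<^sub>R b)) (at t)"
      unfolding y_def by (auto intro!: derivative_eq_intros)
    from has_derivative_imp_has_field_derivative[OF has_derivative_compose[OF this C1cD(1)[OF f]]]
    show ?thesis by simp
  qed
  have "((\<lambda>t. f' (y t) \<bullet> b) has_integral (f (y (x \<bullet> b)) - f (y T))) {T..x \<bullet> b}"
    by (rule fundamental_theorem_of_calculus[OF T(1)])
       (use D in \<open>auto simp: has_real_derivative_iff_has_vector_derivative[symmetric] intro: has_field_derivative_at_within\<close>)
  then have I: "f x = integral {T..x \<bullet> b} (\<lambda>t. f' (y t) \<bullet> b)"
    using fT by (simp add: y_def integral_unique)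
  have cn: "continuous_on {T..x \<bullet> b} (\<lambda>t. norm (f' (y t)))"
    by (intro continuous_intros continuous_on_compose2[OF cf cy]) auto
  have "\<bar>f x\<bar> \<le> integral {T..x \<bullet> b} (\<lambda>t. norm (f' (y t)))"
    unfolding I real_norm_def[symmetric]
  proof (rule integral_norm_bound_integral)
    show "(\<lambda>t. f' (y t) \<bullet> b) integrable_on {T..x \<bullet> b}"
      by (intro integrable_continuous_interval continuous_intros continuous_on_compose2[OF cf cy]) auto
    show "(\<lambda>t. norm (f' (y t))) integrable_on {T..x \<bullet> b}"
      using cn by (rule integrable_continuous_interval)
    fix t show "norm (f' (y t) \<bullet> b) \<le> norm (f' (y t))" using Basis_le_norm[OF b] by simp
  qed
  also have "\<dots> = (\<integral>t. indicator {T..x \<bullet> b} t *\<^sub>R norm (f' (y t)) \<partial>lborel)"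
    using set_borel_integral_eq_integral(2)[OF borel_integrable_atLeastAtMost'[OF cn]]
    by (simp add: set_lebesgue_integral_def)
  finally have "ennreal \<bar>f x\<bar> \<le> ennreal (\<integral>t. indicator {T..x \<bullet> b} t *\<^sub>R norm (f' (y t)) \<partial>lborel)"
    by (rule ennreal_leI)
  also have "\<dots> = (\<integral>\<^sup>+t. ennreal (indicator {T..x \<bullet> b} t *\<^sub>R norm (f' (y t))) \<partial>lborel)"
    using borel_integrable_atLeastAtMost'[OF cn]
    by (intro nn_integral_eq_integral[symmetric]) (auto simp: set_integrable_def)
  also have "\<dots> \<le> (\<integral>\<^sup>+t. ennreal (norm (f' (y t))) \<partial>lborel)"
    by (intro nn_integral_mono ennreal_leI) (auto simp: indicator_def)
  finally show ?thesis unfolding y_def .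
qed

lemma prod_mono_ennreal:
  fixes f g :: "'i \<Rightarrow> ennreal"
  shows "finite J \<Longrightarrow> (\<And>j. j \<in> J \<Longrightarrow> f j \<le> g j) \<Longrightarrow> prod f J \<le> prod g J"
  by (induction J rule: finite_induct) (auto intro!: mult_mono)

text \<open>Gagliardo's argument: with p = 1 / (N - 1) one has r = N p, so |f|^r splits into N
  factors |f|^p, one for each coordinate direction, and each factor is bounded by a line integral of
  the gradient. The grid-line inequality for the norm of the gradient does the rest.\<close>

theorem sobolev_L1:
  fixes f :: "'a::euclidean_space \<Rightarrow> real"
  assumes f: "C1c UNIV f f'" and n: "DIM('a) \<ge> 2"
  defines "r \<equiv> real DIM('a) / (real DIM('a) - 1)"
  shows "(\<integral>x. \<bar>f x\<bar> powr r \<partial>lborel) \<le> (\<integral>x. norm (f' x) \<partial>lborel) powr r"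
proof -
  define p where "p = 1 / (real DIM('a) - 1)"
  have p: "p > 0" "1 + p = r" "real DIM('a) * p = r" "(real DIM('a) - 1) * p = 1"
    using n by (auto simp: p_def r_def field_simps)
  have r: "r > 0" using p by linarith
  have cf: "continuous_on UNIV f" "continuous_on UNIV f'" using C1cD(2,3)[OF f] by (auto simp: Cc_def)
  have [measurable]: "f \<in> borel_measurable borel" "f' \<in> borel_measurable borel"
    using cf by (auto intro: borel_measurable_continuous_onI)
  define X where "X x = (\<Sum>b\<in>Basis. x b *\<^sub>R b)" for x :: "'a \<Rightarrow> real"
  let ?P = "\<Pi>\<^sub>M b\<in>(Basis::'a set). (lborel::real measure)"
  interpret product_sigma_finite "\<lambda>_::'a. lborel :: real measure" by standard
  have lb: "lborel = distr ?P borel X" unfolding X_def by (rule lborel_eq)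
  have [measurable]: "X \<in> ?P \<rightarrow>\<^sub>M borel" unfolding X_def by measurable
  define h where "h x = ennreal (norm (f' x))" for x
  have [measurable]: "h \<in> borel_measurable borel" unfolding h_def by measurable
  have upd: "X (x(b := t)) = X x + (t - X x \<bullet> b) *\<^sub>R b" if "b \<in> Basis" for x b t
  proof (rule euclidean_eqI)
    fix c :: 'a assume c: "c \<in> Basis"
    have Xi: "X y \<bullet> d = y d" if "d \<in> Basis" for y d
      unfolding X_def using that by (rule inner_sum_left_Basis)
    show "X (x(b := t)) \<bullet> c = (X x + (t - X x \<bullet> b) *\<^sub>R b) \<bullet> c"
      using Xi[OF c] Xi[OF that] c that by (cases "b = c") (simp_all add: inner_add_left inner_Basis)
  qed
  have "(\<integral>\<^sup>+x. ennreal (\<bar>f x\<bar> powr r) \<partial>lborel) = (\<integral>\<^sup>+x. ennreal (\<bar>f (X x)\<bar> powr r) \<partial>?P)"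
    unfolding lb by (rule nn_integral_distr) measurable
  \<comment> \<open>The exponent of the first factor is 1 - (N - 1) * p = 0, so this factor is 1 by
    the convention in \<open>epow\<close>.\<close>
  also have "\<dots> \<le> (\<integral>\<^sup>+x. epow (h (X x)) (1 - (real (card (Basis::'a set)) - 1) * p) *
            (\<Prod>b\<in>Basis. epow (\<integral>\<^sup>+t. h (X (x(b := t))) \<partial>lborel) p) \<partial>?P)"
  proof (rule nn_integral_mono)
    fix x
    have "ennreal (\<bar>f (X x)\<bar> powr r) = (\<Prod>b\<in>(Basis::'a set). epow (ennreal \<bar>f (X x)\<bar>) p)"
    proof -
      have "(\<Prod>b\<in>(Basis::'a set). epow (ennreal \<bar>f (X x)\<bar>) p) = ennreal ((\<bar>f (X x)\<bar> powr p) ^ DIM('a))"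
        using p(1) by (simp add: epow_ennreal ennreal_power)
      also have "(\<bar>f (X x)\<bar> powr p) ^ DIM('a) = \<bar>f (X x)\<bar> powr (real DIM('a) * p)"
        by (cases "f (X x) = 0") (auto simp: powr_power)
      finally show ?thesis by (simp add: p(3))
    qed
    also have "\<dots> \<le> (\<Prod>b\<in>Basis. epow (\<integral>\<^sup>+t. h (X (x(b := t))) \<partial>lborel) p)"
    proof (intro prod_mono_ennreal epow_mono)
      fix b :: 'a assume b: "b \<in> Basis"
      show "ennreal \<bar>f (X x)\<bar> \<le> (\<integral>\<^sup>+t. h (X (x(b := t))) \<partial>lborel)"
        using C1c_line_bound[OF f b, of "X x"] b by (simp add: upd h_def)
    qed (use p in auto)
    finally show "ennreal (\<bar>f (X x)\<bar> powr r) \<le> epow (h (X x)) (1 - (real (card (Basis::'a set)) - 1) * p) *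
            (\<Prod>b\<in>Basis. epow (\<integral>\<^sup>+t. h (X (x(b := t))) \<partial>lborel) p)"
      by (simp add: p(4))
  qed
  also have "\<dots> \<le> epow (\<integral>\<^sup>+x. h (X x) \<partial>?P) (1 + p)"
    by (rule nn_integral_grid_lines) (use p in auto)
  also have "(\<integral>\<^sup>+x. h (X x) \<partial>?P) = (\<integral>\<^sup>+x. h x \<partial>lborel)"
    unfolding lb by (rule nn_integral_distr[symmetric]) measurable
  also have "(\<integral>\<^sup>+x. h x \<partial>lborel) = ennreal (\<integral>x. norm (f' x) \<partial>lborel)"
    unfolding h_def using C1cD(3)[OF f] by (intro nn_integral_eq_integral integrable_norm Cc_integrable) auto
  also have "epow \<dots> (1 + p) = ennreal ((\<integral>x. norm (f' x) \<partial>lborel) powr r)"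
    using r p(2) by (simp add: epow_ennreal integral_nonneg_AE)
  finally have *: "(\<integral>\<^sup>+x. ennreal (\<bar>f x\<bar> powr r) \<partial>lborel) \<le> ennreal ((\<integral>x. norm (f' x) \<partial>lborel) powr r)" .
  have "Cc UNIV (\<lambda>x. \<bar>f x\<bar> powr r)"
    using r by (intro Cc_transfer[OF C1cD(2)[OF f]] continuous_intros continuous_on_powr' cf) auto
  then have "integrable lborel (\<lambda>x. \<bar>f x\<bar> powr r)" by (rule Cc_integrable)
  then have "(\<integral>\<^sup>+x. ennreal (\<bar>f x\<bar> powr r) \<partial>lborel) = ennreal (\<integral>x. \<bar>f x\<bar> powr r \<partial>lborel)"
    by (intro nn_integral_eq_integral) auto
  with * show ?thesis by simp
qed

section \<open>The Poincare-Sobolev inequality on the ball\<close>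

text \<open>Reciprocal of the conformal factor: the metric is rho^-2 times the Euclidean one and dV
  is rho^-N dx, so hyperbolic integrals become Lebesgue integrals with powers of \<open>rho\<close>
  as weights.\<close>

definition rho :: "'a::euclidean_space \<Rightarrow> real"
  where "rho x = (1 - (norm x)\<^sup>2) / 2"

lemma rho_pos: "x \<in> ball 0 1 \<Longrightarrow> 0 < rho x"
  by (simp add: rho_def power_less_one_iff)

lemma rho_le: "rho x \<le> 1 / 2"
  by (simp add: rho_def)

lemma norm_sq_rho: "(norm x)\<^sup>2 = 1 - 2 * rho x"
  by (simp add: rho_def field_simps)

lemma rho_powr_derivative:
  assumes "x \<in> ball 0 1"
  shows "((\<lambda>x. rho x powr c) has_derivative (\<lambda>h. (- (c * rho x powr (c - 1)) *\<^sub>R x) \<bullet> h)) (at x)"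
proof -
  have "(rho has_derivative (\<lambda>h. - (x \<bullet> h))) (at x)"
    unfolding rho_def[abs_def] power2_norm_eq_inner
    by (auto intro!: derivative_eq_intros simp: inner_commute)
  moreover have "((\<lambda>t. t powr c) has_derivative (\<lambda>t. c * rho x powr (c - 1) * t)) (at (rho x))"
    using has_real_derivative_powr[OF rho_pos[OF assms], of c] by (simp add: has_field_derivative_def)
  ultimately show ?thesis
    by (rule has_derivative_eq_rhs[OF has_derivative_compose]) auto
qed

lemma rho_powr_continuous: "continuous_on (ball 0 1) (\<lambda>x. rho x powr c)"
  by (intro continuous_at_imp_continuous_on ballI has_derivative_continuous[OF rho_powr_derivative])

lemma rho_mult_powr: "x \<in> ball 0 1 \<Longrightarrow> rho x * rho x powr c = rho x powr (c + 1)"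
  using rho_pos[of x] by (simp add: powr_add)

lemma Cc_rho:
  fixes f :: "'a::euclidean_space \<Rightarrow> real"
  shows "Cc (ball 0 1) f \<Longrightarrow> Cc (ball 0 1) (\<lambda>x. rho x powr c * f x)"
  by (intro Cc_mult rho_powr_continuous)

lemma C1c_outside:
  assumes "C1c (ball 0 1) f f'" "x \<notin> ball 0 1" shows "f x = 0" "f' x = 0"
  using C1c_common_support[OF assms(1)] assms(2) by blast+

lemma C1c_rho:
  assumes "C1c (ball 0 1) f f'"
  shows "C1c (ball 0 1) (\<lambda>x. rho x powr c * f x)
    (\<lambda>x. rho x powr c *\<^sub>R f' x + f x *\<^sub>R (- (c * rho x powr (c - 1)) *\<^sub>R x))"
  by (intro C1c_mult[OF open_ball assms] rho_powr_derivative)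
     (auto intro!: continuous_intros rho_powr_continuous)

lemma C1c_continuous_Cc:
  assumes "C1c S f f'"
  shows "Cc S f" "Cc S f'" "Cc S (\<lambda>x. norm (f' x))" "Cc S (\<lambda>x. \<bar>f x\<bar>)"
    "continuous_on S f" "continuous_on S f'"
  using C1cD[OF assms]
  by (auto intro!: Cc_transfer[of S f' "\<lambda>x. norm (f' x)"] Cc_transfer[of S f "\<lambda>x. \<bar>f x\<bar>"] continuous_intros
       dest: Cc_continuous_on)

text \<open>Divergence theorem for the field g x * x, one coordinate at a time.\<close>

lemma radial_divergence:
  fixes g :: "'a::euclidean_space \<Rightarrow> real"
  assumes S: "open S" and g: "C1c S g g'"
  shows "(\<integral>x. x \<bullet> g' x \<partial>lborel) = - real DIM('a) * (\<integral>x. g x \<partial>lborel)"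
proof -
  have gi: "integrable lborel g" using C1cD(2)[OF g] by (rule Cc_integrable)
  have i: "integrable lborel (\<lambda>x. (x \<bullet> b) * (g' x \<bullet> b))" for b
    by (intro Cc_integrable[of S] Cc_transfer[OF C1cD(3)[OF g]] continuous_intros C1c_continuous_Cc[OF g]) auto
  have b: "(\<integral>x. (x \<bullet> b) * (g' x \<bullet> b) \<partial>lborel) = - (\<integral>x. g x \<partial>lborel)" if "b \<in> Basis" for b
  proof -
    have "C1c S (\<lambda>x. (x \<bullet> b) * g x) (\<lambda>x. (x \<bullet> b) *\<^sub>R g' x + g x *\<^sub>R b)"
      by (intro C1c_mult[OF S g]) (auto intro!: derivative_eq_intros simp: inner_commute)
    from integral_C1c_derivative[OF S this, of b]
    have "(\<integral>x. (x \<bullet> b) * (g' x \<bullet> b) + g x \<partial>lborel) = 0"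
      using that by (simp add: inner_add_left)
    then show ?thesis using i gi by simp
  qed
  have "(\<integral>x. x \<bullet> g' x \<partial>lborel) = (\<integral>x. (\<Sum>b\<in>Basis. (x \<bullet> b) * (g' x \<bullet> b)) \<partial>lborel)"
    by (subst euclidean_inner) simp
  also have "\<dots> = (\<Sum>b\<in>Basis. (\<integral>x. (x \<bullet> b) * (g' x \<bullet> b) \<partial>lborel))"
    using i by (intro Bochner_Integration.integral_sum) auto
  also have "\<dots> = - real DIM('a) * (\<integral>x. g x \<partial>lborel)" by (simp add: b)
  finally show ?thesis .
qed

text \<open>Since \<open>rho\<close> has gradient - x and |x|^2 = 1 - 2 * rho x, differentiating the
  weight in \<open>rho powr c * g\<close> produces the more singular weight
  \<open>rho powr (c - 1)\<close>. For c > 0 this yields a Hardy inequality; with a negative c it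
  removes the cross term in \<open>ground_state\<close>.\<close>

lemma radial_divergence_rho:
  fixes g :: "'a::euclidean_space \<Rightarrow> real"
  assumes g: "C1c (ball 0 1) g g'"
  shows "c * (\<integral>x. rho x powr (c - 1) * g x \<partial>lborel)
     = (\<integral>x. rho x powr c * (x \<bullet> g' x) \<partial>lborel) + (real DIM('a) + 2 * c) * (\<integral>x. rho x powr c * g x \<partial>lborel)"
proof -
  note gc = C1c_continuous_Cc[OF g]
  have i: "integrable lborel (\<lambda>x. rho x powr e * g x)" for e
    by (intro Cc_integrable[of "ball 0 1"] Cc_rho gc)
  have "Cc (ball 0 1) (\<lambda>x. x \<bullet> g' x)"
    by (intro Cc_transfer[OF gc(2)] continuous_intros gc) auto
  then have i': "integrable lborel (\<lambda>x. rho x powr c * (x \<bullet> g' x))"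
    by (intro Cc_integrable[of "ball 0 1"] Cc_rho)
  have "- real DIM('a) * (\<integral>x. rho x powr c * g x \<partial>lborel)
     = (\<integral>x. x \<bullet> (rho x powr c *\<^sub>R g' x + g x *\<^sub>R (- (c * rho x powr (c - 1)) *\<^sub>R x)) \<partial>lborel)"
    by (rule radial_divergence[symmetric, OF open_ball C1c_rho[OF g]])
  also have "\<dots> = (\<integral>x. rho x powr c * (x \<bullet> g' x) - c * (rho x powr (c - 1) * g x) + 2 * c * (rho x powr c * g x) \<partial>lborel)"
  proof (intro Bochner_Integration.integral_cong refl)
    fix x :: 'a
    show "x \<bullet> (rho x powr c *\<^sub>R g' x + g x *\<^sub>R (- (c * rho x powr (c - 1)) *\<^sub>R x))
      = rho x powr c * (x \<bullet> g' x) - c * (rho x powr (c - 1) * g x) + 2 * c * (rho x powr c * g x)"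
    proof (cases "x \<in> ball 0 1")
      case True
      have r: "rho x powr c = rho x * rho x powr (c - 1)" using rho_mult_powr[OF True, of "c - 1"] by simp
      have "x \<bullet> x = 1 - 2 * rho x" using norm_sq_rho[of x] by (simp add: power2_norm_eq_inner)
      then show ?thesis unfolding r by (simp add: inner_diff_right) (simp add: algebra_simps)
    qed (simp add: C1c_outside[OF g])
  qed
  also have "\<dots> = (\<integral>x. rho x powr c * (x \<bullet> g' x) \<partial>lborel) - c * (\<integral>x. rho x powr (c - 1) * g x \<partial>lborel)
       + 2 * c * (\<integral>x. rho x powr c * g x \<partial>lborel)"
    using i i' by simp
  finally show ?thesis by (simp add: algebra_simps)
qed

text \<open>Both factors are bounded by powers of the maximum. It stands in for Young's inequality
  wherever the constant is irrelevant.\<close>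

lemma powr_interpolation:
  fixes X Y t :: real
  assumes "0 \<le> X" "0 \<le> Y" "0 \<le> t" "t \<le> 1"
  shows "X powr (1 - t) * Y powr t \<le> X + Y"
proof -
  define Z where "Z = max X Y"
  have "X powr (1 - t) * Y powr t \<le> Z powr (1 - t) * Z powr t"
    using assms by (intro mult_mono powr_mono2) (auto simp: Z_def)
  also have "\<dots> = Z" using assms by (auto simp: powr_add[symmetric] Z_def)
  also have "\<dots> \<le> X + Y" using assms by (auto simp: Z_def)
  finally show ?thesis .
qed

text \<open>The ends of the scale are t = 0, Hardy with weight \<open>rho powr (a - 1)\<close>, and
  t = 1, Gagliardo-Nirenberg for \<open>rho powr a * g\<close>. The gradient of that product has L1
  norm at most I1 + a * J, and Hardy bounds a * J by I1 + (N + 2 * a) * I0; this is why the gradient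
  integral enters \<open>HH\<close> with the factor 2.\<close>

lemma weighted_L1_inequality:
  fixes g :: "'a::euclidean_space \<Rightarrow> real"
  assumes g: "C1c (ball 0 1) g g'" and g0: "\<And>x. g x \<ge> 0" and n: "DIM('a) \<ge> 2" and a: "a > 0"
    and t: "0 \<le> t" "t \<le> 1" and H: "H > 0"
    and HH: "2 * (\<integral>x. rho x powr a * norm (g' x) \<partial>lborel) + (real DIM('a) + 2 * a) * (\<integral>x. rho x powr a * g x \<partial>lborel) \<le> H"
  defines "r \<equiv> real DIM('a) / (real DIM('a) - 1)"
  shows "(\<integral>x. rho x powr ((1 - t) * (a - 1) + t * a * r) * g x powr ((1 - t) + t * r) \<partial>lborel)
     \<le> (1 / a + 1) * H powr ((1 - t) + t * r)"
proof -
  note gc = C1c_continuous_Cc[OF g]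
  define I1 where "I1 = (\<integral>x. rho x powr a * norm (g' x) \<partial>lborel)"
  define I0 where "I0 = (\<integral>x. rho x powr a * g x \<partial>lborel)"
  define J where "J = (\<integral>x. rho x powr (a - 1) * g x \<partial>lborel)"
  have r: "r > 1" using n by (simp add: r_def field_simps)
  define q where "q = (1 - t) + t * r"
  have "t * (r - 1) \<ge> 0" using t r by simp
  then have q: "q \<ge> 1" by (simp add: q_def algebra_simps)
  have i: "integrable lborel (\<lambda>x. rho x powr e * g x)" for e
    by (intro Cc_integrable[of "ball 0 1"] Cc_rho gc)
  have ci1: "Cc (ball 0 1) (\<lambda>x. x \<bullet> g' x)"
    by (intro Cc_transfer[OF gc(2)] continuous_intros gc) auto
  have i1: "integrable lborel (\<lambda>x. rho x powr e * norm (g' x))" for e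
    by (intro Cc_integrable[of "ball 0 1"] Cc_rho gc)
  have nonneg: "I0 \<ge> 0" "I1 \<ge> 0" "J \<ge> 0"
    unfolding I0_def I1_def J_def using g0 by (auto intro!: integral_nonneg_AE)
  have "(\<integral>x. rho x powr a * (x \<bullet> g' x) \<partial>lborel) \<le> I1"
    unfolding I1_def
  proof (intro integral_mono Cc_integrable[OF Cc_rho[OF ci1]] i1)
    fix x
    show "rho x powr a * (x \<bullet> g' x) \<le> rho x powr a * norm (g' x)"
    proof (cases "x \<in> ball 0 1")
      case True
      have "x \<bullet> g' x \<le> norm x * norm (g' x)" by (rule norm_cauchy_schwarz)
      also have "\<dots> \<le> 1 * norm (g' x)" using True by (intro mult_right_mono) auto
      finally show ?thesis by (intro mult_left_mono) auto
    qed (simp add: C1c_outside[OF g])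
  qed
  then have hardy: "a * J \<le> I1 + (real DIM('a) + 2 * a) * I0"
    using radial_divergence_rho[OF g, of a] by (simp add: J_def I0_def)
  define G' where "G' x = rho x powr a *\<^sub>R g' x + g x *\<^sub>R (- (a * rho x powr (a - 1)) *\<^sub>R x)" for x
  have G: "C1c (ball 0 1) (\<lambda>x. rho x powr a * g x) G'"
    unfolding G'_def[abs_def] by (rule C1c_rho[OF g])
  have "(\<integral>x. norm (G' x) \<partial>lborel) \<le> (\<integral>x. rho x powr a * norm (g' x) + a * (rho x powr (a - 1) * g x) \<partial>lborel)"
  proof (intro integral_mono)
    show "integrable lborel (\<lambda>x. norm (G' x))"
      using C1c_continuous_Cc(3)[OF G] by (rule Cc_integrable)
    show "integrable lborel (\<lambda>x. rho x powr a * norm (g' x) + a * (rho x powr (a - 1) * g x))"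
      using i i1 by auto
    fix x
    show "norm (G' x) \<le> rho x powr a * norm (g' x) + a * (rho x powr (a - 1) * g x)"
    proof (cases "x \<in> ball 0 1")
      case True
      have "norm (G' x) \<le> norm (rho x powr a *\<^sub>R g' x) + norm (g x *\<^sub>R (- (a * rho x powr (a - 1)) *\<^sub>R x))"
        unfolding G'_def by (rule norm_triangle_ineq)
      also have "\<dots> = rho x powr a * norm (g' x) + (a * (rho x powr (a - 1) * g x)) * norm x"
        using g0[of x] a by (simp add: abs_mult)
      also have "(a * (rho x powr (a - 1) * g x)) * norm x \<le> (a * (rho x powr (a - 1) * g x)) * 1"
        using True a g0[of x] by (intro mult_left_mono) auto
      finally show ?thesis by simp
    qed (simp add: C1c_outside[OF g] G'_def)
  qed
  also have "\<dots> = I1 + a * J" using i i1 by (simp add: I1_def J_def)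
  also have "\<dots> \<le> H" using hardy HH by (simp add: I1_def I0_def)
  finally have GH: "(\<integral>x. norm (G' x) \<partial>lborel) \<le> H" .
  have "(\<integral>x. \<bar>rho x powr a * g x\<bar> powr r \<partial>lborel) \<le> (\<integral>x. norm (G' x) \<partial>lborel) powr r"
    unfolding r_def by (rule sobolev_L1[OF C1c_mono[OF G open_ball] n]) simp
  also have "\<dots> \<le> H powr r" using GH r by (intro powr_mono2) (auto intro!: integral_nonneg_AE)
  finally have S: "(\<integral>x. (rho x powr a * g x) powr r \<partial>lborel) \<le> H powr r"
    using g0 by (simp add: abs_mult)
  have "a * J \<le> H" using hardy HH nonneg by (simp add: I1_def[symmetric] I0_def[symmetric])
  then have J: "J \<le> H / a" using a by (simp add: field_simps)
  \<comment> \<open>The two integrands are normalised by \<open>H\<close> and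
    \<open>H powr r\<close>; pointwise interpolation then gives a sum whose terms integrate to at
    most 1 / a and 1.\<close>
  have pt: "rho x powr ((1 - t) * (a - 1) + t * a * r) * g x powr q
      \<le> H powr q * ((1 / H) * (rho x powr (a - 1) * g x) + (1 / H powr r) * (rho x powr a * g x) powr r)" for x
  proof (cases "x \<in> ball 0 1 \<and> g x > 0")
    case True
    then have rp: "rho x > 0" and gp: "g x > 0" using rho_pos by auto
    let ?X = "rho x powr (a - 1) * g x / H" and ?Y = "(rho x powr a * g x / H) powr r"
    have "rho x powr ((1 - t) * (a - 1) + t * a * r) * g x powr q = H powr q * (?X powr (1 - t) * ?Y powr t)"
    proof -
      have "?X powr (1 - t) = rho x powr ((1 - t) * (a - 1)) * g x powr (1 - t) / H powr (1 - t)"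
        using rp gp H by (simp add: powr_mult powr_divide powr_powr mult.commute)
      moreover have "?Y powr t = rho x powr (t * a * r) * g x powr (t * r) / H powr (t * r)"
        using rp gp H by (simp add: powr_mult powr_divide powr_powr mult_ac)
      ultimately show ?thesis
        using H by (simp add: q_def powr_add)
    qed
    also have "\<dots> \<le> H powr q * (?X + ?Y)"
      using rp gp H t by (intro mult_left_mono powr_interpolation) auto
    also have "?Y = (1 / H powr r) * (rho x powr a * g x) powr r"
      using rp gp H by (simp add: powr_divide)
    finally show ?thesis by simp
  next
    case False
    then have "g x = 0" using C1c_outside[OF g, of x] g0[of x] by (metis less_eq_real_def)
    then show ?thesis using q by simp
  qed
  have cG: "Cc (ball 0 1) (\<lambda>x. (rho x powr a * g x) powr r)"
    using r g0 by (intro Cc_transfer[OF gc(1)] continuous_on_powr' continuous_intros rho_powr_continuous gc) auto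
  have cg: "Cc (ball 0 1) (\<lambda>x. g x powr q)"
    using q g0 by (intro Cc_transfer[OF gc(1)] continuous_on_powr' continuous_intros gc) auto
  have "(\<integral>x. rho x powr ((1 - t) * (a - 1) + t * a * r) * g x powr q \<partial>lborel)
    \<le> (\<integral>x. H powr q * ((1 / H) * (rho x powr (a - 1) * g x) + (1 / H powr r) * (rho x powr a * g x) powr r) \<partial>lborel)"
    by (intro integral_mono pt Cc_integrable[OF Cc_rho[OF cg]]
         integrable_mult_right Bochner_Integration.integrable_add i Cc_integrable[OF cG])
  also have "\<dots> = H powr q * ((1 / H) * J + (1 / H powr r) * (\<integral>x. (rho x powr a * g x) powr r \<partial>lborel))"
    using i Cc_integrable[OF cG] by (simp add: J_def)
  also have "\<dots> \<le> H powr q * ((1 / H) * (H / a) + (1 / H powr r) * H powr r)"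
    using H by (intro mult_left_mono add_mono J S) auto
  also have "\<dots> = (1 / a + 1) * H powr q" using H by (simp add: algebra_simps)
  finally show ?thesis unfolding q_def .
qed

section \<open>Powers of the absolute value\<close>

lemma isCont_abs_powr:
  fixes s :: real
  assumes "s > 0" shows "isCont (\<lambda>h. \<bar>h\<bar> powr s) t"
proof -
  have "continuous_on UNIV (\<lambda>h::real. \<bar>h\<bar> powr s)"
    using assms by (intro continuous_on_powr' continuous_on_rabs continuous_on_id continuous_on_const) auto
  then show ?thesis by (simp add: continuous_on_eq_continuous_at)
qed

lemma DERIV_abs_powr:
  fixes s :: real
  assumes s: "s > 1"
  shows "((\<lambda>t. \<bar>t\<bar> powr s) has_real_derivative s * (sgn t * \<bar>t\<bar> powr (s - 1))) (at t)"
proof (cases "t = 0")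
  case True
  have c: "isCont (\<lambda>h. \<bar>h\<bar> powr (s - 1)) 0" using s by (intro isCont_abs_powr) auto
  have "((\<lambda>h. \<bar>h\<bar> powr (s - 1)) \<longlongrightarrow> 0) (at 0)"
    using c s by (simp add: isCont_def)
  then have "((\<lambda>h::real. (\<bar>h\<bar> powr s) / h) \<longlongrightarrow> 0) (at 0)"
    by (rule Lim_null_comparison[rotated])
       (auto simp: eventually_at_filter abs_divide powr_diff)
  then show ?thesis using True by (simp add: DERIV_def)
next
  case False
  then consider "t > 0" | "t < 0" by linarith
  then show ?thesis
  proof cases
    case 1
    have "((\<lambda>t. t powr s) has_real_derivative s * t powr (s - 1)) (at t)"
      using 1 by (rule has_real_derivative_powr)
    then have "((\<lambda>t. \<bar>t\<bar> powr s) has_real_derivative s * t powr (s - 1)) (at t)"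
      by (rule has_field_derivative_transform_within_open[where S="{0<..}"]) (use 1 in auto)
    then show ?thesis using 1 by simp
  next
    case 2
    have "((\<lambda>t. (- t) powr s) has_real_derivative (s * (- t) powr (s - 1)) * (- 1)) (at t)"
      by (rule DERIV_chain2[where f="\<lambda>t. t powr s"])
         (use 2 in \<open>auto intro!: has_real_derivative_powr derivative_eq_intros\<close>)
    then have "((\<lambda>t. \<bar>t\<bar> powr s) has_real_derivative (s * (- t) powr (s - 1)) * (- 1)) (at t)"
      by (rule has_field_derivative_transform_within_open[where S="{..<0}"]) (use 2 in auto)
    then show ?thesis using 2 by simp
  qed
qed

lemma continuous_sgn_abs_powr:
  fixes s :: real
  assumes s: "s > 0"
  shows "continuous_on UNIV (\<lambda>t. sgn t * \<bar>t\<bar> powr s)"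
proof (intro continuous_at_imp_continuous_on ballI)
  fix t :: real
  show "isCont (\<lambda>t. sgn t * \<bar>t\<bar> powr s) t"
  proof (cases "t = 0")
    case True
    have "isCont (\<lambda>h. \<bar>h\<bar> powr s) 0" using s by (rule isCont_abs_powr)
    then have "((\<lambda>h. \<bar>h\<bar> powr s) \<longlongrightarrow> 0) (at 0)" using s by (simp add: isCont_def)
    then have "((\<lambda>h. sgn h * \<bar>h\<bar> powr s) \<longlongrightarrow> 0) (at 0)"
      by (rule Lim_null_comparison[rotated]) (auto simp: abs_mult abs_sgn_eq)
    then show ?thesis using True by (simp add: isCont_def)
  next
    case False
    then show ?thesis by (intro isCont_mult isCont_abs_powr s isCont_sgn continuous_ident)
  qed
qed

lemma C1c_abs_powr:
  assumes "C1c S f f'" "s > 1"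
  shows "C1c S (\<lambda>x. \<bar>f x\<bar> powr s) (\<lambda>x. (s * (sgn (f x) * \<bar>f x\<bar> powr (s - 1))) *\<^sub>R f' x)"
  using assms(2) by (intro C1c_compose[OF assms(1) DERIV_abs_powr]) (auto intro!: continuous_intros continuous_sgn_abs_powr)

lemma Cc_abs_powr:
  fixes f :: "'a::euclidean_space \<Rightarrow> real"
  assumes "Cc S f" "s > 0"
  shows "Cc S (\<lambda>x. \<bar>f x\<bar> powr s)"
  using assms by (intro Cc_transfer[OF assms(1)] continuous_on_powr' continuous_intros Cc_continuous_on[OF assms(1)]) auto

text \<open>The parameter \<open>l\<close> stays free so that it can balance two integrals
  afterwards, which recovers Cauchy-Schwarz from a pointwise bound.\<close>

lemma weighted_young:
  fixes a b l :: real
  assumes "l > 0"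
  shows "a * b \<le> (l * a\<^sup>2 + b\<^sup>2 / l) / 2"
proof -
  have "0 \<le> (l * a - b)\<^sup>2 / l" using assms by simp
  also have "\<dots> = l * a\<^sup>2 - 2 * (a * b) + b\<^sup>2 / l"
    using assms by (simp add: power2_eq_square field_simps)
  finally show ?thesis by simp
qed

text \<open>Origin of the constants: for g = |v|^s the gradient term is a product of rho^(1/2) |v'|
  and rho^(a - 1/2) |v|^(s - 1), up to the factor s. The square of the second factor has to be the
  integrand rho^\<gamma> |v|^p of \<open>M\<close>, which forces 2 (s - 1) = p and 2 a - 1 =
  \<gamma>. Next, \<open>t\<close> is fixed by s q = p with q = 1 + t (r - 1), and the weight then
  comes out as rho^\<gamma> as well. The condition t \<le> 1 is exactly p \<le> 2 N / (N - 2). The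
  outcome is M \<le> K (F M)^(q / 2) for every F > E, where q < 2 allows \<open>M\<close> to be
  absorbed.\<close>

lemma weighted_sobolev:
  assumes n: "DIM('a) \<ge> 3" and p: "2 < p" "p \<le> 2 * real DIM('a) / (real DIM('a) - 2)"
  shows "\<exists>C>0. \<forall>(v :: 'a::euclidean_space \<Rightarrow> real) v'. C1c (ball 0 1) v v' \<longrightarrow>
    (\<integral>x. rho x powr ((real DIM('a) - 1) * p / 2 - real DIM('a)) * \<bar>v x\<bar> powr p \<partial>lborel) powr (2 / p)
    \<le> C * ((\<integral>x. rho x * (norm (v' x))\<^sup>2 \<partial>lborel) + (\<integral>x. (v x)\<^sup>2 \<partial>lborel))"
proof -
  define N where "N = real DIM('a)"
  have N: "N \<ge> 3" using n by (simp add: N_def)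
  define s where "s = (p + 2) / 2"
  define a where "a = (N - 1) * (p - 2) / 4"
  define t where "t = (N - 1) * (p - 2) / (p + 2)"
  define r where "r = N / (N - 1)"
  define q where "q = 2 * p / (p + 2)"
  define \<gamma> where "\<gamma> = (N - 1) * p / 2 - N"
  have a: "a > 0" using N p by (simp add: a_def)
  have s: "s > 1" using p by (simp add: s_def)
  have "p * (N - 2) \<le> 2 * N" using p(2) N by (simp add: N_def[symmetric] field_simps)
  then have "(N - 1) * (p - 2) \<le> p + 2" by (simp add: algebra_simps)
  then have t: "0 \<le> t" "t \<le> 1" using N p(1) by (auto simp: t_def)
  have "r - 1 = 1 / (N - 1)" using N by (simp add: r_def field_simps)
  then have tr: "t * (r - 1) = (p - 2) / (p + 2)" using N by (simp add: t_def)
  have q: "(1 - t) + t * r = q" using tr p by (simp add: q_def field_simps)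
  have "(1 - t) * (a - 1) + t * a * r = a * ((1 - t) + t * r) - 1 + t" by (simp add: algebra_simps)
  also have "\<dots> = (N - 1) * (p - 2) / 2 * (p / (p + 2) + 2 / (p + 2)) - 1"
    unfolding q by (simp add: a_def q_def t_def distrib_left)
  also have "p / (p + 2) + 2 / (p + 2) = 1" using p by (simp add: add_divide_distrib[symmetric])
  also have "(N - 1) * (p - 2) / 2 * 1 - 1 = \<gamma>" by (simp add: \<gamma>_def field_simps)
  finally have exponent: "(1 - t) * (a - 1) + t * a * r = \<gamma>" .
  have a\<gamma>: "2 * a - 1 = \<gamma>" by (simp add: a_def \<gamma>_def field_simps)
  have sq: "s * q = p" "2 * (s - 1) = p" using p by (simp add: s_def q_def, simp add: s_def field_simps)
  \<comment> \<open>The two integrals in the hypothesis of \<open>weighted_L1_inequality\<close>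
    will be at most \<open>s * sqrt (F * M)\<close> and \<open>sqrt (F * M)\<close>;
    \<open>D\<close> collects their coefficients.\<close>
  define D where "D = 2 * s + (N + 2 * a)"
  define K where "K = (1 / a + 1) * D powr q"
  have D: "D > 0" using s N a by (simp add: D_def)
  have K: "K > 0" using a D by (simp add: K_def add_pos_pos)
  show ?thesis
  proof (intro exI[of _ "K powr ((p + 2) / p)"] conjI allI impI)
    show "K powr ((p + 2) / p) > 0" using K by simp
    fix v :: "'a \<Rightarrow> real" and v' assume v: "C1c (ball 0 1) v v'"
    note vc = C1c_continuous_Cc[OF v]
    define E where "E = (\<integral>x. rho x * (norm (v' x))\<^sup>2 \<partial>lborel) + (\<integral>x. (v x)\<^sup>2 \<partial>lborel)"
    define M where "M = (\<integral>x. rho x powr \<gamma> * \<bar>v x\<bar> powr p \<partial>lborel)"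
    have M0: "M \<ge> 0" unfolding M_def by (auto intro!: integral_nonneg_AE)
    have rho_v': "rho x * (norm (v' x))\<^sup>2 \<ge> 0" for x
      using rho_pos[of x] C1c_outside[OF v, of x] by (cases "x \<in> ball 0 1") auto
    have E0: "E \<ge> 0" unfolding E_def using rho_v' by (auto intro!: integral_nonneg_AE add_nonneg_nonneg)
    have iv': "integrable lborel (\<lambda>x. rho x * (norm (v' x))\<^sup>2)"
    proof (rule Cc_integrable, rule Cc_transfer[OF vc(2)])
      show "continuous_on (ball 0 1) (\<lambda>x. rho x * (norm (v' x))\<^sup>2)"
        unfolding rho_def by (auto intro!: continuous_intros vc)
    qed auto
    have iv2: "integrable lborel (\<lambda>x. (v x)\<^sup>2)"
      by (rule Cc_integrable[OF Cc_transfer[OF vc(1)]]) (auto intro!: continuous_intros vc)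
    have iM: "integrable lborel (\<lambda>x. rho x powr \<gamma> * \<bar>v x\<bar> powr p)"
      using p by (intro Cc_integrable[of "ball 0 1"] Cc_rho Cc_abs_powr vc) auto
    define g where "g x = \<bar>v x\<bar> powr s" for x
    define g' where "g' x = (s * (sgn (v x) * \<bar>v x\<bar> powr (s - 1))) *\<^sub>R v' x" for x
    have g: "C1c (ball 0 1) g g'"
      unfolding g_def[abs_def] g'_def[abs_def] by (rule C1c_abs_powr[OF v s])
    note gc = C1c_continuous_Cc[OF g]
    have ng': "norm (g' x) = s * (\<bar>v x\<bar> powr (s - 1) * norm (v' x))" for x
      using s by (cases "v x = 0") (auto simp: g'_def abs_mult abs_sgn_eq)
    \<comment> \<open>\<open>E\<close> could be 0, and \<open>l\<close> below is a quotient by it;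
      hence the strictly larger \<open>F\<close>, which tends to \<open>E\<close> at the
      end.\<close>
    have bound: "M powr (2 / p) \<le> K powr ((p + 2) / p) * F" if F: "F > E" for F
    proof (cases "M = 0")
      case True
      then show ?thesis using E0 F p by simp
    next
      case False
      then have M: "M > 0" using M0 by simp
      have F0: "F > 0" using E0 F by simp
      \<comment> \<open>The balancing choice: \<open>l * F\<close> and \<open>M / l\<close> both
        become the geometric mean of \<open>F\<close> and \<open>M\<close>.\<close>
      define l where "l = sqrt (M / F)"
      have l: "l > 0" using M F0 by (simp add: l_def)
      have lF: "l * F = sqrt (F * M)" "M / l = sqrt (F * M)"
        using M F0 by (auto simp: l_def real_sqrt_divide real_sqrt_mult field_simps)
      have sqF: "(l * F + M / l) / 2 = sqrt (F * M)" unfolding lF by simp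
      have "(\<integral>x. rho x powr a * norm (g' x) \<partial>lborel)
        \<le> (\<integral>x. s * ((l * (rho x * (norm (v' x))\<^sup>2) + (rho x powr \<gamma> * \<bar>v x\<bar> powr p) / l) / 2) \<partial>lborel)"
      proof (intro integral_mono)
        show "integrable lborel (\<lambda>x. rho x powr a * norm (g' x))"
          by (intro Cc_integrable[of "ball 0 1"] Cc_rho gc)
        show "integrable lborel (\<lambda>x. s * ((l * (rho x * (norm (v' x))\<^sup>2) + (rho x powr \<gamma> * \<bar>v x\<bar> powr p) / l) / 2))"
          using iv' iM by auto
        fix x
        show "rho x powr a * norm (g' x) \<le> s * ((l * (rho x * (norm (v' x))\<^sup>2) + (rho x powr \<gamma> * \<bar>v x\<bar> powr p) / l) / 2)"
        proof (cases "x \<in> ball 0 1 \<and> v x \<noteq> 0")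
          case True
          then have rp: "rho x > 0" using rho_pos by auto
          have 1: "rho x powr (1/2) * rho x powr (a - 1/2) = rho x powr a"
            using rp by (simp add: powr_add[symmetric])
          have 2: "(rho x powr (1/2) * norm (v' x))\<^sup>2 = rho x * (norm (v' x))\<^sup>2"
            using rp by (simp add: power_mult_distrib powr_half_sqrt)
          have "(rho x powr (a - 1/2) * \<bar>v x\<bar> powr (s - 1))\<^sup>2
             = rho x powr (2 * a - 1) * \<bar>v x\<bar> powr (2 * (s - 1))"
            using rp True by (simp add: power_mult_distrib powr_power algebra_simps)
          then have 3: "(rho x powr (a - 1/2) * \<bar>v x\<bar> powr (s - 1))\<^sup>2 = rho x powr \<gamma> * \<bar>v x\<bar> powr p"
            unfolding a\<gamma> sq .
          have "rho x powr a * norm (g' x)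
            = s * ((rho x powr (1/2) * norm (v' x)) * (rho x powr (a - 1/2) * \<bar>v x\<bar> powr (s - 1)))"
            unfolding ng' 1[symmetric] by simp
          also have "\<dots> \<le> s * ((l * (rho x * (norm (v' x))\<^sup>2) + (rho x powr \<gamma> * \<bar>v x\<bar> powr p) / l) / 2)"
            using weighted_young[OF l, of "rho x powr (1/2) * norm (v' x)" "rho x powr (a - 1/2) * \<bar>v x\<bar> powr (s - 1)"] s
            unfolding 2 3 by (intro mult_left_mono) auto
          finally show ?thesis .
        next
          case False
          then have "v x = 0" using C1c_outside[OF v] by blast
          then show ?thesis using rho_v'[of x] s l p by (simp add: ng')
        qed
      qed
      also have "\<dots> = s * ((l * (\<integral>x. rho x * (norm (v' x))\<^sup>2 \<partial>lborel) + M / l) / 2)"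
        using iv' iM by (simp add: M_def)
      also have "\<dots> \<le> s * ((l * F + M / l) / 2)"
      proof (intro mult_left_mono divide_right_mono add_mono)
        have "(\<integral>x. (v x)\<^sup>2 \<partial>lborel) \<ge> 0" by (auto intro!: integral_nonneg_AE)
        then show "(\<integral>x. rho x * (norm (v' x))\<^sup>2 \<partial>lborel) \<le> F" using F unfolding E_def by linarith
      qed (use s l in auto)
      finally have T1: "(\<integral>x. rho x powr a * norm (g' x) \<partial>lborel) \<le> s * sqrt (F * M)" unfolding sqF .
      have "(\<integral>x. rho x powr a * g x \<partial>lborel)
        \<le> (\<integral>x. (l * (v x)\<^sup>2 + (rho x powr \<gamma> * \<bar>v x\<bar> powr p) / l) / 2 \<partial>lborel)"
      proof (intro integral_mono)
        show "integrable lborel (\<lambda>x. rho x powr a * g x)"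
          by (intro Cc_integrable[of "ball 0 1"] Cc_rho gc)
        show "integrable lborel (\<lambda>x. (l * (v x)\<^sup>2 + (rho x powr \<gamma> * \<bar>v x\<bar> powr p) / l) / 2)"
          using iv2 iM by auto
        fix x
        show "rho x powr a * g x \<le> (l * (v x)\<^sup>2 + (rho x powr \<gamma> * \<bar>v x\<bar> powr p) / l) / 2"
        proof (cases "x \<in> ball 0 1 \<and> v x \<noteq> 0")
          case True
          then have rp: "rho x > 0" using rho_pos by auto
          have "rho x powr a * g x = \<bar>v x\<bar> * (rho x powr a * \<bar>v x\<bar> powr (s - 1))"
            using True by (simp add: g_def powr_diff)
          also have "\<dots> \<le> (l * \<bar>v x\<bar>\<^sup>2 + (rho x powr a * \<bar>v x\<bar> powr (s - 1))\<^sup>2 / l) / 2"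
            by (rule weighted_young[OF l])
          also have "(rho x powr a * \<bar>v x\<bar> powr (s - 1))\<^sup>2 = rho x powr (2 * a) * \<bar>v x\<bar> powr (2 * (s - 1))"
            using rp True by (simp add: power_mult_distrib powr_power)
          also have "\<dots> = rho x powr (2 * a) * \<bar>v x\<bar> powr p" unfolding sq ..
          \<comment> \<open>The exponent 2 * a is \<gamma> + 1, and \<open>rho\<close> is below
            1.\<close>
          also have "rho x powr (2 * a) \<le> rho x powr \<gamma>"
            using rp rho_le[of x] a\<gamma> by (intro powr_mono') auto
          finally show ?thesis using l by (simp add: divide_right_mono mult_right_mono)
        next
          case False
          then have "v x = 0" using C1c_outside[OF v] by blast
          then show ?thesis using s l p by (simp add: g_def)
        qed
      qed
      also have "\<dots> = (l * (\<integral>x. (v x)\<^sup>2 \<partial>lborel) + M / l) / 2"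
        using iv2 iM by (simp add: M_def)
      also have "\<dots> \<le> (l * F + M / l) / 2"
      proof (intro divide_right_mono add_mono mult_left_mono)
        have "(\<integral>x. rho x * (norm (v' x))\<^sup>2 \<partial>lborel) \<ge> 0"
          using rho_v' by (auto intro!: integral_nonneg_AE)
        then show "(\<integral>x. (v x)\<^sup>2 \<partial>lborel) \<le> F" using F by (simp add: E_def)
      qed (use l in auto)
      finally have T2: "(\<integral>x. rho x powr a * g x \<partial>lborel) \<le> sqrt (F * M)" unfolding sqF .
      define H where "H = D * sqrt (F * M)"
      have H: "H > 0" using D F0 M by (simp add: H_def)
      have "2 * (\<integral>x. rho x powr a * norm (g' x) \<partial>lborel) + (N + 2 * a) * (\<integral>x. rho x powr a * g x \<partial>lborel)
         \<le> 2 * (s * sqrt (F * M)) + (N + 2 * a) * sqrt (F * M)"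
        using N a by (intro add_mono mult_left_mono T1 T2) auto
      also have "\<dots> = H" by (simp add: H_def D_def algebra_simps)
      finally have "(\<integral>x. rho x powr ((1 - t) * (a - 1) + t * a * r) * g x powr ((1 - t) + t * r) \<partial>lborel)
         \<le> (1 / a + 1) * H powr ((1 - t) + t * r)"
        unfolding r_def N_def
        by (intro weighted_L1_inequality[OF g _ _ a t H]) (use n in \<open>auto simp: g_def\<close>)
      then have "M \<le> (1 / a + 1) * H powr q"
        unfolding exponent q by (simp add: M_def g_def powr_powr sq)
      also have "H powr q = D powr q * (F * M) powr (q / 2)"
        using D F0 M by (simp add: H_def powr_mult powr_half_sqrt[symmetric] powr_powr)
      also have "(1 / a + 1) * (D powr q * (F * M) powr (q / 2)) = K * (F powr (q / 2) * M powr (q / 2))"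
        using F0 M by (simp add: K_def powr_mult)
      finally have "M / M powr (q / 2) \<le> K * F powr (q / 2)"
        using M by (simp add: field_simps)
      also have "M / M powr (q / 2) = M powr (1 - q / 2)" using M by (simp add: powr_diff)
      \<comment> \<open>As 1 - q / 2 = 2 / (p + 2) and q / 2 = p / (p + 2), the power (p + 2) / p
        leaves \<open>M powr (2 / p)\<close> on the left and \<open>F\<close> to the first power on
        the right.\<close>
      finally have "(M powr (1 - q / 2)) powr ((p + 2) / p) \<le> (K * F powr (q / 2)) powr ((p + 2) / p)"
        using p by (intro powr_mono2) auto
      also have "(M powr (1 - q / 2)) powr ((p + 2) / p) = M powr (2 / p)"
      proof -
        have e1: "1 - q / 2 = 2 / (p + 2)" using p by (simp add: q_def field_simps)
        have frac: "2 / b * (b / p) = 2 / p" if "b \<noteq> 0" for b using that by simp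
        have "p + 2 \<noteq> 0" using p by simp
        show ?thesis unfolding powr_powr e1 frac[OF \<open>p + 2 \<noteq> 0\<close>] ..
      qed
      also have "(K * F powr (q / 2)) powr ((p + 2) / p) = K powr ((p + 2) / p) * F"
      proof -
        have "p / b * (b / p) = 1" if "b \<noteq> 0" for b using that p by simp
        from this[of "p + 2"] have e: "q / 2 * ((p + 2) / p) = 1" using p by (simp add: q_def)
        have "(K * F powr (q / 2)) powr ((p + 2) / p) = K powr ((p + 2) / p) * F powr (q / 2 * ((p + 2) / p))"
          using K F0 by (simp add: powr_mult powr_powr)
        then show ?thesis unfolding e using F0 by simp
      qed
      finally show ?thesis .
    qed
    have "M powr (2 / p) \<le> K powr ((p + 2) / p) * E"
    proof (rule field_le_epsilon)
      fix e :: real assume e: "e > 0"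
      have "M powr (2 / p) \<le> K powr ((p + 2) / p) * (E + e / K powr ((p + 2) / p))"
        using e K by (intro bound) auto
      also have "\<dots> = K powr ((p + 2) / p) * E + e" using K by (simp add: algebra_simps)
      finally show "M powr (2 / p) \<le> K powr ((p + 2) / p) * E + e" .
    qed
    then show "(\<integral>x. rho x powr ((real DIM('a) - 1) * p / 2 - real DIM('a)) * \<bar>v x\<bar> powr p \<partial>lborel) powr (2 / p)
      \<le> K powr ((p + 2) / p) * ((\<integral>x. rho x * (norm (v' x))\<^sup>2 \<partial>lborel) + (\<integral>x. (v x)\<^sup>2 \<partial>lborel))"
      by (simp add: M_def E_def \<gamma>_def N_def)
  qed
qed

text \<open>The quadratic form of \<open>A\<close> in Euclidean terms: the squared hyperbolic length
  of the gradient is rho^2 |w'|^2 and dV is rho^-N dx. Only one derivative occurs, so the form makes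
  sense for powers of |u|.\<close>

definition hyp_energy :: "('a::euclidean_space \<Rightarrow> real) \<Rightarrow> ('a \<Rightarrow> 'a) \<Rightarrow> real"
  where "hyp_energy w w' = (\<integral>x. rho x powr (2 - real DIM('a)) * (norm (w' x))\<^sup>2 \<partial>lborel)
     - (real DIM('a) - 1)\<^sup>2 / 4 * (\<integral>x. rho x powr (- real DIM('a)) * (w x)\<^sup>2 \<partial>lborel)"

text \<open>Expanding |v'|^2 gives a cross term in w (x . w'), half the radial derivative of w^2,
  which \<open>radial_divergence_rho\<close> turns into \<open>A0\<close> and \<open>A1\<close>. The
  coefficient of \<open>A0\<close> becomes m^2 / 4 - m^2 / 2 = - m^2 / 4, exactly the spectral
  shift, and that of \<open>A1\<close> becomes - m (N - m) / 2 = - m / 2, which moves to the other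
  side as the positive remainder.\<close>

lemma ground_state:
  fixes w :: "'a::euclidean_space \<Rightarrow> real"
  assumes w: "C1c (ball 0 1) w w'"
  defines "c \<equiv> - (real DIM('a) - 1) / 2"
  defines "v \<equiv> \<lambda>x. rho x powr c * w x"
    and "v' \<equiv> \<lambda>x. rho x powr c *\<^sub>R w' x + w x *\<^sub>R (- (c * rho x powr (c - 1)) *\<^sub>R x)"
  shows "hyp_energy w w' = (\<integral>x. rho x * (norm (v' x))\<^sup>2 \<partial>lborel) + (real DIM('a) - 1) / 2 * (\<integral>x. (v x)\<^sup>2 \<partial>lborel)"
proof -
  define N where "N = real DIM('a)"
  define m where "m = N - 1"
  note wc = C1c_continuous_Cc[OF w]
  have c: "c = - m / 2" by (simp add: c_def m_def N_def)
  have c2: "Cc (ball 0 1) (\<lambda>x. (w x)\<^sup>2)"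
    by (intro Cc_transfer[OF wc(1)] continuous_intros wc) auto
  have i2: "integrable lborel (\<lambda>x. rho x powr e * (w x)\<^sup>2)" for e
    by (intro Cc_integrable[of "ball 0 1"] Cc_rho c2)
  have "Cc (ball 0 1) (\<lambda>x. (norm (w' x))\<^sup>2)"
    by (intro Cc_transfer[OF wc(2)] continuous_intros wc) auto
  then have i3: "integrable lborel (\<lambda>x. rho x powr e * (norm (w' x))\<^sup>2)" for e
    by (intro Cc_integrable[of "ball 0 1"] Cc_rho)
  have "Cc (ball 0 1) (\<lambda>x. w x * (x \<bullet> w' x))"
    by (intro Cc_transfer[OF wc(1)] continuous_intros wc) auto
  then have i4: "integrable lborel (\<lambda>x. rho x powr e * (w x * (x \<bullet> w' x)))" for e
    by (intro Cc_integrable[of "ball 0 1"] Cc_rho)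
  define A0 where "A0 = (\<integral>x. rho x powr (- N) * (w x)\<^sup>2 \<partial>lborel)"
  define A1 where "A1 = (\<integral>x. rho x powr (- m) * (w x)\<^sup>2 \<partial>lborel)"
  define A2 where "A2 = (\<integral>x. rho x powr (2 - N) * (norm (w' x))\<^sup>2 \<partial>lborel)"
  define A3 where "A3 = (\<integral>x. rho x powr (- m) * (w x * (x \<bullet> w' x)) \<partial>lborel)"
  have "C1c (ball 0 1) (\<lambda>x. (w x)\<^sup>2) (\<lambda>x. (2 * w x) *\<^sub>R w' x)"
    by (rule C1c_compose[OF w]) (auto intro!: derivative_eq_intros continuous_intros)
  from radial_divergence_rho[OF this, of "- m"]
  have "- m * A0 = (\<integral>x. 2 * (rho x powr (- m) * (w x * (x \<bullet> w' x))) \<partial>lborel) + (N - 2 * m) * A1"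
    by (simp add: A0_def A1_def N_def[symmetric] m_def mult_ac)
  then have rad: "- m * A0 = 2 * A3 + (N - 2 * m) * A1" by (simp add: A3_def)
  have vsq: "(v x)\<^sup>2 = rho x powr (- m) * (w x)\<^sup>2" for x
  proof (cases "x \<in> ball 0 1")
    case True
    then show ?thesis using rho_pos[OF True] by (simp add: v_def c power_mult_distrib powr_power)
  qed (simp add: v_def C1c_outside[OF w])
  have v'sq: "rho x * (norm (v' x))\<^sup>2 = rho x powr (2 - N) * (norm (w' x))\<^sup>2
      + m * (rho x powr (- m) * (w x * (x \<bullet> w' x)))
      + m\<^sup>2 / 4 * (rho x powr (- N) * (w x)\<^sup>2) - m\<^sup>2 / 2 * (rho x powr (- m) * (w x)\<^sup>2)" for x
  proof (cases "x \<in> ball 0 1")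
    case True
    note rp = rho_pos[OF True]
    define R where "R = rho x powr c"
    have R1: "rho x powr (c - 1) = R / rho x" using rp by (simp add: R_def powr_diff)
    have R2: "R\<^sup>2 = rho x powr (- m)" using rp by (simp add: R_def c powr_power)
    have e1: "rho x powr (2 - N) = rho x * R\<^sup>2" unfolding R2 using rho_mult_powr[OF True, of "-m"] by (simp add: m_def)
    have e2: "rho x powr (- N) = R\<^sup>2 / rho x" unfolding R2 using rp rho_mult_powr[OF True, of "- N"] by (simp add: m_def field_simps)
    have "v' x = R *\<^sub>R (w' x + (m / 2 * w x / rho x) *\<^sub>R x)"
      unfolding v'_def R1 R_def[symmetric] by (simp add: c algebra_simps)
    moreover have "(norm (k *\<^sub>R (y + z *\<^sub>R x)))\<^sup>2 = k\<^sup>2 * ((norm y)\<^sup>2 + 2 * z * (x \<bullet> y) + z\<^sup>2 * (norm x)\<^sup>2)" for k z y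
      unfolding power2_norm_eq_inner by (simp add: inner_add_left inner_add_right inner_commute power2_eq_square algebra_simps)
    ultimately have "(norm (v' x))\<^sup>2 = R\<^sup>2 * ((norm (w' x))\<^sup>2 + 2 * (m / 2 * w x / rho x) * (x \<bullet> w' x)
        + (m / 2 * w x / rho x)\<^sup>2 * (norm x)\<^sup>2)" by (simp only:)
    then have v'_eq: "(norm (v' x))\<^sup>2 = R\<^sup>2 * ((norm (w' x))\<^sup>2 + 2 * (m / 2 * w x / rho x) * (x \<bullet> w' x)
        + (m / 2 * w x / rho x)\<^sup>2 * (1 - 2 * rho x))" unfolding norm_sq_rho[of x] .
    define z where "z = w x / rho x"
    have wz: "w x = z * rho x" "m / 2 * w x / rho x = m / 2 * z" using rp by (auto simp: z_def)
    have "R\<^sup>2 / rho x * (w x)\<^sup>2 = R\<^sup>2 * z\<^sup>2 * rho x" using rp by (simp add: wz(1) power2_eq_square)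
    then show ?thesis
      unfolding v'_eq e1 e2 R2[symmetric] wz(2) using rp by (simp add: wz(1) power2_eq_square field_simps)
  qed (simp add: v'_def C1c_outside[OF w])
  have "(\<integral>x. rho x * (norm (v' x))\<^sup>2 \<partial>lborel) = A2 + m * A3 + m\<^sup>2 / 4 * A0 - m\<^sup>2 / 2 * A1"
    unfolding v'sq A0_def A1_def A2_def A3_def using i2 i3 i4 by simp
  moreover have "(\<integral>x. (v x)\<^sup>2 \<partial>lborel) = A1" unfolding vsq A1_def ..
  moreover have "hyp_energy w w' = A2 - m\<^sup>2 / 4 * A0"
    by (simp add: hyp_energy_def A2_def A0_def N_def m_def)
  moreover have "m * A3 = m * (- m * A0 - (N - 2 * m) * A1) / 2" using rad by simp
  ultimately show ?thesis by (simp add: N_def[symmetric] m_def[symmetric]) (simp add: m_def power2_eq_square field_simps)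
qed

lemma rho_norm_gradient_nonneg: "C1c (ball 0 1) v v' \<Longrightarrow> 0 \<le> rho x * (norm (v' x))\<^sup>2"
  using rho_pos[of x] C1c_outside[of v v' x] by (cases "x \<in> ball 0 1") auto

lemma hyp_energy_nonneg:
  fixes w :: "'a::euclidean_space \<Rightarrow> real"
  assumes w: "C1c (ball 0 1) w w'"
  shows "hyp_energy w w' \<ge> 0"
proof -
  have "1 \<le> real DIM('a)" using DIM_positive[where 'a='a] by linarith
  then show ?thesis
    unfolding ground_state[OF w]
    by (intro add_nonneg_nonneg mult_nonneg_nonneg integral_nonneg_AE AE_I2
          rho_norm_gradient_nonneg[OF C1c_rho[OF w]]) auto
qed

lemma poincare_sobolev:
  assumes n: "DIM('a) \<ge> 3" and p: "2 < p" "p \<le> 2 * real DIM('a) / (real DIM('a) - 2)"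
  shows "\<exists>C>0. \<forall>(w :: 'a::euclidean_space \<Rightarrow> real) w'. C1c (ball 0 1) w w' \<longrightarrow>
    (\<integral>x. rho x powr (- real DIM('a)) * \<bar>w x\<bar> powr p \<partial>lborel) powr (2 / p) \<le> C * hyp_energy w w'"
proof -
  obtain C where C: "C > 0" and *: "\<And>(v :: 'a \<Rightarrow> real) v'. C1c (ball 0 1) v v' \<Longrightarrow>
    (\<integral>x. rho x powr ((real DIM('a) - 1) * p / 2 - real DIM('a)) * \<bar>v x\<bar> powr p \<partial>lborel) powr (2 / p)
    \<le> C * ((\<integral>x. rho x * (norm (v' x))\<^sup>2 \<partial>lborel) + (\<integral>x. (v x)\<^sup>2 \<partial>lborel))"
    using weighted_sobolev[OF assms] by blast
  show ?thesis
  proof (intro exI[of _ C] conjI allI impI C)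
    fix w :: "'a \<Rightarrow> real" and w' assume w: "C1c (ball 0 1) w w'"
    define N where "N = real DIM('a)"
    define c where "c = - (N - 1) / 2"
    let ?v = "\<lambda>x. rho x powr c * w x"
    let ?v' = "\<lambda>x. rho x powr c *\<^sub>R w' x + w x *\<^sub>R (- (c * rho x powr (c - 1)) *\<^sub>R x)"
    \<comment> \<open>The weight exponent in \<open>weighted_sobolev\<close> is made for this:
      adding c * p to it leaves - N.\<close>
    have eq: "rho x powr ((N - 1) * p / 2 - N) * \<bar>?v x\<bar> powr p = rho x powr (- N) * \<bar>w x\<bar> powr p" for x
    proof (cases "x \<in> ball 0 1")
      case True
      note rp = rho_pos[OF True]
      have "rho x powr ((N - 1) * p / 2 - N) * \<bar>?v x\<bar> powr p
        = rho x powr ((N - 1) * p / 2 - N) * rho x powr (c * p) * \<bar>w x\<bar> powr p"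
        using rp by (simp add: abs_mult powr_mult powr_powr)
      also have "rho x powr ((N - 1) * p / 2 - N) * rho x powr (c * p) = rho x powr (- N)"
        unfolding powr_add[symmetric] by (simp add: c_def field_simps)
      finally show ?thesis .
    qed (use p C1c_outside[OF w] in simp)
    have "(\<integral>x. rho x powr (- N) * \<bar>w x\<bar> powr p \<partial>lborel) powr (2 / p)
       \<le> C * ((\<integral>x. rho x * (norm (?v' x))\<^sup>2 \<partial>lborel) + (\<integral>x. (?v x)\<^sup>2 \<partial>lborel))"
      using *[OF C1c_rho[OF w, of c]] unfolding N_def[symmetric] eq .
    also have "\<dots> \<le> C * hyp_energy w w'"
    proof (intro mult_left_mono)
      \<comment> \<open>For N \<ge> 3 the coefficient (N - 1) / 2 of the remainder is at least
        1.\<close>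
      have "1 * (\<integral>x. (?v x)\<^sup>2 \<partial>lborel) \<le> (N - 1) / 2 * (\<integral>x. (?v x)\<^sup>2 \<partial>lborel)"
        using n by (intro mult_right_mono integral_nonneg_AE) (auto simp: N_def)
      then show "(\<integral>x. rho x * (norm (?v' x))\<^sup>2 \<partial>lborel) + (\<integral>x. (?v x)\<^sup>2 \<partial>lborel) \<le> hyp_energy w w'"
        unfolding ground_state[OF w] c_def N_def by simp
    qed (use C in auto)
    finally show "(\<integral>x. rho x powr (- real DIM('a)) * \<bar>w x\<bar> powr p \<partial>lborel) powr (2 / p) \<le> C * hyp_energy w w'"
      unfolding N_def .
  qed
qed

section \<open>Smooth functions and the shifted Laplacian\<close>

lemma pderiv_at_eq:
  assumes "(u has_derivative D) (at x)"
  shows "pderiv_at i u x = D (axis i 1)"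
proof -
  have 1: "((\<lambda>t. x + t *\<^sub>R axis i 1) has_derivative (\<lambda>t. t *\<^sub>R axis i 1)) (at 0)"
    by (auto intro!: derivative_eq_intros)
  have "(u has_derivative D) (at (x + 0 *\<^sub>R axis i 1))" using assms by simp
  from has_derivative_compose[OF 1 this]
  have "((\<lambda>t. u (x + t *\<^sub>R axis i 1)) has_derivative (\<lambda>t. D (t *\<^sub>R axis i 1))) (at 0)" .
  moreover have "D (t *\<^sub>R axis i 1) = t * D (axis i 1)" for t
    using has_derivative_linear[OF assms] by (simp add: linear_cmul)
  ultimately have "((\<lambda>t. u (x + t *\<^sub>R axis i 1)) has_real_derivative D (axis i 1)) (at 0)"
    by (intro has_derivative_imp_has_field_derivative) auto
  then show ?thesis unfolding pderiv_at_def by (rule DERIV_imp_deriv)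
qed

lemma pderiv_at_cong:
  assumes "open U" "x \<in> U" "\<And>y. y \<in> U \<Longrightarrow> u y = v y"
  shows "pderiv_at i u x = pderiv_at i v x"
  unfolding pderiv_at_def
proof (rule deriv_cong_ev)
  have "((\<lambda>t. x + t *\<^sub>R axis i 1) \<longlongrightarrow> x + 0 *\<^sub>R axis i 1) (nhds (0::real))"
    by (intro tendsto_intros filterlim_ident)
  then have "((\<lambda>t. x + t *\<^sub>R axis i 1) \<longlongrightarrow> x) (nhds (0::real))" by simp
  then have "\<forall>\<^sub>F t in nhds (0::real). x + t *\<^sub>R axis i 1 \<in> U"
    using assms(1,2) by (rule topological_tendstoD)
  then show "\<forall>\<^sub>F t in nhds 0. u (x + t *\<^sub>R axis i 1) = v (x + t *\<^sub>R axis i 1)"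
    by eventually_elim (rule assms(3))
qed simp

definition grad :: "(real ^ 'n::finite \<Rightarrow> real) \<Rightarrow> real ^ 'n \<Rightarrow> real ^ 'n"
  where "grad u x = (\<chi> i. pderiv_at i u x)"

lemma has_derivative_grad:
  assumes "u differentiable (at x)"
  shows "(u has_derivative (\<lambda>h. grad u x \<bullet> h)) (at x)"
proof -
  obtain D where D: "(u has_derivative D) (at x)" using assms by (auto simp: differentiable_def)
  have "D h = grad u x \<bullet> h" for h
  proof -
    have lin: "linear D" using D by (rule has_derivative_linear)
    have "(\<Sum>i\<in>UNIV. (h $ i) *\<^sub>R axis i 1) = h"
      using basis_expansion[of h] by (simp add: scalar_mult_eq_scaleR)
    then have "D h = D (\<Sum>i\<in>UNIV. (h $ i) *\<^sub>R axis i 1)" by simp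
    also have "\<dots> = (\<Sum>i\<in>UNIV. h $ i * D (axis i 1))"
      using lin by (simp add: linear_sum linear_cmul)
    also have "\<dots> = grad u x \<bullet> h"
      by (simp add: grad_def inner_vec_def pderiv_at_eq[OF D] mult.commute)
    finally show ?thesis .
  qed
  then have "D = (\<lambda>h. grad u x \<bullet> h)" by auto
  then show ?thesis using D by simp
qed

lemma Ck_on_SucD: "Ck_on (Suc m) S u \<Longrightarrow> Ck_on m S u"
proof (induction m arbitrary: u)
  case 0
  then show ?case
    by (auto intro!: continuous_at_imp_continuous_on differentiable_imp_continuous_within)
next
  case (Suc m)
  then show ?case by simp
qed

text \<open>The open sets \<open>S\<close> and the complement of \<open>K\<close> cover the space,
  and partial derivatives again vanish off \<open>K\<close>. After this passage the rules for
  \<open>Ck_on\<close> are needed on the whole space only.\<close>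

lemma Ck_on_extend_zero:
  fixes u :: "real ^ 'n::finite \<Rightarrow> real"
  assumes "open S" "closed K" "K \<subseteq> S"
  shows "Ck_on m S u \<Longrightarrow> (\<And>x. x \<notin> K \<Longrightarrow> u x = 0) \<Longrightarrow> Ck_on m UNIV u"
proof (induction m arbitrary: u)
  case 0
  have "continuous_on (S \<union> - K) u"
    using 0 assms by (intro continuous_on_open_Un) (auto intro: continuous_on_eq[OF continuous_on_const[of _ 0]])
  moreover have "S \<union> - K = UNIV" using assms by auto
  ultimately show ?case by simp
next
  case (Suc m)
  have oK: "open (- K)" using assms by auto
  have "u differentiable (at x)" for x
  proof (cases "x \<in> S")
    case False
    then have "x \<in> - K" using assms by auto
    then have "(u has_derivative (\<lambda>_. 0)) (at x)"
      by (intro has_derivative_transform_within_open[OF has_derivative_const[of 0] oK])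
         (use Suc.prems in auto)
    then show ?thesis by (auto simp: differentiable_def)
  qed (use Suc.prems in auto)
  moreover have "Ck_on m UNIV (pderiv_at i u)" for i
  proof (rule Suc.IH)
    show "Ck_on m S (pderiv_at i u)" using Suc.prems by simp
    fix x assume "x \<notin> K"
    then have "pderiv_at i u x = pderiv_at i (\<lambda>_. 0) x"
      using Suc.prems(2) by (intro pderiv_at_cong[OF oK]) auto
    then show "pderiv_at i u x = 0" by (simp add: pderiv_at_def)
  qed
  ultimately show ?case by simp
qed

lemma Ck_on_const: "Ck_on m UNIV (\<lambda>_::real ^ 'n::finite. c)"
proof (induction m arbitrary: c)
  case (Suc m)
  have "pderiv_at i (\<lambda>_::real ^ 'n. c) = (\<lambda>_. 0)" for i by (simp add: pderiv_at_def fun_eq_iff)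
  then show ?case using Suc by simp
qed simp

lemma Ck_on_component: "Ck_on m UNIV (\<lambda>x::real ^ 'n::finite. x $ j)"
proof (cases m)
  case (Suc k)
  have "((\<lambda>x::real ^ 'n. x $ j) has_derivative (\<lambda>h. h $ j)) (at x)" for x
    by (rule bounded_linear_imp_has_derivative) (rule bounded_linear_vec_nth)
  moreover from pderiv_at_eq[OF this]
  have "pderiv_at i (\<lambda>x::real ^ 'n. x $ j) = (\<lambda>_. axis i 1 $ j)" for i by (simp add: fun_eq_iff)
  ultimately show ?thesis using Suc Ck_on_const by (auto simp: differentiable_def)
qed (auto intro!: continuous_intros)

lemma pderiv_at_add:
  assumes "u differentiable (at x)" "v differentiable (at x)"
  shows "pderiv_at i (\<lambda>x. u x + v x) x = pderiv_at i u x + pderiv_at i v x"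
proof -
  obtain D E where "(u has_derivative D) (at x)" "(v has_derivative E) (at x)"
    using assms by (auto simp: differentiable_def)
  then show ?thesis
    using pderiv_at_eq[OF has_derivative_add[of u D "at x" v E]] by (simp add: pderiv_at_eq)
qed

lemma pderiv_at_mult:
  assumes "u differentiable (at x)" "v differentiable (at x)"
  shows "pderiv_at i (\<lambda>x. u x * v x) x = u x * pderiv_at i v x + pderiv_at i u x * v x"
proof -
  obtain D E where "(u has_derivative D) (at x)" "(v has_derivative E) (at x)"
    using assms by (auto simp: differentiable_def)
  then show ?thesis
    using pderiv_at_eq[OF has_derivative_mult[of u D x UNIV v E]] by (simp add: pderiv_at_eq)
qed

lemma Ck_on_add: "Ck_on m UNIV u \<Longrightarrow> Ck_on m UNIV v \<Longrightarrow> Ck_on m UNIV (\<lambda>x. u x + v x)"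
proof (induction m arbitrary: u v)
  case (Suc m)
  have "pderiv_at i (\<lambda>x. u x + v x) = (\<lambda>x. pderiv_at i u x + pderiv_at i v x)" for i
    using Suc.prems by (simp add: fun_eq_iff pderiv_at_add)
  then show ?case using Suc by (auto intro!: differentiable_add)
qed (auto intro: continuous_intros)

lemma Ck_on_mult: "Ck_on m UNIV u \<Longrightarrow> Ck_on m UNIV v \<Longrightarrow> Ck_on m UNIV (\<lambda>x. u x * v x)"
proof (induction m arbitrary: u v)
  case (Suc m)
  have "pderiv_at i (\<lambda>x. u x * v x) = (\<lambda>x. u x * pderiv_at i v x + pderiv_at i u x * v x)" for i
    using Suc.prems by (simp add: fun_eq_iff pderiv_at_mult)
  moreover have "Ck_on m UNIV (\<lambda>x. u x * pderiv_at i v x + pderiv_at i u x * v x)" for i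
    using Suc.prems Ck_on_SucD[OF Suc.prems(1)] Ck_on_SucD[OF Suc.prems(2)]
    by (intro Ck_on_add Suc.IH) auto
  ultimately show ?case using Suc.prems by (auto intro!: differentiable_mult)
qed (auto intro: continuous_intros)

lemma Ck_on_sum:
  "finite I \<Longrightarrow> (\<And>i. i \<in> I \<Longrightarrow> Ck_on m UNIV (f i)) \<Longrightarrow> Ck_on m UNIV (\<lambda>x. \<Sum>i\<in>I. f i x)"
  by (induction I rule: finite_induct) (auto intro: Ck_on_add Ck_on_const)

definition smooth :: "(real ^ 'n::finite \<Rightarrow> real) \<Rightarrow> bool"
  where "smooth u \<longleftrightarrow> (\<forall>m. Ck_on m UNIV u)"

lemma smooth_intros:
  "smooth (\<lambda>_. c)" "smooth (\<lambda>x. x $ i)"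
  "smooth u \<Longrightarrow> smooth v \<Longrightarrow> smooth (\<lambda>x. u x + v x)"
  "smooth u \<Longrightarrow> smooth v \<Longrightarrow> smooth (\<lambda>x. u x * v x)"
  "(\<And>i. i \<in> I \<Longrightarrow> smooth (f i)) \<Longrightarrow> finite I \<Longrightarrow> smooth (\<lambda>x. \<Sum>i\<in>I. f i x)"
  by (auto simp: smooth_def intro: Ck_on_const Ck_on_component Ck_on_add Ck_on_mult Ck_on_sum)

lemma smoothD:
  assumes "smooth u"
  shows "u differentiable (at x)" "smooth (pderiv_at i u)" "continuous_on S u"
proof -
  have 1: "Ck_on (Suc m) UNIV u" "Ck_on 0 UNIV u" for m using assms by (auto simp: smooth_def)
  show "u differentiable (at x)" "smooth (pderiv_at i u)" using 1(1) by (auto simp: smooth_def)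
  show "continuous_on S u" using 1(2) continuous_on_subset[of UNIV u S] by simp
qed

lemma smooth_rho: "smooth (rho :: real ^ 'n::finite \<Rightarrow> real)"
proof -
  have *: "rho = (\<lambda>x::real ^ 'n. 1 / 2 + (- 1 / 2) * (\<Sum>i\<in>UNIV. x $ i * x $ i))"
    by (simp add: rho_def fun_eq_iff power2_norm_eq_inner inner_vec_def diff_divide_distrib)
  show ?thesis unfolding * by (intro smooth_intros) simp
qed

definition test_fun :: "(real ^ 'n::finite \<Rightarrow> real) \<Rightarrow> bool"
  where "test_fun u \<longleftrightarrow> smooth u \<and> Cc (ball 0 1) u"

lemma test_functions_test_fun: "u \<in> test_functions \<Longrightarrow> test_fun u"
proof -
  assume u: "u \<in> test_functions"
  let ?K = "closure {x. u x \<noteq> 0}"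
  have K: "compact ?K" "?K \<subseteq> ball 0 1" and Ck: "\<And>m. Ck_on m (ball 0 1) u"
    using u by (auto simp: test_functions_def)
  have z: "u x = 0" if "x \<notin> ?K" for x using that closure_subset[of "{x. u x \<noteq> 0}"] by auto
  have "Ck_on m UNIV u" for m
    by (rule Ck_on_extend_zero[OF open_ball _ K(2) Ck z]) auto
  moreover have "Cc (ball 0 1) u"
    unfolding Cc_def
  proof (intro conjI exI[of _ ?K] allI impI)
    show "continuous_on (ball 0 1) u" using Ck[of 0] by simp
  qed (fact K z)+
  ultimately show ?thesis by (simp add: test_fun_def smooth_def)
qed

lemma test_fun_C1c:
  assumes "test_fun u"
  shows "C1c (ball 0 1) u (grad u)"
proof -
  have s: "smooth u" and c: "Cc (ball 0 1) u" using assms by (auto simp: test_fun_def)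
  obtain K where K: "compact K" "K \<subseteq> ball 0 1" "\<forall>x. x \<notin> K \<longrightarrow> u x = 0" using c by (auto simp: Cc_def)
  have "pderiv_at i u x = 0" if "x \<notin> K" for i x
  proof -
    have "pderiv_at i u x = pderiv_at i (\<lambda>_. 0) x"
      using K that by (intro pderiv_at_cong[of "- K"]) (auto simp: compact_imp_closed)
    then show ?thesis by (simp add: pderiv_at_def)
  qed
  then have g0: "grad u x = 0" if "x \<notin> K" for x using that by (simp add: grad_def vec_eq_iff)
  have "continuous_on (ball 0 1) (grad u)"
    unfolding grad_def[abs_def] by (intro continuous_on_vec_lambda smoothD(3) smoothD(2)[OF s])
  then have "Cc (ball 0 1) (grad u)"
    unfolding Cc_def using K(1,2) g0 by (intro conjI exI[of _ K] allI impI)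
  then show ?thesis
    unfolding C1c_def using c by (intro conjI allI has_derivative_grad smoothD(1)[OF s])
qed

lemma test_fun_pderiv:
  assumes "test_fun u" shows "test_fun (pderiv_at i u)"
  unfolding test_fun_def
proof
  show s: "smooth (pderiv_at i u)" using assms smoothD(2)[of u] by (simp add: test_fun_def)
  show "Cc (ball 0 1) (pderiv_at i u)"
    by (rule Cc_transfer[OF C1cD(3)[OF test_fun_C1c[OF assms]] smoothD(3)[OF s]])
       (simp add: grad_def vec_eq_iff)
qed

lemma test_fun_add: "test_fun u \<Longrightarrow> test_fun v \<Longrightarrow> test_fun (\<lambda>x. u x + v x)"
  unfolding test_fun_def by (intro conjI smooth_intros(3) Cc_add) auto

lemma test_fun_mult: "smooth u \<Longrightarrow> test_fun v \<Longrightarrow> test_fun (\<lambda>x. u x * v x)"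
  unfolding test_fun_def by (intro conjI smooth_intros(4) Cc_mult(2) smoothD(3)) auto

lemma test_fun_sum:
  "finite I \<Longrightarrow> (\<And>i. i \<in> I \<Longrightarrow> test_fun (f i)) \<Longrightarrow> test_fun (\<lambda>x. \<Sum>i\<in>I. f i x)"
proof (induction I rule: finite_induct)
  case empty
  have "test_fun (\<lambda>_. 0)"
    unfolding test_fun_def Cc_def using smooth_intros(1)[of 0] by auto
  then show ?case by simp
qed (auto intro: test_fun_add)

lemma hyp_laplace_rho:
  "hyp_laplace u x = (rho x * rho x) * (\<Sum>i\<in>UNIV. pderiv_at i (pderiv_at i u) x)
     + (real CARD('n) - 2) * rho x * (\<Sum>i\<in>UNIV. x $ i * pderiv_at i u x)"
  for u :: "real ^ 'n::finite \<Rightarrow> real"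
  unfolding hyp_laplace_def norm_sq_rho by (simp add: field_simps)

section \<open>The operator A and its quadratic form\<close>

definition hyp_A :: "(real ^ 'n::finite \<Rightarrow> real) \<Rightarrow> real ^ 'n \<Rightarrow> real"
  where "hyp_A u x = - hyp_laplace u x - (real CARD('n) - 1)\<^sup>2 / 4 * u x"

lemma test_fun_hyp_A:
  assumes u: "test_fun u" shows "test_fun (hyp_A u)"
proof -
  have "test_fun (\<lambda>x. ((- 1) * (rho x * rho x)) * (\<Sum>i\<in>UNIV. pderiv_at i (pderiv_at i u) x)
     + (((- (real CARD('a) - 2)) * rho x) * (\<Sum>i\<in>UNIV. x $ i * pderiv_at i u x)
     + (- (real CARD('a) - 1)\<^sup>2 / 4) * u x))"
    by (intro test_fun_add test_fun_mult test_fun_sum test_fun_pderiv smooth_intros smooth_rho u) auto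
  also have "(\<lambda>x. ((- 1) * (rho x * rho x)) * (\<Sum>i\<in>UNIV. pderiv_at i (pderiv_at i u) x)
     + (((- (real CARD('a) - 2)) * rho x) * (\<Sum>i\<in>UNIV. x $ i * pderiv_at i u x)
     + (- (real CARD('a) - 1)\<^sup>2 / 4) * u x)) = hyp_A u"
    unfolding hyp_A_def hyp_laplace_rho by (simp add: fun_eq_iff algebra_simps)
  finally show ?thesis .
qed

lemma pderiv_at_cmult:
  assumes "u differentiable (at x)"
  shows "pderiv_at i (\<lambda>x. d * u x) x = d * pderiv_at i u x"
  using pderiv_at_mult[OF differentiable_const[of d] assms] by (simp add: pderiv_at_def)

lemma hyp_A_linear:
  assumes f: "smooth f" and g: "smooth g"
  shows "hyp_A (\<lambda>x. f x + d * g x) = (\<lambda>x. hyp_A f x + d * hyp_A g x)"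
proof -
  have 1: "pderiv_at i (\<lambda>x. f x + d * g x) = (\<lambda>x. pderiv_at i f x + d * pderiv_at i g x)"
    if "smooth f" "smooth g" for i f g
    using that by (auto simp: fun_eq_iff pderiv_at_add pderiv_at_cmult smoothD(1) smooth_intros)
  have 2: "(\<Sum>i\<in>UNIV. a i + d * b i) = (\<Sum>i\<in>UNIV. a i) + d * (\<Sum>i\<in>UNIV. b i)" for a b :: "'a \<Rightarrow> real"
    by (simp add: sum.distrib sum_distrib_left)
  have 3: "(\<Sum>i\<in>UNIV. y i * (a i + d * b i)) = (\<Sum>i\<in>UNIV. y i * a i) + d * (\<Sum>i\<in>UNIV. y i * b i)"
    for a b y :: "'a \<Rightarrow> real"
    by (simp add: sum.distrib sum_distrib_left algebra_simps)
  show ?thesis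
    unfolding hyp_A_def hyp_laplace_rho 1[OF f g] 1[OF smoothD(2)[OF f] smoothD(2)[OF g]] 2 3
    by (simp add: fun_eq_iff algebra_simps)
qed

definition hyp_inner :: "(real ^ 'n::finite \<Rightarrow> real) \<Rightarrow> (real ^ 'n \<Rightarrow> real) \<Rightarrow> real"
  where "hyp_inner f g = (\<integral>x. rho x powr (- real CARD('n)) * (f x * g x) \<partial>lborel)"

text \<open>In divergence form \<open>hyp_laplace u\<close> is rho^N div (rho^(2 - N) grad u), so
  against rho^-N h it can be integrated by parts coordinatewise. \<open>h\<close> is merely C1
  because powers of |u| with sign, which need not be smooth, are inserted for it later.\<close>

lemma hyp_green:
  fixes u :: "real ^ 'n::finite \<Rightarrow> real"
  assumes u: "test_fun u" and h: "C1c (ball 0 1) h h'"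
  shows "hyp_inner (hyp_A u) h = (\<integral>x. rho x powr (2 - real CARD('n)) * (grad u x \<bullet> h' x) \<partial>lborel)
     - (real CARD('n) - 1)\<^sup>2 / 4 * hyp_inner u h"
proof -
  define N where "N = real CARD('n)"
  note uc = C1c_continuous_Cc[OF test_fun_C1c[OF u]] and hc = C1c_continuous_Cc[OF h]
  have cp: "continuous_on (ball 0 1) (pderiv_at i u)" for i
    using test_fun_pderiv[OF u] smoothD(3) by (auto simp: test_fun_def)
  have tp2: "test_fun (pderiv_at i (pderiv_at i u))" for i by (intro test_fun_pderiv u)
  have cpp: "continuous_on (ball 0 1) (pderiv_at i (pderiv_at i u))" for i
    using tp2 smoothD(3) by (auto simp: test_fun_def)
  define P where "P i x = rho x powr (2 - N) * (pderiv_at i u x * h' x $ i)" for i x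
  define L where "L i x = rho x powr (2 - N) * (h x * pderiv_at i (pderiv_at i u) x)
     + (N - 2) * (rho x powr (1 - N) * (h x * (x $ i * pderiv_at i u x)))" for i x
  have Pi: "integrable lborel (P i)" for i
    unfolding P_def[abs_def]
    by (intro Cc_integrable[of "ball 0 1"] Cc_rho Cc_transfer[OF hc(2)] continuous_intros cp hc) auto
  have Li: "integrable lborel (L i)" for i
    unfolding L_def[abs_def]
    by (intro Cc_integrable[of "ball 0 1"] Cc_rho Cc_add Cc_mult(2)[OF _ continuous_on_const] Cc_mult(1)[OF hc(1)] continuous_intros cp cpp)
  have PL: "(\<integral>x. P i x \<partial>lborel) + (\<integral>x. L i x \<partial>lborel) = 0" for i
  proof -
    have 1: "C1c (ball 0 1) (\<lambda>x. pderiv_at i u x * h x)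
      (\<lambda>x. pderiv_at i u x *\<^sub>R h' x + h x *\<^sub>R grad (pderiv_at i u) x)"
      using C1cD(1)[OF test_fun_C1c[OF test_fun_pderiv[OF u]]] C1c_continuous_Cc(6)[OF test_fun_C1c[OF test_fun_pderiv[OF u]]]
      by (intro C1c_mult[OF open_ball h])
    \<comment> \<open>This is the \<open>i\<close>-th component of the field rho^(2 - N) h grad u,
      differentiated in direction \<open>i\<close>: \<open>P i\<close> contains the derivative of
      \<open>h\<close>, and \<open>L i\<close> the derivatives of the weight and of grad u.\<close>
    from integral_C1c_derivative[OF open_ball C1c_rho[OF 1, of "2 - N"], of "axis i 1"]
    have "(\<integral>x. P i x + L i x \<partial>lborel) = 0"
    proof (rule trans[OF Bochner_Integration.integral_cong[OF refl], rotated])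
      fix x :: "real ^ 'n"
      show "P i x + L i x = (rho x powr (2 - N) *\<^sub>R (pderiv_at i u x *\<^sub>R h' x + h x *\<^sub>R grad (pderiv_at i u) x) +
         (pderiv_at i u x * h x) *\<^sub>R - ((2 - N) * rho x powr (2 - N - 1)) *\<^sub>R x) \<bullet> axis i 1"
        by (simp add: P_def L_def inner_axis grad_def algebra_simps)
    qed
    then show ?thesis using Pi Li by simp
  qed
  have sumL: "(\<Sum>i\<in>UNIV. L i x) = rho x powr (- N) * (hyp_laplace u x * h x)" for x
  proof (cases "x \<in> ball 0 1")
    case True
    have "rho x powr (1 - N) = rho x * rho x powr (- N)" using rho_mult_powr[OF True, of "- N"] by simp
    moreover have "rho x powr (2 - N) = rho x * rho x powr (1 - N)" using rho_mult_powr[OF True, of "1 - N"] by simp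
    ultimately have "L i x = (rho x * rho x * rho x powr (- N) * h x) * pderiv_at i (pderiv_at i u) x
        + ((N - 2) * rho x * rho x powr (- N) * h x) * (x $ i * pderiv_at i u x)" for i
      by (simp add: L_def mult_ac)
    then show ?thesis
      unfolding hyp_laplace_rho N_def[symmetric]
      by (simp only: sum.distrib sum_distrib_left[symmetric]) (simp only: distrib_left distrib_right mult_ac)
  qed (simp add: L_def C1c_outside[OF h])
  have sumP: "(\<Sum>i\<in>UNIV. P i x) = rho x powr (2 - N) * (grad u x \<bullet> h' x)" for x
    by (simp add: P_def grad_def inner_vec_def sum_distrib_left)
  have "(\<Sum>i\<in>UNIV. (\<integral>x. P i x \<partial>lborel)) + (\<Sum>i\<in>UNIV. (\<integral>x. L i x \<partial>lborel)) = 0"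
    unfolding sum.distrib[symmetric] using PL by simp
  then have main: "(\<integral>x. rho x powr (2 - N) * (grad u x \<bullet> h' x) \<partial>lborel)
      + (\<integral>x. rho x powr (- N) * (hyp_laplace u x * h x) \<partial>lborel) = 0"
    unfolding sumP[symmetric] sumL[symmetric] using Pi Li by (simp add: Bochner_Integration.integral_sum)
  have iL: "integrable lborel (\<lambda>x. rho x powr (- N) * (hyp_laplace u x * h x))"
    unfolding sumL[symmetric] using Li by (intro Bochner_Integration.integrable_sum) auto
  have iu: "integrable lborel (\<lambda>x. rho x powr (- N) * (u x * h x))"
    by (intro Cc_integrable[of "ball 0 1"] Cc_rho Cc_mult hc uc)
  have "hyp_inner (hyp_A u) h = (\<integral>x. - (rho x powr (- N) * (hyp_laplace u x * h x))
      - (N - 1)\<^sup>2 / 4 * (rho x powr (- N) * (u x * h x)) \<partial>lborel)"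
    unfolding hyp_inner_def hyp_A_def N_def by (simp add: algebra_simps)
  also have "\<dots> = - (\<integral>x. rho x powr (- N) * (hyp_laplace u x * h x) \<partial>lborel) - (N - 1)\<^sup>2 / 4 * hyp_inner u h"
    unfolding hyp_inner_def N_def[symmetric] using iL iu by simp
  finally show ?thesis using main by (simp add: N_def)
qed

lemma hyp_A_symmetric:
  assumes "test_fun u" "test_fun v"
  shows "hyp_inner (hyp_A u) v = hyp_inner u (hyp_A v)"
proof -
  have comm: "hyp_inner f g = hyp_inner g f" for f g :: "real ^ 'a \<Rightarrow> real" by (simp add: hyp_inner_def mult.commute)
  show ?thesis
    unfolding comm[of u "hyp_A v"] hyp_green[OF assms(1) test_fun_C1c[OF assms(2)]]
      hyp_green[OF assms(2) test_fun_C1c[OF assms(1)]]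
    by (simp add: inner_commute comm[of v u])
qed

lemma hyp_inner_hyp_A_energy:
  assumes "test_fun u"
  shows "hyp_inner (hyp_A u) u = hyp_energy u (grad u)"
  unfolding hyp_green[OF assms test_fun_C1c[OF assms]]
  by (simp add: hyp_energy_def hyp_inner_def power2_norm_eq_inner) (simp add: power2_eq_square)

lemma test_fun_hyp_A_pow: "test_fun u \<Longrightarrow> test_fun ((hyp_A ^^ j) u)"
  by (induction j) (auto intro: test_fun_hyp_A)

lemma hyp_A_pow_symmetric:
  assumes "test_fun u" "test_fun v"
  shows "hyp_inner ((hyp_A ^^ (a + b)) u) v = hyp_inner ((hyp_A ^^ a) u) ((hyp_A ^^ b) v)"
  using assms(2)
proof (induction b arbitrary: v)
  case (Suc b)
  have "hyp_inner ((hyp_A ^^ (a + Suc b)) u) v = hyp_inner ((hyp_A ^^ (a + b)) u) (hyp_A v)"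
    using Suc.prems assms(1) by (simp add: hyp_A_symmetric test_fun_hyp_A_pow)
  also have "\<dots> = hyp_inner ((hyp_A ^^ a) u) ((hyp_A ^^ b) (hyp_A v))"
    using Suc.prems by (intro Suc.IH test_fun_hyp_A)
  finally show ?case by (simp add: funpow_swap1)
qed simp

lemma hyp_inner_self_nonneg: "hyp_inner u u \<ge> 0"
  unfolding hyp_inner_def by (intro integral_nonneg_AE AE_I2) simp

text \<open>By symmetry, j = 2 i gives the squared norm of A^i u and j = 2 i + 1 the energy of A^i
  u, which is nonnegative by the ground state representation.\<close>

lemma hyp_A_pow_nonneg:
  assumes "test_fun u" shows "hyp_inner ((hyp_A ^^ j) u) u \<ge> 0"
proof (cases "even j")
  case True
  then obtain i where j: "j = i + i" by (metis evenE mult_2)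
  show ?thesis unfolding j hyp_A_pow_symmetric[OF assms assms] by (rule hyp_inner_self_nonneg)
next
  case False
  then obtain i where j: "j = Suc i + i" by (metis oddE mult_2 add_Suc add.commute plus_1_eq_Suc)
  have t: "test_fun ((hyp_A ^^ i) u)" using assms by (rule test_fun_hyp_A_pow)
  have "hyp_inner ((hyp_A ^^ j) u) u = hyp_energy ((hyp_A ^^ i) u) (grad ((hyp_A ^^ i) u))"
    unfolding j hyp_A_pow_symmetric[OF assms assms] by (simp add: hyp_inner_hyp_A_energy t)
  then show ?thesis using hyp_energy_nonneg[OF test_fun_C1c[OF t]] by simp
qed

section \<open>Q_k as a polynomial in A\<close>

lemma hyp_inner_linear:
  assumes "test_fun f" "test_fun g" "test_fun h"
  shows "hyp_inner (\<lambda>x. f x + d * g x) h = hyp_inner f h + d * hyp_inner g h"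
proof -
  have "integrable lborel (\<lambda>x. rho x powr (- real CARD('a)) * (f x * h x))" if "test_fun f" for f
    using that assms(3) by (intro Cc_integrable[of "ball 0 1"] Cc_rho Cc_mult) (auto simp: test_fun_def smoothD(3))
  from this[OF assms(1)] this[OF assms(2)] show ?thesis
    by (simp add: hyp_inner_def algebra_simps)
qed

text \<open>At k = 1, below the intended range, the list of factors is empty; this provides the base
  for inductions on \<open>k\<close>.\<close>

lemma hyp_Q_1: "hyp_Q 1 u = hyp_A u"
  by (simp add: hyp_Q_def hyp_A_def[abs_def])

text \<open>\<open>P\<^sub>1 + (k + 1) k = A + (k + 1/2)\<^sup>2\<close>\<close>

lemma hyp_Q_Suc:
  assumes "1 \<le> k"
  shows "hyp_Q (Suc k) u = hyp_Q k (\<lambda>x. hyp_A u x + (real k + 1 / 2)\<^sup>2 * u x)"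
proof -
  have "(\<lambda>x. hyp_P1 u x + real (Suc k) * (real (Suc k) - 1) * u x)
     = (\<lambda>x. hyp_A u x + (real k + 1 / 2)\<^sup>2 * u x)"
    by (simp add: fun_eq_iff hyp_P1_def hyp_A_def power2_eq_square field_simps)
  \<comment> \<open>\<open>foldr\<close> applies the last list element first, so the new factor acts
    directly on \<open>u\<close>.\<close>
  moreover have "[2..<Suc (Suc k)] = [2..<Suc k] @ [Suc k]" using assms by simp
  ultimately show ?thesis unfolding hyp_Q_def by (simp del: upt_Suc)
qed

lemma test_fun_shift: "test_fun u \<Longrightarrow> test_fun v \<Longrightarrow> test_fun (\<lambda>x. u x + d * v x)"
  by (intro test_fun_add test_fun_mult smooth_intros)

lemma hyp_Q_test_linear:
  assumes "1 \<le> k" "test_fun f" "test_fun g"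
  shows "test_fun (hyp_Q k f) \<and> hyp_Q k (\<lambda>x. f x + d * g x) = (\<lambda>x. hyp_Q k f x + d * hyp_Q k g x)"
  using assms
proof (induction k arbitrary: f g rule: nat_induct_at_least)
  case base
  then show ?case using hyp_A_linear[of f g d] test_fun_hyp_A[of f] by (simp add: hyp_Q_1[simplified] test_fun_def)
next
  case (Suc k)
  define e where "e = (real k + 1 / 2)\<^sup>2"
  have sm: "smooth f" "smooth g" using Suc.prems by (auto simp: test_fun_def)
  have t: "test_fun (\<lambda>x. hyp_A f x + e * f x)" "test_fun (\<lambda>x. hyp_A g x + e * g x)"
    using Suc.prems by (auto intro: test_fun_shift test_fun_hyp_A)
  have "hyp_Q (Suc k) (\<lambda>x. f x + d * g x) = hyp_Q k (\<lambda>x. (hyp_A f x + e * f x) + d * (hyp_A g x + e * g x))"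
    unfolding hyp_Q_Suc[OF Suc.hyps(1)] hyp_A_linear[OF sm] e_def by (simp add: algebra_simps)
  then show ?case using Suc.IH[OF t] unfolding hyp_Q_Suc[OF Suc.hyps(1)] e_def by simp
qed

text \<open>Q_(k+1) A^l u = Q_k A^(l+1) u + e Q_k A^l u, where e \<ge> 1 and both terms are
  nonnegative against \<open>u\<close>. The first term supplies j = k + 1, the second all smaller j.
  The shift \<open>l\<close> is part of the claim because the first term raises it.\<close>

lemma hyp_Q_lower_bound:
  assumes "1 \<le> k" "test_fun u" "1 \<le> j" "j \<le> k"
  shows "hyp_inner ((hyp_A ^^ (j + l)) u) u \<le> hyp_inner (hyp_Q k ((hyp_A ^^ l) u)) u"
  using assms(1,3,4)
proof (induction k arbitrary: j l rule: nat_induct_at_least)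
  case base
  then have "j = 1" by simp
  then show ?case by (simp add: hyp_Q_1[simplified])
next
  case (Suc k)
  define e where "e = (real k + 1 / 2)\<^sup>2"
  define X where "X l = hyp_inner (hyp_Q k ((hyp_A ^^ l) u)) u" for l
  have e: "e \<ge> 1" using Suc.hyps power_mono[of 1 "real k + 1 / 2" 2] by (simp add: e_def)
  have t: "test_fun ((hyp_A ^^ l) u)" for l using assms(2) by (rule test_fun_hyp_A_pow)
  have "hyp_Q (Suc k) ((hyp_A ^^ l) u) = hyp_Q k (\<lambda>x. (hyp_A ^^ Suc l) u x + e * (hyp_A ^^ l) u x)"
    unfolding hyp_Q_Suc[OF Suc.hyps(1)] e_def by simp
  also have "\<dots> = (\<lambda>x. hyp_Q k ((hyp_A ^^ Suc l) u) x + e * hyp_Q k ((hyp_A ^^ l) u) x)"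
    using hyp_Q_test_linear[OF Suc.hyps(1) t t] by blast
  finally have Q: "hyp_Q (Suc k) ((hyp_A ^^ l) u) = \<dots>" .
  have tQ: "test_fun (hyp_Q k ((hyp_A ^^ l) u))" for l
    using hyp_Q_test_linear[OF Suc.hyps(1) t t] by blast
  have eq: "hyp_inner (hyp_Q (Suc k) ((hyp_A ^^ l) u)) u = X (Suc l) + e * X l"
    unfolding X_def Q by (rule hyp_inner_linear[OF tQ tQ assms(2)])
  have lb: "hyp_inner ((hyp_A ^^ (j + l)) u) u \<le> X l" if "1 \<le> j" "j \<le> k" for j l
    unfolding X_def using Suc.IH that by blast
  have X0: "X l \<ge> 0" for l
    using lb[of 1 l] Suc.hyps hyp_A_pow_nonneg[OF assms(2), of "1 + l"] by linarith
  show ?case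
  proof (cases "j = Suc k")
    case True
    then have "hyp_inner ((hyp_A ^^ (j + l)) u) u \<le> X (Suc l)" using lb[of k "Suc l"] Suc.hyps by simp
    also have "\<dots> \<le> X (Suc l) + e * X l" using e X0 by simp
    finally show ?thesis unfolding eq .
  next
    case False
    then have "hyp_inner ((hyp_A ^^ (j + l)) u) u \<le> 1 * X l" using lb[of j l] Suc.prems by simp
    also have "\<dots> \<le> e * X l" using e X0 by (intro mult_right_mono) auto
    also have "\<dots> \<le> X (Suc l) + e * X l" using X0 by simp
    finally show ?thesis unfolding eq .
  qed
qed

section \<open>Higher order inequalities\<close>

lemma DERIV_sgn_abs_powr:
  fixes s :: real
  assumes s: "s > 1"
  shows "((\<lambda>t. sgn t * \<bar>t\<bar> powr s) has_real_derivative s * \<bar>t\<bar> powr (s - 1)) (at t)"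
proof (cases "t = 0")
  case True
  have "((\<lambda>h::real. \<bar>h\<bar> powr (s - 1)) \<longlongrightarrow> 0) (at 0)"
    using isCont_abs_powr[of "s - 1" 0] s by (simp add: isCont_def)
  then have "((\<lambda>h::real. (sgn h * \<bar>h\<bar> powr s) / h) \<longlongrightarrow> 0) (at 0)"
    by (rule Lim_null_comparison[rotated])
       (auto simp: eventually_at_filter abs_divide abs_mult abs_sgn_eq powr_diff)
  then show ?thesis using True by (simp add: DERIV_def)
next
  case False
  have "((\<lambda>u. sgn t * \<bar>u\<bar> powr s) has_real_derivative sgn t * (s * (sgn t * \<bar>t\<bar> powr (s - 1)))) (at t)"
    by (intro DERIV_cmult DERIV_abs_powr s)
  moreover have "sgn t * (s * (sgn t * \<bar>t\<bar> powr (s - 1))) = s * \<bar>t\<bar> powr (s - 1)"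
    using False by (simp add: sgn_if)
  ultimately have "((\<lambda>u. sgn t * \<bar>u\<bar> powr s) has_real_derivative s * \<bar>t\<bar> powr (s - 1)) (at t)" by simp
  moreover have "open {u. 0 < t * u}" by (intro open_Collect_less continuous_intros)
  ultimately show ?thesis
    by (rule has_field_derivative_transform_within_open) (use False in \<open>auto simp: sgn_if zero_less_mult_iff\<close>)
qed

lemma C1c_sgn_abs_powr:
  assumes "C1c S f f'" "s > 1"
  shows "C1c S (\<lambda>x. sgn (f x) * \<bar>f x\<bar> powr s) (\<lambda>x. (s * \<bar>f x\<bar> powr (s - 1)) *\<^sub>R f' x)"
proof (rule C1c_compose[OF assms(1) DERIV_sgn_abs_powr[OF assms(2)]])
  have "continuous_on UNIV (\<lambda>t::real. \<bar>t\<bar> powr (s - 1))"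
    using assms(2) isCont_abs_powr[of "s - 1"] by (intro continuous_at_imp_continuous_on) auto
  then show "continuous_on UNIV (\<lambda>t. s * \<bar>t\<bar> powr (s - 1))" by (rule continuous_on_mult_left)
qed simp

text \<open>\<open>T\<close> is the point where t^m and e t^r agree. Beyond it the first term
  suffices; below it t^(m - l) \<le> T^(m - l), and the second one does.\<close>

lemma powr_sandwich:
  fixes e l m r :: real
  assumes "e > 0" "l \<le> m" "m < r"
  shows "\<exists>K\<ge>0. \<forall>t\<ge>0. t powr m \<le> e * t powr r + K * t powr l"
proof -
  define T where "T = e powr (- 1 / (r - m))"
  have T: "T > 0" using assms by (simp add: T_def)
  have "- 1 / (r - m) * (m - r) = 1" using assms by (simp add: field_simps)
  then have Te: "T powr (m - r) = e" using assms(1) unfolding T_def powr_powr by simp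
  show ?thesis
  proof (intro exI[of _ "T powr (m - l)"] conjI allI impI)
    fix t :: real assume t0: "t \<ge> 0"
    consider "t = 0" | "t > 0" "t \<ge> T" | "t > 0" "t < T" using t0 by linarith
    then show "t powr m \<le> e * t powr r + T powr (m - l) * t powr l"
    proof cases
      case 2
      have "t powr m = t powr (m - r) * t powr r" by (simp add: powr_add[symmetric])
      also have "\<dots> \<le> T powr (m - r) * t powr r"
        using 2 T assms by (intro mult_right_mono powr_mono2') auto
      finally show ?thesis unfolding Te by (simp add: add_increasing2)
    next
      case 3
      have "t powr m = t powr (m - l) * t powr l" by (simp add: powr_add[symmetric])
      also have "\<dots> \<le> T powr (m - l) * t powr l"
        using 3 assms by (intro mult_right_mono powr_mono2) auto
      finally show ?thesis using assms by (simp add: add_increasing)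
    qed simp
  qed simp
qed

text \<open>The p-th power of the L^p(dV) norm, without the root. Bounds on the norm are therefore
  written with a number F, in the form \<open>hyp_Lp p u \<le> F powr p\<close>.\<close>

definition hyp_Lp :: "real \<Rightarrow> (real ^ 'n::finite \<Rightarrow> real) \<Rightarrow> real"
  where "hyp_Lp p u = (\<integral>x. rho x powr (- real CARD('n)) * \<bar>u x\<bar> powr p \<partial>lborel)"

lemma hyp_Lp_nonneg: "hyp_Lp p u \<ge> 0"
  unfolding hyp_Lp_def by (intro integral_nonneg_AE AE_I2) simp

lemma hyp_Lp_integrable:
  assumes "Cc (ball 0 1) u" "p > 0"
  shows "integrable lborel (\<lambda>x. rho x powr (- real CARD('n)) * \<bar>(u :: real ^ 'n::finite \<Rightarrow> real) x\<bar> powr p)"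
  using assms by (intro Cc_integrable[of "ball 0 1"] Cc_rho Cc_abs_powr)

text \<open>After normalisation, pointwise inequalities between powers with different exponents can
  be integrated.\<close>

lemma hyp_Lp_scale:
  assumes "F > 0"
  shows "(\<integral>x. rho x powr (- real CARD('n)) * (\<bar>(u :: real ^ 'n::finite \<Rightarrow> real) x\<bar> / F) powr p \<partial>lborel) = hyp_Lp p u / F powr p"
proof -
  have "(\<integral>x. rho x powr (- real CARD('n)) * (\<bar>u x\<bar> / F) powr p \<partial>lborel)
     = (\<integral>x. (rho x powr (- real CARD('n)) * \<bar>u x\<bar> powr p) / F powr p \<partial>lborel)"
    using assms by (simp add: powr_divide)
  then show ?thesis by (simp add: hyp_Lp_def)
qed

lemma hyp_Lp_integrable_scale:
  assumes "Cc (ball 0 1) u" "p > 0" "F > 0"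
  shows "integrable lborel (\<lambda>x. rho x powr (- real CARD('n)) * (\<bar>(u :: real ^ 'n::finite \<Rightarrow> real) x\<bar> / F) powr p)"
  using integrable_divide[OF hyp_Lp_integrable[OF assms(1,2)], of "F powr p"] assms(3)
  by (simp add: powr_divide)

lemma hyp_poincare_sobolev:
  assumes "CARD('n::finite) \<ge> 3" "2 < p" "p \<le> 2 * real CARD('n) / (real CARD('n) - 2)"
  shows "\<exists>C>0. \<forall>(w :: real ^ 'n \<Rightarrow> real) w'. C1c (ball 0 1) w w' \<longrightarrow> hyp_Lp p w powr (2 / p) \<le> C * hyp_energy w w'"
  using poincare_sobolev[where 'a="real ^ 'n", of p] assms unfolding hyp_Lp_def by simp

text \<open>\<open>hyp_green\<close> is tested with h = sgn u * |u|^(2 s - 1). Then grad u . grad h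
  is (2 s - 1) |u|^(2 s - 2) |grad u|^2, whereas the squared gradient of |u|^s carries the factor
  s^2; hence the quotient s^2 / (2 s - 1). The zero-order terms do not cancel, and the negative one
  is dropped.\<close>

lemma hyp_energy_abs_powr:
  fixes u :: "real ^ 'n::finite \<Rightarrow> real"
  assumes u: "test_fun u" and s: "s > 1"
  shows "hyp_energy (\<lambda>x. \<bar>u x\<bar> powr s) (\<lambda>x. (s * (sgn (u x) * \<bar>u x\<bar> powr (s - 1))) *\<^sub>R grad u x)
    \<le> s\<^sup>2 / (2 * s - 1) * (hyp_inner (hyp_A u) (\<lambda>x. sgn (u x) * \<bar>u x\<bar> powr (2 * s - 1))
        + (real CARD('n) - 1)\<^sup>2 / 4 * hyp_Lp (2 * s) u)"
proof -
  define N where "N = real CARD('n)"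
  define c where "c = (N - 1)\<^sup>2 / 4"
  define h where "h x = sgn (u x) * \<bar>u x\<bar> powr (2 * s - 1)" for x
  have h: "C1c (ball 0 1) h (\<lambda>x. ((2 * s - 1) * \<bar>u x\<bar> powr (2 * s - 1 - 1)) *\<^sub>R grad u x)"
    unfolding h_def[abs_def] using s by (intro C1c_sgn_abs_powr test_fun_C1c[OF u]) auto
  have uh: "u x * h x = \<bar>u x\<bar> powr (2 * s)" for x
  proof (cases "u x = 0")
    case False
    have "\<bar>u x\<bar> powr (2 * s) = \<bar>u x\<bar> powr (1 + (2 * s - 1))" by simp
    also have "\<dots> = \<bar>u x\<bar> * \<bar>u x\<bar> powr (2 * s - 1)" unfolding powr_add using False by simp
    finally show ?thesis by (simp add: h_def abs_sgn)
  qed (simp add: h_def)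
  have w: "(\<bar>u x\<bar> powr s)\<^sup>2 = \<bar>u x\<bar> powr (2 * s)" for x
    by (cases "u x = 0") (auto simp: powr_power)
  have w': "(norm ((s * (sgn (u x) * \<bar>u x\<bar> powr (s - 1))) *\<^sub>R grad u x))\<^sup>2
      = s\<^sup>2 / (2 * s - 1) * (grad u x \<bullet> (((2 * s - 1) * \<bar>u x\<bar> powr (2 * s - 1 - 1)) *\<^sub>R grad u x))" for x
  proof (cases "u x = 0")
    case False
    then have "(\<bar>u x\<bar> powr (s - 1))\<^sup>2 = \<bar>u x\<bar> powr (2 * s - 1 - 1)"
      by (simp add: powr_power algebra_simps)
    then have "(norm ((s * (sgn (u x) * \<bar>u x\<bar> powr (s - 1))) *\<^sub>R grad u x))\<^sup>2
      = s\<^sup>2 * \<bar>u x\<bar> powr (2 * s - 1 - 1) * (norm (grad u x))\<^sup>2"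
      using False by (simp add: power_mult_distrib abs_mult abs_sgn_eq)
    then show ?thesis using s by (simp add: power2_norm_eq_inner)
  qed simp
  have uh': "hyp_inner u h = hyp_Lp (2 * s) u" by (simp add: hyp_inner_def hyp_Lp_def uh)
  have "(\<integral>x. rho x powr (2 - N) * (norm ((s * (sgn (u x) * \<bar>u x\<bar> powr (s - 1))) *\<^sub>R grad u x))\<^sup>2 \<partial>lborel)
     = s\<^sup>2 / (2 * s - 1) * (hyp_inner (hyp_A u) h + c * hyp_inner u h)"
    (is "?I = _")
  proof -
    have "?I = (\<integral>x. s\<^sup>2 / (2 * s - 1) *
        (rho x powr (2 - N) * (grad u x \<bullet> (((2 * s - 1) * \<bar>u x\<bar> powr (2 * s - 1 - 1)) *\<^sub>R grad u x))) \<partial>lborel)"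
      unfolding w' by (simp only: mult.left_commute)
    also have "\<dots> = s\<^sup>2 / (2 * s - 1) *
        (\<integral>x. rho x powr (2 - N) * (grad u x \<bullet> (((2 * s - 1) * \<bar>u x\<bar> powr (2 * s - 1 - 1)) *\<^sub>R grad u x)) \<partial>lborel)"
      by (rule integral_mult_right_zero)
    finally show ?thesis unfolding hyp_green[OF u h] by (simp add: c_def N_def)
  qed
  then have "hyp_energy (\<lambda>x. \<bar>u x\<bar> powr s) (\<lambda>x. (s * (sgn (u x) * \<bar>u x\<bar> powr (s - 1))) *\<^sub>R grad u x)
     = s\<^sup>2 / (2 * s - 1) * (hyp_inner (hyp_A u) h + c * hyp_Lp (2 * s) u) - c * hyp_Lp (2 * s) u"
    unfolding hyp_energy_def w uh' by (simp add: c_def N_def hyp_Lp_def)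
  moreover have "c * hyp_Lp (2 * s) u \<ge> 0" unfolding c_def by (intro mult_nonneg_nonneg hyp_Lp_nonneg) auto
  ultimately show ?thesis unfolding c_def N_def h_def[abs_def] by linarith
qed

text \<open>Poincare-Sobolev with exponent \<open>p1\<close> is applied to |u|^s. Since s p1 = r,
  its left side is X^(2 s), where X is the L^r norm of u, and 2 s - 1 = r (1 - 1 / q) is the Hoelder
  condition that pairs A u in L^q with |u|^(2 s - 1). The exponent 2 s of the zero-order term lies
  between \<open>p1\<close> and \<open>r\<close>, so that term splits into a part to be absorbed and
  a part controlled by the L^p1 norm.\<close>

lemma elliptic_step:
  fixes q :: real
  assumes n: "CARD('n::finite) \<ge> 3" and q: "2 \<le> q" "2 * q < real CARD('n)"
  defines "r \<equiv> real CARD('n) * q / (real CARD('n) - 2 * q)"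
    and "p1 \<equiv> 2 * real CARD('n) / (real CARD('n) - 2)"
  shows "\<exists>C>0. \<forall>(u :: real ^ 'n \<Rightarrow> real) F. test_fun u \<longrightarrow> F > 0 \<longrightarrow>
     hyp_Lp q (hyp_A u) \<le> F powr q \<longrightarrow> hyp_Lp p1 u \<le> F powr p1 \<longrightarrow> hyp_Lp r u \<le> C * F powr r"
proof -
  define N where "N = real CARD('n)"
  have N: "N \<ge> 3" "2 * q < N" using n q by (auto simp: N_def)
  define s where "s = r * (N - 2) / (2 * N)"
  have r: "r = N * q / (N - 2 * q)" and p1: "p1 = 2 * N / (N - 2)" by (simp_all add: r_def p1_def N_def)
  have s_eq: "2 * s = q * (N - 2) / (N - 2 * q)" using N by (simp add: s_def r field_simps)
  have p1_le: "p1 \<le> 2 * s"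
  proof -
    have "2 * N * (N - 2 * q) \<le> q * (N - 2) * (N - 2)"
    proof -
      have "q * (N - 2) * (N - 2) - 2 * N * (N - 2 * q) = (q - 2) * N\<^sup>2 + 4 * q"
        by (simp add: power2_eq_square algebra_simps)
      also have "\<dots> \<ge> 0" using q N by (intro add_nonneg_nonneg mult_nonneg_nonneg) auto
      finally show ?thesis by simp
    qed
    then show ?thesis unfolding p1 s_eq using N by (simp add: field_simps)
  qed
  have p1_gt: "p1 > 2" using N by (simp add: p1 field_simps)
  have s: "s > 1" using p1_le p1_gt by simp
  have s_lt: "2 * s < r" unfolding s_eq r using N q by (intro divide_strict_right_mono) (auto simp: field_simps)
  have sp: "s * p1 = r" "r * (2 / p1) = 2 * s" using N p1_gt by (auto simp: s_def p1 field_simps)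
  have young_exp: "2 * s - 1 = r * (1 - 1 / q)"
    unfolding s_eq r using N q by (simp add: field_simps)
  have r0: "r > 0" using s s_lt by simp
  obtain C0 where C0: "C0 > 0" and PS: "\<And>(w :: real ^ 'n \<Rightarrow> real) w'. C1c (ball 0 1) w w' \<Longrightarrow> hyp_Lp p1 w powr (2 / p1) \<le> C0 * hyp_energy w w'"
    using hyp_poincare_sobolev[OF n p1_gt] unfolding p1_def by auto
  define c where "c = (N - 1)\<^sup>2 / 4"
  have c: "c > 0" using N by (simp add: c_def)
  define k where "k = C0 * (s\<^sup>2 / (2 * s - 1))"
  have k: "k > 0" using C0 s by (simp add: k_def)
  \<comment> \<open>With this coefficient the \<open>r\<close>-part of the zero-order term
    contributes k * c / (2 * k * c) = 1 / 2 once X^(2 s) has been divided out.\<close>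
  obtain K where K: "K \<ge> 0" and sandwich: "\<And>t. t \<ge> 0 \<Longrightarrow> t powr (2 * s) \<le> 1 / (2 * k * c) * t powr r + K * t powr p1"
    using powr_sandwich[of "1 / (2 * k * c)" p1 "2 * s" r] p1_le s_lt k c by auto
  \<comment> \<open>A lower bound for y = F / X, read off from the inequality \<open>y_ge\<close>
    below: for y \<le> 1 one has y^p1 \<le> y, and the inequality becomes linear; larger y exceed d
    because of the minimum with 1.\<close>
  define d where "d = min 1 (1 / (2 * k * (2 + c * K)))"
  have d: "d > 0" using k c K by (auto simp: d_def intro!: divide_pos_pos mult_pos_pos add_pos_nonneg)
  show ?thesis
  proof (intro exI[of _ "(1 / d) powr r"] conjI allI impI)
    show "(1 / d) powr r > 0" using d by simp
    fix u :: "real ^ 'n \<Rightarrow> real" and F :: real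
    assume u: "test_fun u" and F: "F > 0" and HA: "hyp_Lp q (hyp_A u) \<le> F powr q" and Hp: "hyp_Lp p1 u \<le> F powr p1"
    show "hyp_Lp r u \<le> (1 / d) powr r * F powr r"
    proof (cases "hyp_Lp r u = 0")
      case False
      then have Lpos: "hyp_Lp r u > 0" using hyp_Lp_nonneg[of r u] by simp
      define X where "X = hyp_Lp r u powr (1 / r)"
      have X: "X > 0" using Lpos by (simp add: X_def)
      have Xr: "X powr r = hyp_Lp r u" using Lpos r0 by (simp add: X_def powr_powr)
      have cu: "Cc (ball 0 1) u" and cA: "Cc (ball 0 1) (hyp_A u)"
        using u test_fun_hyp_A[OF u] by (auto simp: test_fun_def)
      have uc: "continuous_on (ball 0 1) u" "continuous_on (ball 0 1) (hyp_A u)"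
        using cu cA by (auto dest: Cc_continuous_on)
      define h where "h x = sgn (u x) * \<bar>u x\<bar> powr (2 * s - 1)" for x
      have ch: "Cc (ball 0 1) h"
        unfolding h_def[abs_def] using s by (intro C1cD(2)[OF C1c_sgn_abs_powr[OF test_fun_C1c[OF u]]]) auto
      have "hyp_Lp p1 (\<lambda>x. \<bar>u x\<bar> powr s) = hyp_Lp r u"
        by (simp add: hyp_Lp_def powr_powr sp)
      then have "X powr (2 * s) = hyp_Lp p1 (\<lambda>x. \<bar>u x\<bar> powr s) powr (2 / p1)"
        unfolding sp(2)[symmetric] by (simp add: Xr[symmetric] powr_powr)
      also have "\<dots> \<le> C0 * hyp_energy (\<lambda>x. \<bar>u x\<bar> powr s) (\<lambda>x. (s * (sgn (u x) * \<bar>u x\<bar> powr (s - 1))) *\<^sub>R grad u x)"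
        by (intro PS C1c_abs_powr test_fun_C1c u s)
      also have "\<dots> \<le> k * (hyp_inner (hyp_A u) h + c * hyp_Lp (2 * s) u)"
        unfolding k_def mult.assoc c_def N_def h_def
        using C0 by (intro mult_left_mono hyp_energy_abs_powr u s) auto
      finally have main: "X powr (2 * s) \<le> k * (hyp_inner (hyp_A u) h + c * hyp_Lp (2 * s) u)" .
      \<comment> \<open>Hoelder's inequality in the form of a pointwise bound for the functions
        normalised by \<open>F\<close> and \<open>X\<close>, at the cost of a factor 2.\<close>
      have "hyp_inner (hyp_A u) h \<le> (\<integral>x. F * X powr (2 * s - 1) *
          (rho x powr (- N) * (\<bar>hyp_A u x\<bar> / F) powr q + rho x powr (- N) * (\<bar>u x\<bar> / X) powr r) \<partial>lborel)"
        unfolding hyp_inner_def N_def[symmetric]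
      proof (intro integral_mono)
        show "integrable lborel (\<lambda>x. rho x powr (- N) * (hyp_A u x * h x))"
          by (intro Cc_integrable[of "ball 0 1"] Cc_rho Cc_mult(2)[OF ch] uc)
        show "integrable lborel (\<lambda>x. F * X powr (2 * s - 1) *
          (rho x powr (- N) * (\<bar>hyp_A u x\<bar> / F) powr q + rho x powr (- N) * (\<bar>u x\<bar> / X) powr r))"
          unfolding N_def using q r0
          by (intro integrable_mult_right Bochner_Integration.integrable_add hyp_Lp_integrable_scale cA cu F X) auto
        fix x
        have "hyp_A u x * h x \<le> \<bar>hyp_A u x * h x\<bar>" by simp
        also have "\<dots> = \<bar>hyp_A u x\<bar> * \<bar>u x\<bar> powr (2 * s - 1)"
          by (simp add: h_def abs_mult abs_sgn_eq)
        also have "\<dots> = F * X powr (2 * s - 1) * ((\<bar>hyp_A u x\<bar> / F) * (\<bar>u x\<bar> / X) powr (2 * s - 1))"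
          using F X by (simp add: powr_divide)
        also have "(\<bar>hyp_A u x\<bar> / F) * (\<bar>u x\<bar> / X) powr (2 * s - 1)
           = ((\<bar>hyp_A u x\<bar> / F) powr q) powr (1 - (1 - 1 / q)) * ((\<bar>u x\<bar> / X) powr r) powr (1 - 1 / q)"
          using F X q by (simp add: powr_powr young_exp)
        also have "\<dots> \<le> (\<bar>hyp_A u x\<bar> / F) powr q + (\<bar>u x\<bar> / X) powr r"
          using q by (intro powr_interpolation) auto
        finally have "hyp_A u x * h x \<le> F * X powr (2 * s - 1) * ((\<bar>hyp_A u x\<bar> / F) powr q + (\<bar>u x\<bar> / X) powr r)"
          using F X by (simp add: mult_left_mono)
        from mult_left_mono[OF this, of "rho x powr (- N)"]
        show "rho x powr (- N) * (hyp_A u x * h x) \<le> F * X powr (2 * s - 1) *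
          (rho x powr (- N) * (\<bar>hyp_A u x\<bar> / F) powr q + rho x powr (- N) * (\<bar>u x\<bar> / X) powr r)"
          by (simp add: algebra_simps)
      qed
      also have "\<dots> = F * X powr (2 * s - 1) * (hyp_Lp q (hyp_A u) / F powr q + hyp_Lp r u / X powr r)"
        unfolding N_def using q r0 hyp_Lp_integrable_scale[OF cA _ F, of q] hyp_Lp_integrable_scale[OF cu _ X, of r]
        by (simp add: hyp_Lp_scale F X)
      also have "\<dots> \<le> F * X powr (2 * s - 1) * (1 + 1)"
        using F X HA Lpos by (intro mult_left_mono add_mono) (auto simp: Xr divide_le_eq)
      finally have T1: "hyp_inner (hyp_A u) h \<le> 2 * F * X powr (2 * s - 1)" by simp
      have "hyp_Lp (2 * s) u / X powr (2 * s) = (\<integral>x. rho x powr (- N) * (\<bar>u x\<bar> / X) powr (2 * s) \<partial>lborel)"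
        unfolding N_def hyp_Lp_scale[OF X] ..
      also have "\<dots> \<le> (\<integral>x. 1 / (2 * k * c) * (rho x powr (- N) * (\<bar>u x\<bar> / X) powr r)
           + K * (rho x powr (- N) * (\<bar>u x\<bar> / X) powr p1) \<partial>lborel)"
      proof (intro integral_mono)
        show "integrable lborel (\<lambda>x. rho x powr (- N) * (\<bar>u x\<bar> / X) powr (2 * s))"
          unfolding N_def using s by (intro hyp_Lp_integrable_scale cu X) auto
        show "integrable lborel (\<lambda>x. 1 / (2 * k * c) * (rho x powr (- N) * (\<bar>u x\<bar> / X) powr r)
           + K * (rho x powr (- N) * (\<bar>u x\<bar> / X) powr p1))"
          unfolding N_def using r0 p1_gt
          by (intro Bochner_Integration.integrable_add integrable_mult_right hyp_Lp_integrable_scale cu X) auto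
        fix x
        have "(\<bar>u x\<bar> / X) powr (2 * s) \<le> 1 / (2 * k * c) * (\<bar>u x\<bar> / X) powr r + K * (\<bar>u x\<bar> / X) powr p1"
          using X by (intro sandwich) auto
        from mult_left_mono[OF this, of "rho x powr (- N)"]
        show "rho x powr (- N) * (\<bar>u x\<bar> / X) powr (2 * s)
          \<le> 1 / (2 * k * c) * (rho x powr (- N) * (\<bar>u x\<bar> / X) powr r) + K * (rho x powr (- N) * (\<bar>u x\<bar> / X) powr p1)"
          by (simp add: algebra_simps)
      qed
      also have "\<dots> = 1 / (2 * k * c) * (hyp_Lp r u / X powr r) + K * (hyp_Lp p1 u / X powr p1)"
        unfolding N_def using r0 p1_gt hyp_Lp_integrable_scale[OF cu _ X, of r] hyp_Lp_integrable_scale[OF cu _ X, of p1]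
        by (simp add: hyp_Lp_scale[OF X] del: times_divide_eq_left times_divide_eq_right)
      also have "\<dots> \<le> 1 / (2 * k * c) * 1 + K * (F powr p1 / X powr p1)"
        using k c K Hp Lpos by (intro add_mono mult_left_mono divide_right_mono) (auto simp: Xr)
      also have "F powr p1 / X powr p1 = (F / X) powr p1" using F X by (simp add: powr_divide)
      finally have T2: "hyp_Lp (2 * s) u / X powr (2 * s) \<le> 1 / (2 * k * c) + K * (F / X) powr p1" by simp
      define y where "y = F / X"
      have y: "y > 0" using F X by (simp add: y_def)
      \<comment> \<open>Divided by X^(2 s), \<open>main\<close> becomes an inequality in
        \<open>y\<close> alone, which excludes small \<open>y\<close>.\<close>
      have "1 = X powr (2 * s) / X powr (2 * s)" using X by simp
      also have "\<dots> \<le> k * (hyp_inner (hyp_A u) h + c * hyp_Lp (2 * s) u) / X powr (2 * s)"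
        by (intro divide_right_mono main) simp
      also have "\<dots> = k * (hyp_inner (hyp_A u) h / X powr (2 * s) + c * (hyp_Lp (2 * s) u / X powr (2 * s)))"
        by (simp add: add_divide_distrib[symmetric])
      also have "\<dots> \<le> k * (2 * F * X powr (2 * s - 1) / X powr (2 * s) + c * (1 / (2 * k * c) + K * y powr p1))"
        unfolding y_def using k c X by (intro mult_left_mono add_mono divide_right_mono T1 T2) auto
      also have "2 * F * X powr (2 * s - 1) / X powr (2 * s) = 2 * y"
        using X by (simp add: y_def powr_diff)
      also have "k * (2 * y + c * (1 / (2 * k * c) + K * y powr p1)) = k * (2 * y + c * K * y powr p1) + 1 / 2"
        using k c by (simp add: field_simps)
      finally have y_ge: "1 / 2 \<le> k * (2 * y + c * K * y powr p1)" by simp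
      have "d \<le> y"
      proof (cases "y \<le> 1")
        case True
        have "y powr p1 \<le> y powr 1" using y True p1_gt by (intro powr_mono') auto
        then have "k * (2 * y + c * K * y powr p1) \<le> k * (2 * y + c * K * y)"
          using k c K y by (intro mult_left_mono add_left_mono) auto
        with y_ge have "1 / 2 \<le> k * (2 + c * K) * y" by (simp add: algebra_simps)
        moreover have "k * (2 + c * K) > 0" using k c K by (intro mult_pos_pos add_pos_nonneg) auto
        ultimately have "1 / (2 * k * (2 + c * K)) \<le> y" by (simp add: field_simps)
        then show ?thesis by (simp add: d_def)
      qed (simp add: d_def)
      then have "X \<le> 1 / d * F" using d X by (simp add: y_def field_simps)
      then have "X powr r \<le> (1 / d * F) powr r" using X r0 by (intro powr_mono2) auto
      also have "\<dots> = (1 / d) powr r * F powr r" by (rule powr_mult)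
      finally show ?thesis unfolding Xr .
    qed simp
  qed
qed

text \<open>The induction has step two since passing from u to A u moves the moments up by two.
  \<open>min 1 k\<close> keeps the zeroth moment, the squared L2 norm, out of the hypotheses unless
  k = 0. That case is used for A u, where the zeroth moment is the second moment of u.\<close>

lemma moments_control_Lp:
  assumes "CARD('n::finite) \<ge> 3" "2 * real k < real CARD('n)"
  defines "p \<equiv> 2 * real CARD('n) / (real CARD('n) - 2 * real k)"
  shows "\<exists>C>0. \<forall>(u :: real ^ 'n \<Rightarrow> real) F. test_fun u \<longrightarrow> F > 0 \<longrightarrow>
    (\<forall>j. min 1 k \<le> j \<and> j \<le> k \<longrightarrow> hyp_inner ((hyp_A ^^ j) u) u \<le> F\<^sup>2) \<longrightarrow> hyp_Lp p u \<le> C * F powr p"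
  using assms(2) unfolding p_def
proof (induction k rule: induct_nat_012)
  case 0
  show ?case
  proof (intro exI[of _ 1] conjI allI impI)
    fix u :: "real ^ 'n \<Rightarrow> real" and F :: real
    assume "F > 0" and H: "\<forall>j. min 1 0 \<le> j \<and> j \<le> 0 \<longrightarrow> hyp_inner ((hyp_A ^^ j) u) u \<le> F\<^sup>2"
    have "hyp_inner u u \<le> F\<^sup>2" using H[rule_format, of 0] by simp
    moreover have "hyp_Lp 2 u = hyp_inner u u"
      by (simp add: hyp_Lp_def hyp_inner_def power2_eq_square)
    ultimately show "hyp_Lp (2 * real CARD('n) / (real CARD('n) - 2 * real 0)) u
      \<le> 1 * F powr (2 * real CARD('n) / (real CARD('n) - 2 * real 0))"
      using \<open>F > 0\<close> by simp
  qed simp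
next
  case 1
  define p1 where "p1 = 2 * real CARD('n) / (real CARD('n) - 2)"
  have p1: "p1 > 2" using assms(1) by (simp add: p1_def field_simps)
  obtain C where C: "C > 0" and PS: "\<And>(w :: real ^ 'n \<Rightarrow> real) w'. C1c (ball 0 1) w w' \<Longrightarrow> hyp_Lp p1 w powr (2 / p1) \<le> C * hyp_energy w w'"
    using hyp_poincare_sobolev[OF assms(1) p1] unfolding p1_def by auto
  show ?case
  proof (intro exI[of _ "C powr (p1 / 2)"] conjI allI impI)
    fix u :: "real ^ 'n \<Rightarrow> real" and F :: real
    assume u: "test_fun u" and F: "F > 0"
      and H: "\<forall>j. min 1 (Suc 0) \<le> j \<and> j \<le> Suc 0 \<longrightarrow> hyp_inner ((hyp_A ^^ j) u) u \<le> F\<^sup>2"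
    have "hyp_inner (hyp_A u) u \<le> F\<^sup>2" using H[rule_format, of 1] by simp
    then have "hyp_Lp p1 u powr (2 / p1) \<le> C * F\<^sup>2"
      using PS[OF test_fun_C1c[OF u]] C unfolding hyp_inner_hyp_A_energy[OF u]
      by (meson less_imp_le mult_left_mono order_trans)
    then have "(hyp_Lp p1 u powr (2 / p1)) powr (p1 / 2) \<le> (C * F\<^sup>2) powr (p1 / 2)"
      using p1 by (intro powr_mono2) auto
    also have "(hyp_Lp p1 u powr (2 / p1)) powr (p1 / 2) = hyp_Lp p1 u"
      using p1 hyp_Lp_nonneg[of p1 u] by (simp add: powr_powr)
    also have "(C * F\<^sup>2) powr (p1 / 2) = C powr (p1 / 2) * (F powr 2) powr (p1 / 2)"
      using C F by (simp add: powr_mult)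
    also have "(F powr 2) powr (p1 / 2) = F powr p1" by (simp add: powr_powr)
    finally show "hyp_Lp (2 * real CARD('n) / (real CARD('n) - 2 * real (Suc 0))) u
      \<le> C powr (p1 / 2) * F powr (2 * real CARD('n) / (real CARD('n) - 2 * real (Suc 0)))"
      by (simp add: p1_def)
  qed (use C in simp)
next
  case (ge2 k)
  define N where "N = real CARD('n)"
  define q where "q = 2 * N / (N - 2 * real k)"
  define r where "r = 2 * N / (N - 2 * real (Suc (Suc k)))"
  define p1 where "p1 = 2 * N / (N - 2)"
  have N: "N \<ge> 3" "2 * real (Suc (Suc k)) < N" using assms(1) ge2.prems by (auto simp: N_def)
  have q: "q \<ge> 2" using N by (simp add: q_def field_simps)
  have "N * 4 < N * (N - 2 * real k)" using N by (intro mult_strict_left_mono) auto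
  then have q2: "2 * q < N" using N by (simp add: q_def divide_less_eq)
  \<comment> \<open>Equivalently 1 / r = 1 / q - 2 / N.\<close>
  have r: "r = N * q / (N - 2 * q)"
  proof -
    define D where "D = N - 2 * real k"
    have D: "D > 4" "r = 2 * N / (D - 4)" using N by (auto simp: D_def r_def)
    have "q = 2 * N / D" by (simp add: q_def D_def)
    then have "N - 2 * q = N * (D - 4) / D" "N * q = N * (2 * N) / D" using D by (auto simp: field_simps)
    moreover have "N * (2 * N) / D / (N * (D - 4) / D) = 2 * N / (D - 4)" using D(1) N(1) by simp
    ultimately show ?thesis unfolding D(2) by simp
  qed
  have p1: "p1 > 2" using N by (simp add: p1_def field_simps)
  obtain C1 where C1: "C1 > 0" and IH1: "\<And>(u :: real ^ 'n \<Rightarrow> real) F. test_fun u \<Longrightarrow> F > 0 \<Longrightarrow>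
    (\<And>j. min 1 k \<le> j \<and> j \<le> k \<Longrightarrow> hyp_inner ((hyp_A ^^ j) u) u \<le> F\<^sup>2) \<Longrightarrow> hyp_Lp q u \<le> C1 * F powr q"
    using ge2.IH(1) ge2.prems unfolding q_def N_def by auto
  obtain C2 where C2: "C2 > 0" and PS: "\<And>(w :: real ^ 'n \<Rightarrow> real) w'. C1c (ball 0 1) w w' \<Longrightarrow> hyp_Lp p1 w powr (2 / p1) \<le> C2 * hyp_energy w w'"
    using hyp_poincare_sobolev[OF assms(1) p1] unfolding p1_def N_def by auto
  obtain C3 where C3: "C3 > 0" and step: "\<And>(u :: real ^ 'n \<Rightarrow> real) F. test_fun u \<Longrightarrow> F > 0 \<Longrightarrow>
     hyp_Lp q (hyp_A u) \<le> F powr q \<Longrightarrow> hyp_Lp p1 u \<le> F powr p1 \<Longrightarrow> hyp_Lp r u \<le> C3 * F powr r"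
    using elliptic_step[OF assms(1) q] q2 unfolding r p1_def N_def by blast
  \<comment> \<open>Enlarging F to D * F makes both hypotheses of \<open>step\<close> hold with the
    same number.\<close>
  define D where "D = max (C1 powr (1 / q)) (C2 powr (1 / 2))"
  have D: "D > 0" using C1 by (auto simp: D_def less_max_iff_disj)
  show ?case
  proof (intro exI[of _ "C3 * D powr r"] conjI allI impI)
    fix u :: "real ^ 'n \<Rightarrow> real" and F :: real
    assume u: "test_fun u" and F: "F > 0"
      and H: "\<forall>j. min 1 (Suc (Suc k)) \<le> j \<and> j \<le> Suc (Suc k) \<longrightarrow> hyp_inner ((hyp_A ^^ j) u) u \<le> F\<^sup>2"
    have DF: "D * F > 0" using D F by simp
    have "hyp_Lp q (hyp_A u) \<le> C1 * F powr q"
    proof (rule IH1[OF test_fun_hyp_A[OF u] F])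
      fix j assume j: "min 1 k \<le> j \<and> j \<le> k"
      have "hyp_inner ((hyp_A ^^ j) (hyp_A u)) (hyp_A u) = hyp_inner ((hyp_A ^^ Suc j) u) ((hyp_A ^^ 1) u)"
        by (simp add: funpow_swap1)
      also have "\<dots> = hyp_inner ((hyp_A ^^ (Suc j + 1)) u) u"
        by (rule hyp_A_pow_symmetric[symmetric, OF u u])
      also have "\<dots> \<le> F\<^sup>2" using H[rule_format, of "Suc j + 1"] j by simp
      finally show "hyp_inner ((hyp_A ^^ j) (hyp_A u)) (hyp_A u) \<le> F\<^sup>2" .
    qed
    also have "\<dots> = (C1 powr (1 / q) * F) powr q" using C1 F q by (simp add: powr_mult powr_powr)
    also have "\<dots> \<le> (D * F) powr q"
      using F q C1 by (intro powr_mono2 mult_right_mono) (auto simp: D_def)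
    finally have 1: "hyp_Lp q (hyp_A u) \<le> (D * F) powr q" .
    have "hyp_Lp p1 u powr (2 / p1) \<le> C2 * hyp_inner (hyp_A u) u"
      using PS[OF test_fun_C1c[OF u]] unfolding hyp_inner_hyp_A_energy[OF u] .
    also have "\<dots> \<le> C2 * F\<^sup>2" using H[rule_format, of 1] C2 by (intro mult_left_mono) auto
    also have "\<dots> = (C2 powr (1 / 2) * F)\<^sup>2" using C2 by (simp add: power_mult_distrib powr_half_sqrt)
    also have "\<dots> \<le> (D * F)\<^sup>2" using F C2 by (intro power_mono mult_right_mono) (auto simp: D_def)
    finally have "(hyp_Lp p1 u powr (2 / p1)) powr (p1 / 2) \<le> ((D * F)\<^sup>2) powr (p1 / 2)"
      using p1 by (intro powr_mono2) auto
    also have "(hyp_Lp p1 u powr (2 / p1)) powr (p1 / 2) = hyp_Lp p1 u"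
      using p1 hyp_Lp_nonneg[of p1 u] by (simp add: powr_powr)
    also have "((D * F)\<^sup>2) powr (p1 / 2) = ((D * F) powr 2) powr (p1 / 2)" using DF by simp
    also have "\<dots> = (D * F) powr p1" by (simp add: powr_powr)
    finally have 2: "hyp_Lp p1 u \<le> (D * F) powr p1" .
    have "hyp_Lp r u \<le> C3 * (D * F) powr r" by (rule step[OF u DF 1 2])
    also have "\<dots> = C3 * D powr r * F powr r" using D F by (simp add: powr_mult)
    finally show "hyp_Lp (2 * real CARD('n) / (real CARD('n) - 2 * real (Suc (Suc k)))) u
      \<le> C3 * D powr r * F powr (2 * real CARD('n) / (real CARD('n) - 2 * real (Suc (Suc k))))"
      unfolding r_def N_def .
  qed (use C3 D in simp)
qed

section \<open>Passage to the hyperbolic measure and conclusion\<close>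

lemma integral_hyp_vol:
  fixes f :: "real ^ 'n::finite \<Rightarrow> real"
  assumes f: "continuous_on UNIV f" and z: "\<And>x. x \<notin> ball 0 1 \<Longrightarrow> f x = 0"
  shows "(\<integral>x. f x \<partial>hyp_vol) = (\<integral>x. rho x powr (- real CARD('n)) * f x \<partial>lborel)"
proof -
  have [measurable]: "f \<in> borel_measurable borel" using f by (rule borel_measurable_continuous_onI)
  let ?d = "\<lambda>x::real ^ 'n. (2 / (1 - (norm x)\<^sup>2)) ^ CARD('n)"
  have d: "?d x = rho x powr (- real CARD('n))" if "x \<in> ball 0 1" for x
  proof -
    have "2 / (1 - (norm x)\<^sup>2) = inverse (rho x)" by (simp add: rho_def inverse_eq_divide)
    then show ?thesis
      using rho_pos[OF that] by (simp add: powr_minus powr_realpow power_inverse)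
  qed
  have "(\<integral>x. f x \<partial>hyp_vol) = (\<integral>x. ?d x *\<^sub>R f x \<partial>restrict_space lborel (ball 0 1))"
    unfolding hyp_vol_def
  proof (rule integral_density)
    show "AE x in restrict_space lborel (ball 0 1). 0 \<le> ?d x"
      using d by (intro AE_I2) (auto simp: space_restrict_space)
  qed (auto intro!: measurable_restrict_space1)
  also have "\<dots> = (\<integral>x. indicator (ball 0 1) x *\<^sub>R (?d x *\<^sub>R f x) \<partial>lborel)"
    by (rule integral_restrict_space) auto
  also have "\<dots> = (\<integral>x. rho x powr (- real CARD('n)) * f x \<partial>lborel)"
    by (rule Bochner_Integration.integral_cong) (auto simp: indicator_def d z)
  finally show ?thesis .
qed

theorem theorem1p1:
  fixes k :: nat and p :: real
  assumes "2 \<le> k" and "real k < real CARD('n::finite) / 2"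
    and "2 < p" and "p \<le> 2 * real CARD('n) / (real CARD('n) - 2 * real k)"
  shows "\<exists>C>0. \<forall>u \<in> (test_functions :: (real ^ 'n \<Rightarrow> real) set).
    (\<integral>x. hyp_Q k u x * u x \<partial>hyp_vol) \<ge> C * (\<integral>x. \<bar>u x\<bar> powr p \<partial>hyp_vol) powr (2 / p)"
proof -
  define N where "N = real CARD('n)"
  have N: "N > 2 * real k" "N \<ge> 4" and n: "CARD('n) \<ge> 3" using assms(1,2) by (auto simp: N_def)
  have k: "1 \<le> k" using assms(1) by simp
  define p1 where "p1 = 2 * N / (N - 2)"
  define pk where "pk = 2 * N / (N - 2 * real k)"
  have "\<exists>C>0. \<forall>u :: real ^ 'n \<Rightarrow> real. test_fun u \<longrightarrow> hyp_Lp p u powr (2 / p) \<le> C * hyp_inner (hyp_Q k u) u"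
  proof (cases "p \<le> p1")
    case True
    then obtain C where C: "C > 0" and PS: "\<And>(w :: real ^ 'n \<Rightarrow> real) w'. C1c (ball 0 1) w w' \<Longrightarrow> hyp_Lp p w powr (2 / p) \<le> C * hyp_energy w w'"
      using hyp_poincare_sobolev[OF n assms(3)] unfolding p1_def N_def by auto
    show ?thesis
    proof (intro exI[of _ C] conjI allI impI C)
      fix u :: "real ^ 'n \<Rightarrow> real" assume u: "test_fun u"
      have "hyp_Lp p u powr (2 / p) \<le> C * hyp_inner (hyp_A u) u"
        using PS[OF test_fun_C1c[OF u]] unfolding hyp_inner_hyp_A_energy[OF u] .
      also have "\<dots> \<le> C * hyp_inner (hyp_Q k u) u"
        using hyp_Q_lower_bound[OF k u, of 1 0] k C by (intro mult_left_mono) auto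
      finally show "hyp_Lp p u powr (2 / p) \<le> C * hyp_inner (hyp_Q k u) u" .
    qed
  next
    case False
    have k1: "2 * real (Suc 0) < real CARD('n)" "2 * real k < real CARD('n)" using N by (auto simp: N_def)
    obtain C1 where C1: "C1 > 0" and L1: "\<And>(u :: real ^ 'n \<Rightarrow> real) F. test_fun u \<Longrightarrow> F > 0 \<Longrightarrow>
      (\<And>j. min 1 (Suc 0) \<le> j \<and> j \<le> Suc 0 \<Longrightarrow> hyp_inner ((hyp_A ^^ j) u) u \<le> F\<^sup>2) \<Longrightarrow> hyp_Lp p1 u \<le> C1 * F powr p1"
      using moments_control_Lp[OF n k1(1)] unfolding p1_def N_def by auto
    obtain C2 where C2: "C2 > 0" and L2: "\<And>(u :: real ^ 'n \<Rightarrow> real) F. test_fun u \<Longrightarrow> F > 0 \<Longrightarrow>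
      (\<And>j. min 1 k \<le> j \<and> j \<le> k \<Longrightarrow> hyp_inner ((hyp_A ^^ j) u) u \<le> F\<^sup>2) \<Longrightarrow> hyp_Lp pk u \<le> C2 * F powr pk"
      using moments_control_Lp[OF n k1(2)] unfolding pk_def N_def by auto
    have p1: "0 < p1" "p1 \<le> p" "p \<le> pk" using False assms(3,4) N by (auto simp: p1_def pk_def N_def)
    define C where "C = (C1 + C2) powr (2 / p)"
    have C: "C > 0" using C1 C2 by (simp add: C_def)
    show ?thesis
    proof (intro exI[of _ C] conjI allI impI C)
      fix u :: "real ^ 'n \<Rightarrow> real" assume u: "test_fun u"
      define E where "E = hyp_inner (hyp_Q k u) u"
      have mom: "hyp_inner ((hyp_A ^^ j) u) u \<le> E" if "1 \<le> j" "j \<le> k" for j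
        using hyp_Q_lower_bound[OF k u that, of 0] by (simp add: E_def)
      have E0: "E \<ge> 0" using mom[of 1] k hyp_A_pow_nonneg[OF u, of 1] by simp
      have cu: "Cc (ball 0 1) u" using u by (simp add: test_fun_def)
      \<comment> \<open>The norm bounds require F > 0, but \<open>E\<close> is only known to be
        nonnegative; hence the detour through numbers G > E.\<close>
      have bound: "hyp_Lp p u powr (2 / p) \<le> C * G" if G: "G > E" for G
      proof -
        define F where "F = sqrt G"
        have F: "F > 0" "F\<^sup>2 = G" using G E0 by (auto simp: F_def)
        have momF: "hyp_inner ((hyp_A ^^ j) u) u \<le> F\<^sup>2" if "1 \<le> j" "j \<le> k" for j
          using mom[OF that] G F by simp
        have B1: "hyp_Lp p1 u \<le> C1 * F powr p1" using k by (intro L1 u F momF) auto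
        have B2: "hyp_Lp pk u \<le> C2 * F powr pk" using k by (intro L2 u F momF) auto
        have "hyp_Lp p u / F powr p = (\<integral>x. rho x powr (- N) * (\<bar>u x\<bar> / F) powr p \<partial>lborel)"
          unfolding N_def hyp_Lp_scale[OF F(1)] ..
        also have "\<dots> \<le> (\<integral>x. rho x powr (- N) * (\<bar>u x\<bar> / F) powr p1 + rho x powr (- N) * (\<bar>u x\<bar> / F) powr pk \<partial>lborel)"
        proof (intro integral_mono)
          show "integrable lborel (\<lambda>x. rho x powr (- N) * (\<bar>u x\<bar> / F) powr p)"
            unfolding N_def using p1 by (intro hyp_Lp_integrable_scale cu F) auto
          show "integrable lborel (\<lambda>x. rho x powr (- N) * (\<bar>u x\<bar> / F) powr p1 + rho x powr (- N) * (\<bar>u x\<bar> / F) powr pk)"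
            unfolding N_def using p1 by (intro Bochner_Integration.integrable_add hyp_Lp_integrable_scale cu F) auto
          fix x
          \<comment> \<open>Interpolation between \<open>p1\<close> and \<open>pk\<close> without
            Hoelder: the lower exponent dominates for y \<le> 1, the upper one for y > 1.\<close>
          have "y powr p \<le> y powr p1 + y powr pk" if "y \<ge> 0" for y :: real
          proof (cases "y \<le> 1")
            case True
            have "y powr p \<le> y powr p1" using that True p1 by (cases "y = 0") (auto intro: powr_mono')
            then show ?thesis by (simp add: add_increasing2)
          next
            case False
            have "y powr p \<le> y powr pk" using False p1 by (intro powr_mono) auto
            then show ?thesis by (simp add: add_increasing)
          qed
          from mult_left_mono[OF this[of "\<bar>u x\<bar> / F"], of "rho x powr (- N)"]
          show "rho x powr (- N) * (\<bar>u x\<bar> / F) powr p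
            \<le> rho x powr (- N) * (\<bar>u x\<bar> / F) powr p1 + rho x powr (- N) * (\<bar>u x\<bar> / F) powr pk"
            using F by (simp add: distrib_left)
        qed
        also have "\<dots> = hyp_Lp p1 u / F powr p1 + hyp_Lp pk u / F powr pk"
          unfolding N_def using p1 hyp_Lp_integrable_scale[OF cu _ F(1), of p1] hyp_Lp_integrable_scale[OF cu _ F(1), of pk]
          by (simp add: hyp_Lp_scale[OF F(1)])
        also have "\<dots> \<le> C1 + C2"
          using B1 B2 F by (intro add_mono) (auto simp: divide_le_eq)
        finally have "hyp_Lp p u \<le> (C1 + C2) * F powr p" using F by (simp add: divide_le_eq)
        then have "hyp_Lp p u powr (2 / p) \<le> ((C1 + C2) * F powr p) powr (2 / p)"
          using assms(3) by (intro powr_mono2 hyp_Lp_nonneg) auto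
        also have "\<dots> = C * F powr 2"
          using C1 C2 F assms(3) by (simp add: C_def powr_mult powr_powr)
        also have "\<dots> = C * G" using F by simp
        finally show ?thesis .
      qed
      show "hyp_Lp p u powr (2 / p) \<le> C * E"
      proof (rule field_le_epsilon)
        fix e :: real assume e: "e > 0"
        have "hyp_Lp p u powr (2 / p) \<le> C * (E + e / C)" using e C by (intro bound) auto
        also have "\<dots> = C * E + e" using C by (simp add: algebra_simps)
        finally show "hyp_Lp p u powr (2 / p) \<le> C * E + e" .
      qed
    qed
  qed
  then obtain C where C: "C > 0"
    and main: "\<And>u :: real ^ 'n \<Rightarrow> real. test_fun u \<Longrightarrow> hyp_Lp p u powr (2 / p) \<le> C * hyp_inner (hyp_Q k u) u"
    by blast
  show ?thesis
  proof (intro exI[of _ "1 / C"] conjI ballI)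
    fix u :: "real ^ 'n \<Rightarrow> real" assume "u \<in> test_functions"
    then have u: "test_fun u" by (rule test_functions_test_fun)
    then have cu: "Cc (ball 0 1) u" by (simp add: test_fun_def)
    have "test_fun (hyp_Q k u)" using hyp_Q_test_linear[OF k u u] by blast
    then have cQ: "Cc (ball 0 1) (\<lambda>x. hyp_Q k u x * u x)"
      by (intro Cc_mult(2)[OF cu]) (auto simp: test_fun_def Cc_continuous_on)
    have zero: "u x = 0" if "x \<notin> ball 0 1" for x using C1c_outside[OF test_fun_C1c[OF u] that] by simp
    have 1: "(\<integral>x. hyp_Q k u x * u x \<partial>hyp_vol) = hyp_inner (hyp_Q k u) u"
      unfolding hyp_inner_def using zero by (intro integral_hyp_vol Cc_extend[OF cQ open_ball]) auto
    have "Cc (ball 0 1) (\<lambda>x. \<bar>u x\<bar> powr p)" using assms(3) by (intro Cc_abs_powr cu) auto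
    then have 2: "(\<integral>x. \<bar>u x\<bar> powr p \<partial>hyp_vol) = hyp_Lp p u"
      unfolding hyp_Lp_def using zero assms(3) by (intro integral_hyp_vol Cc_extend[OF _ open_ball]) auto
    show "1 / C * (\<integral>x. \<bar>u x\<bar> powr p \<partial>hyp_vol) powr (2 / p) \<le> (\<integral>x. hyp_Q k u x * u x \<partial>hyp_vol)"
      unfolding 1 2 using main[OF u] C by (simp add: divide_le_eq mult.commute)
  qed (use C in simp)
qed

end
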